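(* Let $k$ be a field of characteristic not $2$ with $cd(k)\le 1$, and let $G$ be a group of type $G_2$ over $k$. Then every semisimple element in $G(k)$ is a product of two involutions in $G(k)$.
   Context: The condition $cd(k)\le1$ is used in the form: $\mathrm{Br}(K)=0$ for every algebraic field extension $K$ of $k$. A group of type $G_2$ over $k$ is $\mathrm{Aut}(\mathfrak C)$ for an octonion algebra $\mathfrak C$ over $k$ (an $8$-dimensional unital $k$-algebra with a nondegenerate quadratic form $N$ satisfying $N(xy)=N(x)N(y)$). An involution in $G(k)$ is an element $g\in G(k)$ with $g^2=1$. *)

theory Defs
  imports
    "HOL-Algebra.Algebra"
    "HOL-Algebra.Algebraic_Closure_Type"
    "Jordan_Normal_Form.Matrix"
begin

section \<open>Brauer groups\<close>

text \<open>The HOL-Algebra locale \<open>algebra\<close> is restricted to commutative algebras, hence:\<close>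

locale assoc_algebra = module F A + ring A
  for F :: "('k, 'm) ring_scheme" and A :: "('k, 'a, 'n) module_scheme" +
  assumes smult_mult_left:
    "\<lbrakk>a \<in> carrier F; x \<in> carrier A; y \<in> carrier A\<rbrakk> \<Longrightarrow>
      (a \<odot>\<^bsub>A\<^esub> x) \<otimes>\<^bsub>A\<^esub> y = a \<odot>\<^bsub>A\<^esub> (x \<otimes>\<^bsub>A\<^esub> y)"
  and smult_mult_right:
    "\<lbrakk>a \<in> carrier F; x \<in> carrier A; y \<in> carrier A\<rbrakk> \<Longrightarrow>
      x \<otimes>\<^bsub>A\<^esub> (a \<odot>\<^bsub>A\<^esub> y) = a \<odot>\<^bsub>A\<^esub> (x \<otimes>\<^bsub>A\<^esub> y)"

definition finite_dimensional :: "('k, 'm) ring_scheme \<Rightarrow> ('k, 'a, 'n) module_scheme \<Rightarrow> bool" where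
  "finite_dimensional F A \<longleftrightarrow>
     (\<exists>B. finite B \<and> B \<subseteq> carrier A \<and>
        (\<forall>x\<in>carrier A. \<exists>c\<in>B \<rightarrow> carrier F. x = (\<Oplus>\<^bsub>A\<^esub>b\<in>B. c b \<odot>\<^bsub>A\<^esub> b)))"

definition ring_center :: "('a, 'n) ring_scheme \<Rightarrow> 'a set" where
  "ring_center A = {z \<in> carrier A. \<forall>x\<in>carrier A. z \<otimes>\<^bsub>A\<^esub> x = x \<otimes>\<^bsub>A\<^esub> z}"

definition simple_ring :: "('a, 'n) ring_scheme \<Rightarrow> bool" where
  "simple_ring A \<longleftrightarrow>
     ring A \<and> \<one>\<^bsub>A\<^esub> \<noteq> \<zero>\<^bsub>A\<^esub> \<and> (\<forall>I. ideal I A \<longrightarrow> I = {\<zero>\<^bsub>A\<^esub>} \<or> I = carrier A)"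

definition central_simple_algebra :: "('k, 'm) ring_scheme \<Rightarrow> ('k, 'a, 'n) module_scheme \<Rightarrow> bool" where
  "central_simple_algebra F A \<longleftrightarrow>
     field F \<and> assoc_algebra F A \<and> finite_dimensional F A \<and>
     ring_center A = (\<lambda>a. a \<odot>\<^bsub>A\<^esub> \<one>\<^bsub>A\<^esub>) ` carrier F \<and> simple_ring A"

definition self_algebra :: "('k, 'm) ring_scheme \<Rightarrow> ('k, 'k) module" where
  "self_algebra F =
     \<lparr>carrier = carrier F, monoid.mult = monoid.mult F, one = \<one>\<^bsub>F\<^esub>,
      ring.zero = \<zero>\<^bsub>F\<^esub>, add = add F, module.smult = monoid.mult F\<rparr>"

definition matrix_algebra ::
    "nat \<Rightarrow> ('k, 'a, 'n) module_scheme \<Rightarrow> ('k, nat \<times> nat \<Rightarrow> 'a) module" where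
  "matrix_algebra n A =
     \<lparr>carrier = {..<n} \<times> {..<n} \<rightarrow>\<^sub>E carrier A,
      monoid.mult = (\<lambda>u v. restrict (\<lambda>(i, j). \<Oplus>\<^bsub>A\<^esub>l\<in>{..<n}. u (i, l) \<otimes>\<^bsub>A\<^esub> v (l, j))
                              ({..<n} \<times> {..<n})),
      one = restrict (\<lambda>(i, j). if i = j then \<one>\<^bsub>A\<^esub> else \<zero>\<^bsub>A\<^esub>) ({..<n} \<times> {..<n}),
      ring.zero = (\<lambda>p\<in>{..<n} \<times> {..<n}. \<zero>\<^bsub>A\<^esub>),
      add = (\<lambda>u v. \<lambda>p\<in>{..<n} \<times> {..<n}. u p \<oplus>\<^bsub>A\<^esub> v p),
      module.smult = (\<lambda>a u. \<lambda>p\<in>{..<n} \<times> {..<n}. a \<odot>\<^bsub>A\<^esub> u p)\<rparr>"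

definition algebra_isomorphic ::
    "('k, 'm) ring_scheme \<Rightarrow> ('k, 'a, 'n) module_scheme \<Rightarrow> ('k, 'b, 'p) module_scheme \<Rightarrow> bool" where
  "algebra_isomorphic F A B \<longleftrightarrow>
     (\<exists>h\<in>ring_iso A B. \<forall>a\<in>carrier F. \<forall>x\<in>carrier A. h (a \<odot>\<^bsub>A\<^esub> x) = a \<odot>\<^bsub>B\<^esub> h x)"

definition brauer_equivalent ::
    "('k, 'm) ring_scheme \<Rightarrow> ('k, 'a, 'n) module_scheme \<Rightarrow> ('k, 'b, 'p) module_scheme \<Rightarrow> bool" where
  "brauer_equivalent F A B \<longleftrightarrow>
     (\<exists>m>0. \<exists>n>0. algebra_isomorphic F (matrix_algebra m A) (matrix_algebra n B))"

text \<open>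
  \<open>Br(F) = 0\<close>: every central simple algebra has the Brauer class of \<open>F\<close>. The type of the
  elements of \<open>A\<close> is no restriction up to isomorphism: an algebra of dimension \<open>d\<close> over \<open>F\<close> can
  be transported to the functions \<open>nat \<Rightarrow> 'l\<close> that take values in \<open>F\<close> and vanish from \<open>d\<close> on.
\<close>

definition brauer_group_trivial :: "('l, 'm) ring_scheme \<Rightarrow> bool" where
  "brauer_group_trivial F \<longleftrightarrow>
     (\<forall>A :: ('l, nat \<Rightarrow> 'l) module.
        central_simple_algebra F A \<longrightarrow> brauer_equivalent F A (self_algebra F))"

text \<open>
  The condition \<open>cd(k) \<le> 1\<close>, in the form \<open>Br(K) = 0\<close> for all algebraic extensions \<open>K\<close> of \<open>k\<close>.
  Up to \<open>k\<close>-isomorphism, these are the intermediate fields of the algebraic closure of \<open>k\<close>.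
\<close>

definition cd_le_one :: "'k :: field itself \<Rightarrow> bool" where
  "cd_le_one _ \<longleftrightarrow>
     (\<forall>K. subfield K (ring_of_type_algebra :: 'k alg_closure ring) \<and> range to_ac \<subseteq> K \<longrightarrow>
        brauer_group_trivial
          ((ring_of_type_algebra :: 'k alg_closure ring)\<lparr>carrier := K\<rparr>))"

section \<open>Semisimple endomorphisms\<close>

definition is_basis_list :: "('a :: field \<Rightarrow> 'b :: ab_group_add \<Rightarrow> 'b) \<Rightarrow> 'b list \<Rightarrow> bool" where
  "is_basis_list scale bs \<longleftrightarrow>
     distinct bs \<and> \<not> Modules.module.dependent scale (set bs) \<and>
     Modules.module.span scale (set bs) = UNIV"

definition matrix_of ::
    "('a :: field \<Rightarrow> 'b :: ab_group_add \<Rightarrow> 'b) \<Rightarrow> 'b list \<Rightarrow> ('b \<Rightarrow> 'b) \<Rightarrow> 'a mat" where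
  "matrix_of scale bs f =
     mat (length bs) (length bs)
       (\<lambda>(i, j). Modules.module.representation scale (set bs) (f (bs ! j)) (bs ! i))"

text \<open>
  Semisimplicity in the sense of algebraic groups: \<open>f\<close> becomes diagonalizable over the algebraic
  closure. Over an imperfect field this is stronger than semisimplicity of \<open>f\<close> over the base field.
\<close>

definition semisimple_endo :: "('a :: field \<Rightarrow> 'b :: ab_group_add \<Rightarrow> 'b) \<Rightarrow> ('b \<Rightarrow> 'b) \<Rightarrow> bool" where
  "semisimple_endo scale f \<longleftrightarrow>
     Vector_Spaces.linear scale scale f \<and>
     (\<exists>bs D. is_basis_list scale bs \<and> diagonal_mat D \<and>
        similar_mat (map_mat to_ac (matrix_of scale bs f)) D)"

section \<open>Quadratic forms\<close>

definition polar_form :: "('b :: ab_group_add \<Rightarrow> 'a :: field) \<Rightarrow> 'b \<Rightarrow> 'b \<Rightarrow> 'a" where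
  "polar_form N x y = N (x + y) - N x - N y"

definition quadratic_form ::
    "('a :: field \<Rightarrow> 'b :: ab_group_add \<Rightarrow> 'b) \<Rightarrow> ('b \<Rightarrow> 'a) \<Rightarrow> bool" where
  "quadratic_form scale N \<longleftrightarrow>
     (\<forall>a x. N (scale a x) = a\<^sup>2 * N x) \<and>
     (\<forall>y. Vector_Spaces.linear scale (*) (\<lambda>x. polar_form N x y)) \<and>
     (\<forall>x. Vector_Spaces.linear scale (*) (\<lambda>y. polar_form N x y))"

definition nondegenerate :: "('b :: ab_group_add \<Rightarrow> 'a :: field) \<Rightarrow> bool" where
  "nondegenerate N \<longleftrightarrow> (\<forall>x. (\<forall>y. polar_form N x y = 0) \<longrightarrow> x = 0)"

section \<open>Octonion algebras and groups of type \<open>G\<^sub>2\<close>\<close>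

locale octonion_algebra = vector_space scale
  for scale :: "'a :: field \<Rightarrow> 'c :: ab_group_add \<Rightarrow> 'c" +
  fixes mul :: "'c \<Rightarrow> 'c \<Rightarrow> 'c" and e :: 'c
  assumes dim_eq_8: "dim UNIV = 8"
  and linear_left: "Vector_Spaces.linear scale scale (\<lambda>x. mul x y)"
  and linear_right: "Vector_Spaces.linear scale scale (mul x)"
  and unit_left: "mul e x = x"
  and unit_right: "mul x e = x"
  and ex_norm: "\<exists>N. quadratic_form scale N \<and> nondegenerate N \<and> (\<forall>x y. N (mul x y) = N x * N y)"
begin

text \<open>The group of rational points of the algebraic group \<open>Aut\<close> of the octonion algebra.\<close>

definition aut_group :: "('c \<Rightarrow> 'c) monoid" where
  "aut_group =
     \<lparr>carrier = {g. bij g \<and> Vector_Spaces.linear scale scale g \<and> g e = e \<and>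
                    (\<forall>x y. g (mul x y) = mul (g x) (g y))},
      monoid.mult = (\<circ>), one = id\<rparr>"

end

definition involution :: "('g, 'm) monoid_scheme \<Rightarrow> 'g \<Rightarrow> bool" where
  "involution G s \<longleftrightarrow> s \<in> carrier G \<and> s \<otimes>\<^bsub>G\<^esub> s = \<one>\<^bsub>G\<^esub>"

lemma (in octonion_algebra) group_aut_group: "group aut_group"
proof (rule groupI)
  fix f g assume "f \<in> carrier aut_group" "g \<in> carrier aut_group"
  then show "f \<otimes>\<^bsub>aut_group\<^esub> g \<in> carrier aut_group"
    unfolding aut_group_def by (auto intro: bij_comp Vector_Spaces.linear_compose)
next
  show "\<one>\<^bsub>aut_group\<^esub> \<in> carrier aut_group"
    unfolding aut_group_def using linear_id by (auto simp: id_def bij_def inj_on_def)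
next
  fix g assume g: "g \<in> carrier aut_group"
  then have b: "bij g" and l: "Vector_Spaces.linear scale scale g" and ge: "g e = e"
    and m: "\<And>x y. g (mul x y) = mul (g x) (g y)"
    unfolding aut_group_def by auto
  interpret g: Vector_Spaces.linear scale scale g by (fact l)
  let ?h = "inv_into UNIV g"
  have gh: "g (?h x) = x" and hg: "?h (g x) = x" for x
    using b by (simp_all add: bij_is_surj surj_f_inv_f bij_is_inj)
  have hI: "?h x = y" if "g y = x" for x y
    using that hg by auto
  have "Vector_Spaces.linear scale scale ?h"
    by (unfold_locales) (auto intro!: hI simp: g.add g.scale gh)
  moreover have "?h (mul x y) = mul (?h x) (?h y)" for x y
    by (rule hI) (simp add: m gh)
  moreover have "?h e = e"
    by (rule hI) (fact ge)
  ultimately have "?h \<in> carrier aut_group"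
    unfolding aut_group_def using b by (auto intro: bij_imp_bij_inv)
  moreover have "?h \<otimes>\<^bsub>aut_group\<^esub> g = \<one>\<^bsub>aut_group\<^esub>"
    unfolding aut_group_def using hg by auto
  ultimately show "\<exists>h\<in>carrier aut_group. h \<otimes>\<^bsub>aut_group\<^esub> g = \<one>\<^bsub>aut_group\<^esub>"
    by blast
qed (auto simp: aut_group_def)

end

theory Submission
  imports Defs "Jordan_Normal_Form.Determinant"
begin

text \<open>
  The skew operator \<open>g - g\<^sup>-\<^sup>1\<close> on the \<open>7\<close>-dimensional space of pure octonions is singular, and this leads to an
  anisotropic pure octonion \<open>a\<close> fixed by \<open>g\<close>. Over the quadratic algebra \<open>L = k[a]\<close>, the orthogonal complement \<open>W\<close>
  of \<open>L\<close> is free of rank \<open>3\<close> and carries an alternating \<open>L\<close>-trilinear form \<open>T\<close> preserved by \<open>g\<close>, so \<open>g\<close> has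
  a cubic characteristic polynomial over \<open>L\<close> with constant term \<open>-1\<close>. The involution that inverts \<open>g\<close> acts
  as the identity on a quaternion subalgebra \<open>D\<close> orthogonal to \<open>a D\<close> and as \<open>-1\<close> on \<open>a D\<close>.

  If the cubic has a root, semisimplicity provides an anisotropic eigenvector of \<open>g\<close> in \<open>W\<close>, and \<open>D\<close> is written
  down from it. If not, every anisotropic \<open>u\<close> generates \<open>W\<close> over \<open>L[g]\<close>, and a subspace \<open>D\<close> spanned by
  \<open>1\<close>, \<open>g w\<close>, \<open>(g\<^sup>2 + 1) w\<close>, \<open>a (g\<^sup>2 - 1) w\<close> works as soon as \<open>T w (g w) (g\<^sup>2 w) = 1\<close>. Replacing \<open>u\<close> by \<open>w = p(g) u\<close>
  multiplies \<open>T u (g u) (g\<^sup>2 u)\<close> by the norm of \<open>p\<close>, so \<open>w\<close> exists because norms of cubic extensions are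
  surjective: in the cyclic case since cyclic algebras of degree \<open>3\<close> split, and in general after adjoining the
  square root of the discriminant, an extension of degree prime to \<open>3\<close>.\<close>

section \<open>Splitting of central division algebras\<close>

text \<open>It suffices to find an involution \<open>s\<close> with \<open>s g s g = 1\<close>: then
  \<open>s g\<close> is an involution too, and \<open>g = s (s g)\<close>. Anisotropy of
  \<open>a\<close> splits off \<open>L\<close> orthogonally, but \<open>L\<close> may still be
  \<open>k x k\<close>, where nonzero scalars can be zero divisors. Hence the form \<open>T\<close>
  is read through the two homomorphisms \<open>a \<mapsto> r\<close> and
  \<open>a \<mapsto> - r\<close> into the algebraic closure, and the last steps have a split case
  and a field case. An involution that fixes \<open>D\<close> and negates \<open>a D\<close> is
  conjugate-linear over \<open>L\<close>. If it fixes \<open>w0\<close> and exchanges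
  \<open>g w0\<close> with the inverse image of \<open>w0\<close>, then, this permutation being odd,
  the \<open>a\<close>-component of \<open>T\<close> at these three vectors has to vanish. So
  \<open>T\<close> must take a value in \<open>k\<close>; arranging this is the purpose of the norm
  equation, and here the Brauer groups enter. Semisimplicity acts through duality: an eigenvector
  does not lie in the image of the corresponding shift of \<open>g\<close>, so it pairs nontrivially
  with a dual eigenvector; when both have the same eigenvalue, one of the two or their sum is
  anisotropic.\<close>

definition matrix_unit :: "nat \<Rightarrow> ('a, 'n) ring_scheme \<Rightarrow> nat \<Rightarrow> nat \<Rightarrow> 'a \<Rightarrow> nat \<times> nat \<Rightarrow> 'a" where
  "matrix_unit n A i j x =
     restrict (\<lambda>(p, q). if p = i \<and> q = j then x else \<zero>\<^bsub>A\<^esub>) ({..<n} \<times> {..<n})"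

lemma matrix_unit_closed:
  assumes "ring A" "x \<in> carrier A"
  shows "matrix_unit n A i j x \<in> carrier (matrix_algebra n A)"
proof -
  interpret ring A by fact
  show ?thesis using assms by (auto simp: matrix_unit_def matrix_algebra_def)
qed

lemma matrix_unit_mult_left:
  assumes "ring A" "x \<in> carrier A" "V \<in> carrier (matrix_algebra n A)" "p < n" "q < n" "j < n"
  shows "(matrix_unit n A i j x \<otimes>\<^bsub>matrix_algebra n A\<^esub> V) (p, q) =
    (if p = i then x \<otimes>\<^bsub>A\<^esub> V (j, q) else \<zero>\<^bsub>A\<^esub>)"
proof -
  interpret ring A by fact
  have V: "\<And>a b. a < n \<Longrightarrow> b < n \<Longrightarrow> V (a, b) \<in> carrier A"
    using assms by (auto simp: matrix_algebra_def)
  have "(\<Oplus>\<^bsub>A\<^esub>l\<in>{..<n}. matrix_unit n A i j x (p, l) \<otimes>\<^bsub>A\<^esub> V (l, q)) =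
     (\<Oplus>\<^bsub>A\<^esub>l\<in>{..<n}. if j = l then (if p = i then x \<otimes>\<^bsub>A\<^esub> V (l, q) else \<zero>\<^bsub>A\<^esub>) else \<zero>\<^bsub>A\<^esub>)"
    using assms V by (intro add.finprod_cong') (auto simp: matrix_unit_def)
  also have "\<dots> = (if p = i then x \<otimes>\<^bsub>A\<^esub> V (j, q) else \<zero>\<^bsub>A\<^esub>)"
    using assms V by (intro add.finprod_singleton) auto
  finally show ?thesis using assms by (simp add: matrix_algebra_def)
qed

lemma matrix_unit_mult_right:
  assumes "ring A" "x \<in> carrier A" "V \<in> carrier (matrix_algebra n A)" "p < n" "q < n" "i < n"
  shows "(V \<otimes>\<^bsub>matrix_algebra n A\<^esub> matrix_unit n A i j x) (p, q) =
    (if q = j then V (p, i) \<otimes>\<^bsub>A\<^esub> x else \<zero>\<^bsub>A\<^esub>)"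
proof -
  interpret ring A by fact
  have V: "\<And>a b. a < n \<Longrightarrow> b < n \<Longrightarrow> V (a, b) \<in> carrier A"
    using assms by (auto simp: matrix_algebra_def)
  have "(\<Oplus>\<^bsub>A\<^esub>l\<in>{..<n}. V (p, l) \<otimes>\<^bsub>A\<^esub> matrix_unit n A i j x (l, q)) =
     (\<Oplus>\<^bsub>A\<^esub>l\<in>{..<n}. if i = l then (if q = j then V (p, l) \<otimes>\<^bsub>A\<^esub> x else \<zero>\<^bsub>A\<^esub>) else \<zero>\<^bsub>A\<^esub>)"
    using assms V by (intro add.finprod_cong') (auto simp: matrix_unit_def)
  also have "\<dots> = (if q = j then V (p, i) \<otimes>\<^bsub>A\<^esub> x else \<zero>\<^bsub>A\<^esub>)"
    using assms V by (intro add.finprod_singleton) auto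
  finally show ?thesis using assms by (simp add: matrix_algebra_def)
qed

lemma matrix_algebra_mult_closed:
  assumes "ring A" "U \<in> carrier (matrix_algebra n A)" "V \<in> carrier (matrix_algebra n A)"
  shows "U \<otimes>\<^bsub>matrix_algebra n A\<^esub> V \<in> carrier (matrix_algebra n A)"
proof -
  interpret ring A by fact
  show ?thesis using assms(2,3)
    by (auto simp: matrix_algebra_def PiE_def Pi_def intro!: finsum_closed)
qed

lemma ring_self_algebra:
  assumes "ring F"
  shows "ring (self_algebra F)"
proof -
  interpret F: ring F by fact
  show ?thesis
  proof (rule ringI)
    show "abelian_group (self_algebra F)"
    proof (rule abelian_groupI)
      fix x assume "x \<in> carrier (self_algebra F)"
      then show "\<exists>y\<in>carrier (self_algebra F). y \<oplus>\<^bsub>self_algebra F\<^esub> x = \<zero>\<^bsub>self_algebra F\<^esub>"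
        by (intro bexI[of _ "\<ominus>\<^bsub>F\<^esub> x"]) (auto simp: self_algebra_def F.l_neg)
    qed (auto simp: self_algebra_def intro: F.a_assoc F.a_comm)
    show "Group.monoid (self_algebra F)"
      by (unfold_locales) (auto simp: self_algebra_def F.m_assoc)
  qed (auto simp: self_algebra_def F.l_distr F.r_distr)
qed

text \<open>In a matrix algebra over \<open>F\<close>, the idempotent \<open>E\<close> has the
  property that \<open>E Z E\<close> is always a scalar multiple of \<open>E\<close>. The
  isomorphism carries this property to a matrix \<open>U\<close> over \<open>A\<close>. Any nonzero
  entry \<open>a\<close> of \<open>U\<close> then satisfies \<open>a y a = c a\<close> for every
  \<open>y\<close>, and cancelling \<open>a\<close> shows that \<open>A\<close> consists of
  scalars.\<close>

lemma central_division_algebra_trivial: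
  fixes F :: "('l, 'm) ring_scheme" and A :: "('l, nat \<Rightarrow> 'l) module"
  assumes brauer: "brauer_group_trivial F" and csa: "central_simple_algebra F A"
    and inv: "\<And>x. x \<in> carrier A \<Longrightarrow> x \<noteq> \<zero>\<^bsub>A\<^esub> \<Longrightarrow> \<exists>y\<in>carrier A. y \<otimes>\<^bsub>A\<^esub> x = \<one>\<^bsub>A\<^esub>"
    and x: "x \<in> carrier A"
  shows "\<exists>c\<in>carrier F. x = c \<odot>\<^bsub>A\<^esub> \<one>\<^bsub>A\<^esub>"
proof -
  interpret F: field F using csa by (simp add: central_simple_algebra_def)
  interpret A: assoc_algebra F A using csa by (simp add: central_simple_algebra_def)
  have rA: "ring A" by (rule A.ring_axioms)
  have rF: "ring (self_algebra F)" by (rule ring_self_algebra) (rule F.ring_axioms)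
  from brauer csa have "brauer_equivalent F A (self_algebra F)"
    by (simp add: brauer_group_trivial_def)
  then obtain m n h where "m > 0" and n: "n > 0"
    and h: "h \<in> ring_iso (matrix_algebra m A) (matrix_algebra n (self_algebra F))"
    and hs: "\<And>a Z. a \<in> carrier F \<Longrightarrow> Z \<in> carrier (matrix_algebra m A) \<Longrightarrow>
       h (a \<odot>\<^bsub>matrix_algebra m A\<^esub> Z) = a \<odot>\<^bsub>matrix_algebra n (self_algebra F)\<^esub> h Z"
    by (auto simp: brauer_equivalent_def algebra_isomorphic_def)
  let ?MA = "matrix_algebra m A" and ?MF = "matrix_algebra n (self_algebra F)"
  have hbij: "bij_betw h (carrier ?MA) (carrier ?MF)"
    and hmult: "\<And>Z Y. Z \<in> carrier ?MA \<Longrightarrow> Y \<in> carrier ?MA \<Longrightarrow>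
      h (Z \<otimes>\<^bsub>?MA\<^esub> Y) = h Z \<otimes>\<^bsub>?MF\<^esub> h Y"
    using h by (simp_all add: ring_iso_def Ring.ring_hom_mult[of h ?MA ?MF])
  define E where "E = matrix_unit n (self_algebra F) 0 0 \<one>\<^bsub>F\<^esub>"
  have Ec: "E \<in> carrier ?MF"
    unfolding E_def by (rule matrix_unit_closed[OF rF]) (simp add: self_algebra_def)
  have ExE: "(E \<otimes>\<^bsub>?MF\<^esub> Z) \<otimes>\<^bsub>?MF\<^esub> E = Z (0, 0) \<odot>\<^bsub>?MF\<^esub> E"
    and X00: "Z (0, 0) \<in> carrier F" if Z: "Z \<in> carrier ?MF" for Z
  proof -
    have c1: "\<one>\<^bsub>F\<^esub> \<in> carrier (self_algebra F)" by (simp add: self_algebra_def)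
    show X00: "Z (0, 0) \<in> carrier F" using Z n by (auto simp: matrix_algebra_def self_algebra_def)
    have EX: "E \<otimes>\<^bsub>?MF\<^esub> Z \<in> carrier ?MF" by (rule matrix_algebra_mult_closed[OF rF Ec Z])
    have "((E \<otimes>\<^bsub>?MF\<^esub> Z) \<otimes>\<^bsub>?MF\<^esub> E) (p, q) = (Z (0, 0) \<odot>\<^bsub>?MF\<^esub> E) (p, q)" for p q
    proof (cases "p < n \<and> q < n")
      case True
      have "((E \<otimes>\<^bsub>?MF\<^esub> Z) \<otimes>\<^bsub>?MF\<^esub> E) (p, q) =
         (if q = 0 then (E \<otimes>\<^bsub>?MF\<^esub> Z) (p, 0) \<otimes>\<^bsub>self_algebra F\<^esub> \<one>\<^bsub>F\<^esub> else \<zero>\<^bsub>self_algebra F\<^esub>)"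
        unfolding E_def using True n
        by (subst matrix_unit_mult_right[OF rF c1 EX[unfolded E_def]]) auto
      also have "(E \<otimes>\<^bsub>?MF\<^esub> Z) (p, 0) =
         (if p = 0 then \<one>\<^bsub>F\<^esub> \<otimes>\<^bsub>self_algebra F\<^esub> Z (0, 0) else \<zero>\<^bsub>self_algebra F\<^esub>)"
        unfolding E_def using True n by (subst matrix_unit_mult_left[OF rF c1 Z]) auto
      finally show ?thesis using True X00 n
        by (auto simp: matrix_algebra_def E_def matrix_unit_def self_algebra_def)
    next
      case False
      then show ?thesis by (auto simp: matrix_algebra_def)
    qed
    then show "(E \<otimes>\<^bsub>?MF\<^esub> Z) \<otimes>\<^bsub>?MF\<^esub> E = Z (0, 0) \<odot>\<^bsub>?MF\<^esub> E"
      by auto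
  qed
  have "E \<in> h ` carrier ?MA"
    using Ec bij_betw_imp_surj_on[OF hbij] by simp
  then obtain U where U: "U \<in> carrier ?MA" "h U = E"
    by (elim imageE) auto
  have UXU: "\<exists>c\<in>carrier F. (U \<otimes>\<^bsub>?MA\<^esub> Z) \<otimes>\<^bsub>?MA\<^esub> U = c \<odot>\<^bsub>?MA\<^esub> U" if Z: "Z \<in> carrier ?MA" for Z
  proof -
    have hX: "h Z \<in> carrier ?MF" using hbij Z by (auto simp: bij_betw_def)
    have c: "(U \<otimes>\<^bsub>?MA\<^esub> Z) \<in> carrier ?MA" "(U \<otimes>\<^bsub>?MA\<^esub> Z) \<otimes>\<^bsub>?MA\<^esub> U \<in> carrier ?MA"
      using Z U matrix_algebra_mult_closed[OF rA] by auto
    have "h ((U \<otimes>\<^bsub>?MA\<^esub> Z) \<otimes>\<^bsub>?MA\<^esub> U) = h (h Z (0, 0) \<odot>\<^bsub>?MA\<^esub> U)"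
      using Z U c hX X00[OF hX] by (simp add: hmult hs ExE)
    moreover have "h Z (0, 0) \<odot>\<^bsub>?MA\<^esub> U \<in> carrier ?MA"
      using U(1) X00[OF hX] by (auto simp: matrix_algebra_def)
    ultimately have "(U \<otimes>\<^bsub>?MA\<^esub> Z) \<otimes>\<^bsub>?MA\<^esub> U = h Z (0, 0) \<odot>\<^bsub>?MA\<^esub> U"
      using hbij c by (auto simp: bij_betw_def inj_on_def)
    with X00[OF hX] show ?thesis by blast
  qed
  have "\<exists>i<m. \<exists>j<m. U (i, j) \<noteq> \<zero>\<^bsub>A\<^esub>"
  proof (rule ccontr)
    assume neg: "\<not> ?thesis"
    have "U = \<zero>\<^bsub>F\<^esub> \<odot>\<^bsub>?MA\<^esub> U"
    proof
      fix p :: "nat \<times> nat"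
      obtain i j where p: "p = (i, j)" by (cases p)
      show "U p = (\<zero>\<^bsub>F\<^esub> \<odot>\<^bsub>?MA\<^esub> U) p"
        using neg U(1) by (cases "i < m \<and> j < m") (auto simp: p matrix_algebra_def PiE_def extensional_def)
    qed
    then have "E = \<zero>\<^bsub>F\<^esub> \<odot>\<^bsub>?MF\<^esub> E"
      using U hs[of "\<zero>\<^bsub>F\<^esub>" U] by simp
    then have "E (0, 0) = (\<zero>\<^bsub>F\<^esub> \<odot>\<^bsub>?MF\<^esub> E) (0, 0)" by simp
    then show False using n
      by (simp add: matrix_algebra_def E_def matrix_unit_def self_algebra_def)
  qed
  then obtain i j where ij: "i < m" "j < m" and nz: "U (i, j) \<noteq> \<zero>\<^bsub>A\<^esub>" by blast
  define a where "a = U (i, j)"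
  have a: "a \<in> carrier A" "a \<noteq> \<zero>\<^bsub>A\<^esub>"
    using U(1) ij nz by (auto simp: a_def matrix_algebra_def)
  have axa: "\<exists>c\<in>carrier F. (a \<otimes>\<^bsub>A\<^esub> y) \<otimes>\<^bsub>A\<^esub> a = c \<odot>\<^bsub>A\<^esub> a" if y: "y \<in> carrier A" for y
  proof -
    \<comment> \<open>The swapped indices isolate one entry: at position \<open>(i, j)\<close>, the
      product \<open>U Z U\<close> is \<open>U (i, j)\<close> times \<open>y\<close> times
      \<open>U (i, j)\<close>.\<close>
    let ?Z = "matrix_unit m A j i y"
    have Xc: "?Z \<in> carrier ?MA" by (rule matrix_unit_closed[OF rA y])
    from UXU[OF Xc] obtain c where c: "c \<in> carrier F"
      and eq: "(U \<otimes>\<^bsub>?MA\<^esub> ?Z) \<otimes>\<^bsub>?MA\<^esub> U = c \<odot>\<^bsub>?MA\<^esub> U" by blast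
    have UX: "(U \<otimes>\<^bsub>?MA\<^esub> ?Z) (i, l) = (if l = i then a \<otimes>\<^bsub>A\<^esub> y else \<zero>\<^bsub>A\<^esub>)" if "l < m" for l
      using matrix_unit_mult_right[OF rA y U(1) ij(1) that ij(2), of i] by (simp add: a_def)
    have "((U \<otimes>\<^bsub>?MA\<^esub> ?Z) \<otimes>\<^bsub>?MA\<^esub> U) (i, j) =
        (\<Oplus>\<^bsub>A\<^esub>l\<in>{..<m}. (U \<otimes>\<^bsub>?MA\<^esub> ?Z) (i, l) \<otimes>\<^bsub>A\<^esub> U (l, j))"
      using ij unfolding matrix_algebra_def by simp
    also have "\<dots> = (\<Oplus>\<^bsub>A\<^esub>l\<in>{..<m}. if i = l then (a \<otimes>\<^bsub>A\<^esub> y) \<otimes>\<^bsub>A\<^esub> U (l, j) else \<zero>\<^bsub>A\<^esub>)"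
    proof (intro A.add.finprod_cong')
      fix l assume l: "l \<in> {..<m}"
      then have "U (l, j) \<in> carrier A" using U(1) ij by (auto simp: matrix_algebra_def)
      then show "(U \<otimes>\<^bsub>?MA\<^esub> ?Z) (i, l) \<otimes>\<^bsub>A\<^esub> U (l, j) =
          (if i = l then (a \<otimes>\<^bsub>A\<^esub> y) \<otimes>\<^bsub>A\<^esub> U (l, j) else \<zero>\<^bsub>A\<^esub>)"
        using UX[of l] l by auto
    next
      show "(\<lambda>l. if i = l then (a \<otimes>\<^bsub>A\<^esub> y) \<otimes>\<^bsub>A\<^esub> U (l, j) else \<zero>\<^bsub>A\<^esub>) \<in> {..<m} \<rightarrow> carrier A"
        using a y by (auto simp: a_def)
    qed simp
    also have "\<dots> = (a \<otimes>\<^bsub>A\<^esub> y) \<otimes>\<^bsub>A\<^esub> U (i, j)"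
    proof (rule A.add.finprod_singleton)
      have "U (l, j) \<in> carrier A" if "l < m" for l
        using U(1) ij that by (auto simp: matrix_algebra_def)
      then show "(\<lambda>l. (a \<otimes>\<^bsub>A\<^esub> y) \<otimes>\<^bsub>A\<^esub> U (l, j)) \<in> {..<m} \<rightarrow> carrier A"
        using a y by auto
    qed (use ij in auto)
    finally have "((U \<otimes>\<^bsub>?MA\<^esub> ?Z) \<otimes>\<^bsub>?MA\<^esub> U) (i, j) = (a \<otimes>\<^bsub>A\<^esub> y) \<otimes>\<^bsub>A\<^esub> a"
      by (simp add: a_def)
    moreover have "(c \<odot>\<^bsub>?MA\<^esub> U) (i, j) = c \<odot>\<^bsub>A\<^esub> a"
      using ij by (simp add: matrix_algebra_def a_def)
    ultimately show ?thesis using eq c by (intro bexI[of _ c]) simp_all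
  qed
  from inv[OF a] obtain b where b: "b \<in> carrier A" "b \<otimes>\<^bsub>A\<^esub> a = \<one>\<^bsub>A\<^esub>" by blast
  \<comment> \<open>The factor \<open>b\<close> cancels the second \<open>a\<close>:
    \<open>a (x b) a\<close> is \<open>a x\<close>, which is thus a multiple of
    \<open>a\<close>.\<close>
  from axa[of "x \<otimes>\<^bsub>A\<^esub> b"] x b obtain c where c: "c \<in> carrier F"
    and eq: "(a \<otimes>\<^bsub>A\<^esub> (x \<otimes>\<^bsub>A\<^esub> b)) \<otimes>\<^bsub>A\<^esub> a = c \<odot>\<^bsub>A\<^esub> a" by auto
  have "x = b \<otimes>\<^bsub>A\<^esub> (a \<otimes>\<^bsub>A\<^esub> x)"
    using a b x by (simp add: A.m_assoc[symmetric])
  also have "a \<otimes>\<^bsub>A\<^esub> x = (a \<otimes>\<^bsub>A\<^esub> (x \<otimes>\<^bsub>A\<^esub> b)) \<otimes>\<^bsub>A\<^esub> a"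
    using a b x by (simp add: A.m_assoc)
  also have "b \<otimes>\<^bsub>A\<^esub> \<dots> = c \<odot>\<^bsub>A\<^esub> \<one>\<^bsub>A\<^esub>"
    using eq c a b by (simp add: A.smult_mult_right)
  finally show ?thesis using c by blast
qed

section \<open>Subfields as sets, and the hypothesis on Brauer groups\<close>

definition subfield_set :: "'l :: field set \<Rightarrow> bool" where
  "subfield_set K \<longleftrightarrow> 0 \<in> K \<and> 1 \<in> K \<and> (\<forall>x\<in>K. \<forall>y\<in>K. x + y \<in> K \<and> x * y \<in> K) \<and>
     (\<forall>x\<in>K. - x \<in> K \<and> inverse x \<in> K)"

lemma subfield_setD:
  assumes "subfield_set K"
  shows "0 \<in> K" "1 \<in> K" "x \<in> K \<Longrightarrow> y \<in> K \<Longrightarrow> x + y \<in> K" "x \<in> K \<Longrightarrow> y \<in> K \<Longrightarrow> x * y \<in> K"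
    "x \<in> K \<Longrightarrow> - x \<in> K" "x \<in> K \<Longrightarrow> inverse x \<in> K" "x \<in> K \<Longrightarrow> y \<in> K \<Longrightarrow> x - y \<in> K"
    "x \<in> K \<Longrightarrow> y \<in> K \<Longrightarrow> x / y \<in> K" "x \<in> K \<Longrightarrow> x ^ n \<in> K" "of_nat k \<in> K" "numeral w \<in> K"
proof -
  note * = assms[unfolded subfield_set_def]
  show "0 \<in> K" "1 \<in> K" "x \<in> K \<Longrightarrow> y \<in> K \<Longrightarrow> x + y \<in> K" "x \<in> K \<Longrightarrow> y \<in> K \<Longrightarrow> x * y \<in> K"
    "x \<in> K \<Longrightarrow> - x \<in> K" "x \<in> K \<Longrightarrow> inverse x \<in> K"
    using * by auto
  show "x \<in> K \<Longrightarrow> y \<in> K \<Longrightarrow> x - y \<in> K"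
    using * by (metis add_uminus_conv_diff)
  show "x \<in> K \<Longrightarrow> y \<in> K \<Longrightarrow> x / y \<in> K"
    using * by (simp add: divide_inverse)
  show "x \<in> K \<Longrightarrow> x ^ n \<in> K"
    using * by (induction n) auto
  show nat: "of_nat k \<in> K" for k
    using * by (induction k) auto
  show "numeral w \<in> K"
    using nat[of "numeral w"] by simp
qed

abbreviation subfield_ring :: "'l :: field set \<Rightarrow> 'l ring" where
  "subfield_ring K \<equiv> ring_of_type_algebra\<lparr>carrier := K\<rparr>"

lemma field_subfield_ring:
  assumes K: "subfield_set K"
  shows "field (subfield_ring K)"
proof -
  note K = subfield_setD[OF K]
  have "cring (subfield_ring K)"
  proof (rule cringI)
    show "abelian_group (subfield_ring K)"
    proof (rule abelian_groupI)
      fix x assume "x \<in> carrier (subfield_ring K)"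
      then show "\<exists>y\<in>carrier (subfield_ring K). y \<oplus>\<^bsub>subfield_ring K\<^esub> x = \<zero>\<^bsub>subfield_ring K\<^esub>"
        using K by (intro bexI[of _ "- x"]) (auto simp: ring_of_type_algebra_def)
    qed (use K in \<open>auto simp: ring_of_type_algebra_def algebra_simps\<close>)
    show "Group.comm_monoid (subfield_ring K)"
      by (rule comm_monoidI) (use K in \<open>auto simp: ring_of_type_algebra_def algebra_simps\<close>)
  qed (use K in \<open>auto simp: ring_of_type_algebra_def algebra_simps\<close>)
  then show ?thesis
  proof (rule cring.cring_fieldI2)
    fix x assume "x \<in> carrier (subfield_ring K)" "x \<noteq> \<zero>\<^bsub>subfield_ring K\<^esub>"
    then show "\<exists>b\<in>carrier (subfield_ring K). x \<otimes>\<^bsub>subfield_ring K\<^esub> b = \<one>\<^bsub>subfield_ring K\<^esub>"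
      using K by (intro bexI[of _ "inverse x"]) (auto simp: ring_of_type_algebra_def)
  qed (auto simp: ring_of_type_algebra_def)
qed

lemma cd_le_oneD:
  fixes K :: "'k :: field alg_closure set"
  assumes "cd_le_one TYPE('k)" "subfield_set K" "range to_ac \<subseteq> K"
  shows "brauer_group_trivial (subfield_ring K)"
proof -
  interpret R: ring "ring_of_type_algebra :: 'k alg_closure ring" by rule
  have "subfield K (ring_of_type_algebra :: 'k alg_closure ring)"
    by (rule R.subfield_iff(1)[OF field_subfield_ring[OF assms(2)]])
      (auto simp: ring_of_type_algebra_def)
  with assms show ?thesis by (auto simp: cd_le_one_def)
qed

section \<open>Cyclic algebras of degree three\<close>

text \<open>Three coordinates padded by zeros, because \<open>brauer_group_trivial\<close>
  quantifies over algebras whose elements are functions on \<open>nat\<close>.\<close>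

definition triple :: "'l :: zero \<Rightarrow> 'l \<Rightarrow> 'l \<Rightarrow> nat \<Rightarrow> 'l" where
  "triple a b c = (\<lambda>n. if n = 0 then a else if n = 1 then b else if n = 2 then c else 0)"

lemma triple_simps [simp]:
  "triple a b c 0 = a" "triple a b c (Suc 0) = b" "triple a b c 2 = c"
  by (auto simp: triple_def)

lemma triple_eq_iff: "triple a b c = triple a' b' c' \<longleftrightarrow> a = a' \<and> b = b' \<and> c = c'"
  by (metis triple_simps)

text \<open>The cyclic algebra \<open>E \<oplus> E z \<oplus> E z\<^sup>2\<close> with \<open>z b = s(b) z\<close> and \<open>z\<^sup>3 = m\<close>.\<close>

definition cyclic_algebra :: "'l :: field set \<Rightarrow> ('l \<Rightarrow> 'l) \<Rightarrow> 'l \<Rightarrow> ('l, nat \<Rightarrow> 'l) module" where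
  "cyclic_algebra E s m =
     \<lparr>carrier = {triple a b c |a b c. a \<in> E \<and> b \<in> E \<and> c \<in> E},
      monoid.mult = (\<lambda>x y. triple
        (x 0 * y 0 + m * (x 1 * s (y 2) + x 2 * s (s (y 1))))
        (x 0 * y 1 + x 1 * s (y 0) + m * (x 2 * s (s (y 2))))
        (x 0 * y 2 + x 1 * s (y 1) + x 2 * s (s (y 0)))),
      one = triple 1 0 0,
      ring.zero = triple 0 0 0,
      add = (\<lambda>x y. triple (x 0 + y 0) (x 1 + y 1) (x 2 + y 2)),
      module.smult = (\<lambda>a x. triple (a * x 0) (a * x 1) (a * x 2))\<rparr>"

text \<open>A cyclic cubic extension \<open>E\<close> of \<open>K\<close> with Galois group
  generated by \<open>s\<close>, recorded by what the crossed product uses: \<open>K\<close> is the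
  fixed field, the cube of \<open>s\<close> is the identity, and \<open>E\<close> is spanned by 1,
  \<open>\<theta>\<close> and \<open>\<theta>^2\<close>.\<close>

locale cyclic_cubic =
  fixes K E :: "'l :: field set" and s :: "'l \<Rightarrow> 'l" and \<theta> m :: 'l
  assumes K: "subfield_set K" and E: "subfield_set E" and KE: "K \<subseteq> E"
    and s_closed: "x \<in> E \<Longrightarrow> s x \<in> E"
    and s_add: "x \<in> E \<Longrightarrow> y \<in> E \<Longrightarrow> s (x + y) = s x + s y"
    and s_mult: "x \<in> E \<Longrightarrow> y \<in> E \<Longrightarrow> s (x * y) = s x * s y"
    and s_3: "x \<in> E \<Longrightarrow> s (s (s x)) = x"
    and s_fixed: "x \<in> E \<Longrightarrow> s x = x \<longleftrightarrow> x \<in> K"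
    and \<theta>: "\<theta> \<in> E" "s \<theta> \<noteq> \<theta>"
    and span: "x \<in> E \<Longrightarrow> \<exists>a\<in>K. \<exists>b\<in>K. \<exists>c\<in>K. x = a + b * \<theta> + c * \<theta>^2"
    and m: "m \<in> K" "m \<noteq> 0"
begin

abbreviation A where "A \<equiv> cyclic_algebra E s m"
abbreviation F where "F \<equiv> subfield_ring K"

lemmas E_simps [simp] = subfield_setD[OF E]
lemmas K_simps [simp] = subfield_setD[OF K]

lemma K_E [simp]: "x \<in> K \<Longrightarrow> x \<in> E" using KE by blast

declare s_closed [simp] s_add [simp] s_mult [simp] s_3 [simp] \<theta> [simp] m [simp]

lemma s_K [simp]: "x \<in> K \<Longrightarrow> s x = x" using s_fixed by simp

lemma s_minus [simp]:
  assumes "x \<in> E" shows "s (- x) = - s x"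
  using s_mult[of "-1" x] assms by simp

lemma A_simps:
  "carrier A = {triple a b c |a b c. a \<in> E \<and> b \<in> E \<and> c \<in> E}"
  "triple a b c \<otimes>\<^bsub>A\<^esub> triple a' b' c' = triple
        (a * a' + m * (b * s c' + c * s (s b')))
        (a * b' + b * s a' + m * (c * s (s c')))
        (a * c' + b * s b' + c * s (s a'))"
  "\<one>\<^bsub>A\<^esub> = triple 1 0 0" "\<zero>\<^bsub>A\<^esub> = triple 0 0 0"
  "triple a b c \<oplus>\<^bsub>A\<^esub> triple a' b' c' = triple (a + a') (b + b') (c + c')"
  "k \<odot>\<^bsub>A\<^esub> triple a b c = triple (k * a) (k * b) (k * c)"
  by (auto simp: cyclic_algebra_def)

lemma F_simps [simp]:
  "carrier F = K" "x \<otimes>\<^bsub>F\<^esub> y = x * y" "x \<oplus>\<^bsub>F\<^esub> y = x + y" "\<one>\<^bsub>F\<^esub> = 1" "\<zero>\<^bsub>F\<^esub> = 0"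
  by (auto simp: ring_of_type_algebra_def)

lemma triple_in_A [simp]: "triple a b c \<in> carrier A \<longleftrightarrow> a \<in> E \<and> b \<in> E \<and> c \<in> E"
  by (auto simp: A_simps triple_eq_iff)

lemma in_A_E:
  assumes "x \<in> carrier A"
  obtains a b c where "x = triple a b c" "a \<in> E" "b \<in> E" "c \<in> E"
  using assms by (auto simp: A_simps)

lemma A_assoc:
  assumes "x \<in> carrier A" "y \<in> carrier A" "z \<in> carrier A"
  shows "x \<otimes>\<^bsub>A\<^esub> y \<otimes>\<^bsub>A\<^esub> z = x \<otimes>\<^bsub>A\<^esub> (y \<otimes>\<^bsub>A\<^esub> z)"
proof -
  obtain a b c where x: "x = triple a b c" "a \<in> E" "b \<in> E" "c \<in> E" using assms(1) by (rule in_A_E)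
  obtain a' b' c' where y: "y = triple a' b' c'" "a' \<in> E" "b' \<in> E" "c' \<in> E" using assms(2) by (rule in_A_E)
  obtain a'' b'' c'' where z: "z = triple a'' b'' c''" "a'' \<in> E" "b'' \<in> E" "c'' \<in> E" using assms(3) by (rule in_A_E)
  show ?thesis
    unfolding x(1) y(1) z(1) A_simps using x(2-) y(2-) z(2-)
    by (simp add: triple_eq_iff) (simp add: algebra_simps)
qed

lemma A_distrib:
  assumes "x \<in> carrier A" "y \<in> carrier A" "z \<in> carrier A"
  shows "(x \<oplus>\<^bsub>A\<^esub> y) \<otimes>\<^bsub>A\<^esub> z = x \<otimes>\<^bsub>A\<^esub> z \<oplus>\<^bsub>A\<^esub> y \<otimes>\<^bsub>A\<^esub> z"
    "z \<otimes>\<^bsub>A\<^esub> (x \<oplus>\<^bsub>A\<^esub> y) = z \<otimes>\<^bsub>A\<^esub> x \<oplus>\<^bsub>A\<^esub> z \<otimes>\<^bsub>A\<^esub> y"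
proof -
  obtain a b c where x: "x = triple a b c" "a \<in> E" "b \<in> E" "c \<in> E" using assms(1) by (rule in_A_E)
  obtain a' b' c' where y: "y = triple a' b' c'" "a' \<in> E" "b' \<in> E" "c' \<in> E" using assms(2) by (rule in_A_E)
  obtain a'' b'' c'' where z: "z = triple a'' b'' c''" "a'' \<in> E" "b'' \<in> E" "c'' \<in> E" using assms(3) by (rule in_A_E)
  show "(x \<oplus>\<^bsub>A\<^esub> y) \<otimes>\<^bsub>A\<^esub> z = x \<otimes>\<^bsub>A\<^esub> z \<oplus>\<^bsub>A\<^esub> y \<otimes>\<^bsub>A\<^esub> z"
    "z \<otimes>\<^bsub>A\<^esub> (x \<oplus>\<^bsub>A\<^esub> y) = z \<otimes>\<^bsub>A\<^esub> x \<oplus>\<^bsub>A\<^esub> z \<otimes>\<^bsub>A\<^esub> y"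
    unfolding x(1) y(1) z(1) A_simps using x(2-) y(2-) z(2-)
    by (simp_all add: triple_eq_iff) (simp_all add: algebra_simps)
qed

lemma A_closed:
  assumes "x \<in> carrier A" "y \<in> carrier A"
  shows "x \<otimes>\<^bsub>A\<^esub> y \<in> carrier A" "x \<oplus>\<^bsub>A\<^esub> y \<in> carrier A"
proof -
  obtain a b c where x: "x = triple a b c" "a \<in> E" "b \<in> E" "c \<in> E" using assms(1) by (rule in_A_E)
  obtain a' b' c' where y: "y = triple a' b' c'" "a' \<in> E" "b' \<in> E" "c' \<in> E" using assms(2) by (rule in_A_E)
  show "x \<otimes>\<^bsub>A\<^esub> y \<in> carrier A" "x \<oplus>\<^bsub>A\<^esub> y \<in> carrier A"
    using x(2-) y(2-) by (simp_all add: x(1) y(1) A_simps(2,5))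
qed

lemma abelian_group_A: "abelian_group A"
proof (rule abelian_groupI)
  fix x assume "x \<in> carrier A"
  then obtain a b c where x: "x = triple a b c" "a \<in> E" "b \<in> E" "c \<in> E" by (rule in_A_E)
  show "\<exists>y\<in>carrier A. y \<oplus>\<^bsub>A\<^esub> x = \<zero>\<^bsub>A\<^esub>"
    using x(2-) by (intro bexI[of _ "triple (- a) (- b) (- c)"]) (simp_all add: x(1) A_simps(4,5))
  show "\<zero>\<^bsub>A\<^esub> \<oplus>\<^bsub>A\<^esub> x = x"
    by (simp add: x(1) A_simps(4,5))
qed (auto simp: A_closed A_simps(4), auto elim!: in_A_E simp: A_simps(5) triple_eq_iff algebra_simps)

lemma ring_A: "ring A"
proof (rule ringI)
  show "Group.monoid A"
  proof (rule monoidI)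
    fix x assume "x \<in> carrier A"
    then obtain a b c where x: "x = triple a b c" "a \<in> E" "b \<in> E" "c \<in> E" by (rule in_A_E)
    show "\<one>\<^bsub>A\<^esub> \<otimes>\<^bsub>A\<^esub> x = x" "x \<otimes>\<^bsub>A\<^esub> \<one>\<^bsub>A\<^esub> = x"
      by (simp_all add: x(1) A_simps(2,3) triple_eq_iff)
  qed (auto simp: A_closed A_assoc A_simps(3))
qed (auto simp: A_distrib abelian_group_A)

lemma assoc_algebra_A: "assoc_algebra F A"
proof -
  interpret F: field F by (rule field_subfield_ring[OF K])
  interpret A: ring A by (rule ring_A)
  have *: "a \<odot>\<^bsub>A\<^esub> x \<in> carrier A" "(a \<odot>\<^bsub>A\<^esub> x) \<otimes>\<^bsub>A\<^esub> y = a \<odot>\<^bsub>A\<^esub> (x \<otimes>\<^bsub>A\<^esub> y)"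
    "x \<otimes>\<^bsub>A\<^esub> (a \<odot>\<^bsub>A\<^esub> y) = a \<odot>\<^bsub>A\<^esub> (x \<otimes>\<^bsub>A\<^esub> y)" "a \<odot>\<^bsub>A\<^esub> (x \<oplus>\<^bsub>A\<^esub> y) = a \<odot>\<^bsub>A\<^esub> x \<oplus>\<^bsub>A\<^esub> a \<odot>\<^bsub>A\<^esub> y"
    if axy: "a \<in> K" "x \<in> carrier A" "y \<in> carrier A" for a x y
  proof -
    obtain p q r where x: "x = triple p q r" "p \<in> E" "q \<in> E" "r \<in> E" using axy(2) by (rule in_A_E)
    obtain p' q' r' where y: "y = triple p' q' r'" "p' \<in> E" "q' \<in> E" "r' \<in> E" using axy(3) by (rule in_A_E)
    show "a \<odot>\<^bsub>A\<^esub> x \<in> carrier A"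
      using axy(1) x(2-) by (simp add: x(1) A_simps(6))
    show "(a \<odot>\<^bsub>A\<^esub> x) \<otimes>\<^bsub>A\<^esub> y = a \<odot>\<^bsub>A\<^esub> (x \<otimes>\<^bsub>A\<^esub> y)"
      "x \<otimes>\<^bsub>A\<^esub> (a \<odot>\<^bsub>A\<^esub> y) = a \<odot>\<^bsub>A\<^esub> (x \<otimes>\<^bsub>A\<^esub> y)" "a \<odot>\<^bsub>A\<^esub> (x \<oplus>\<^bsub>A\<^esub> y) = a \<odot>\<^bsub>A\<^esub> x \<oplus>\<^bsub>A\<^esub> a \<odot>\<^bsub>A\<^esub> y"
      unfolding x(1) y(1) A_simps using axy(1) x(2-) y(2-)
      by (simp_all add: triple_eq_iff) (simp_all add: algebra_simps)
  qed
  show ?thesis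
  proof (unfold_locales, goal_cases)
    case (2 a b x) then show ?case by (auto elim!: in_A_E simp: A_simps(5,6) triple_eq_iff algebra_simps ring_of_type_algebra_def)
  next
    case (4 a b x) then show ?case
      by (auto elim!: in_A_E simp: A_simps(6) triple_eq_iff ring_of_type_algebra_def)
  next
    case (5 x) then show ?case by (auto elim!: in_A_E simp: A_simps(6) triple_eq_iff)
  qed (simp_all add: *)
qed

lemma finsum_A:
  assumes "finite I" "f \<in> I \<rightarrow> carrier A"
  shows "finsum A f I = triple (\<Sum>i\<in>I. f i 0) (\<Sum>i\<in>I. f i 1) (\<Sum>i\<in>I. f i 2)"
proof -
  interpret A: ring A by (rule ring_A)
  show ?thesis
    using assms
  proof (induction I)
    case empty
    then show ?case by (simp add: A_simps(4))
  next
    case (insert i I)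
    have add: "x \<oplus>\<^bsub>A\<^esub> y = triple (x 0 + y 0) (x 1 + y 1) (x 2 + y 2)" for x y
      by (simp add: cyclic_algebra_def)
    from insert have "finsum A f (insert i I) = f i \<oplus>\<^bsub>A\<^esub> finsum A f I"
      by (intro A.finsum_insert) auto
    with insert show ?case by (simp add: add)
  qed
qed

lemma finite_dimensional_A: "finite_dimensional F A"
proof -
  interpret A: ring A by (rule ring_A)
  define I where "I = {..<3::nat} \<times> {..<3::nat}"
  define b where "b = (\<lambda>(i, j). triple (if i = (0::nat) then \<theta> ^ j else 0) (if i = 1 then \<theta> ^ j else 0)
      (if i = 2 then \<theta> ^ j else 0))"
  have b_in: "b p \<in> carrier A" for p
    by (cases p) (simp add: b_def)
  have sum_I: "(\<Sum>p\<in>I. f p) = (\<Sum>i<3. \<Sum>j<3. f (i, j))" for f :: "nat \<times> nat \<Rightarrow> 'l"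
    unfolding I_def by (simp add: sum.cartesian_product)
  have three: "{..<3::nat} = {0, 1, 2}" by auto
  have "\<theta> \<notin> K" using \<theta> by (metis s_K)
  \<comment> \<open>\<open>finite_dimensional\<close> sums over a set, so the nine products of
    powers of \<open>\<theta>\<close> and \<open>z\<close> have to be distinct.\<close>
  then have th: "\<theta> \<noteq> 0" "\<theta> \<noteq> 1" "\<theta> \<noteq> - 1" "\<theta>\<^sup>2 \<noteq> 1" "\<theta>\<^sup>2 \<noteq> \<theta>"
    using K_simps(1,2) K_simps(5)[OF K_simps(2)] by (auto simp: power2_eq_1_iff) (auto simp: power2_eq_square)
  have inj: "inj_on b I"
  proof (rule inj_onI)
    fix p q assume pq: "p \<in> I" "q \<in> I" "b p = b q"
    obtain i j k l where "p = (i, j)" "q = (k, l)" by (cases p, cases q)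
    with pq th show "p = q"
      unfolding I_def three b_def by (auto simp: triple_eq_iff)
  qed
  have "\<exists>c\<in>b ` I \<rightarrow> carrier F. x = (\<Oplus>\<^bsub>A\<^esub>v\<in>b ` I. c v \<odot>\<^bsub>A\<^esub> v)" if x: "x \<in> carrier A" for x
  proof -
    obtain x0 x1 x2 where x: "x = triple x0 x1 x2" "x0 \<in> E" "x1 \<in> E" "x2 \<in> E" using x by (rule in_A_E)
    have "\<forall>i. \<exists>f. f ` {..<3::nat} \<subseteq> K \<and> x i = (\<Sum>j<3. f j * \<theta> ^ j)"
    proof
      fix i
      have "x i \<in> E" using x by (auto simp: triple_def)
      then obtain a b c where "a \<in> K" "b \<in> K" "c \<in> K" "x i = a + b * \<theta> + c * \<theta>^2" using span by blast
      then show "\<exists>f. f ` {..<3::nat} \<subseteq> K \<and> x i = (\<Sum>j<3. f j * \<theta> ^ j)"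
        by (intro exI[of _ "triple a b c"]) (auto simp: three triple_def)
    qed
    then obtain f where f: "\<And>i. f i ` {..<3::nat} \<subseteq> K" "\<And>i. x i = (\<Sum>j<3. f i j * \<theta> ^ j)" by metis
    define c where "c v = (case inv_into I b v of (i, j) \<Rightarrow> f i j)" for v
    have cb: "c (b (i, j)) = f i j" if "(i, j) \<in> I" for i j
      using inv_into_f_f[OF inj that] by (simp add: c_def)
    have c_in: "c (b p) \<in> K" if "p \<in> I" for p
      using that f(1) cb by (cases p) (auto simp: I_def)
    interpret B: assoc_algebra F A by (rule assoc_algebra_A)
    have smult: "c (b p) \<odot>\<^bsub>A\<^esub> b p \<in> carrier A" if "p \<in> I" for p
      using c_in[OF that] b_in by simp
    have "(\<Oplus>\<^bsub>A\<^esub>v\<in>b ` I. c v \<odot>\<^bsub>A\<^esub> v) = (\<Oplus>\<^bsub>A\<^esub>p\<in>I. c (b p) \<odot>\<^bsub>A\<^esub> b p)"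
      by (rule A.add.finprod_reindex) (use smult inj in auto)
    also have "\<dots> = triple (\<Sum>p\<in>I. (c (b p) \<odot>\<^bsub>A\<^esub> b p) 0) (\<Sum>p\<in>I. (c (b p) \<odot>\<^bsub>A\<^esub> b p) 1)
         (\<Sum>p\<in>I. (c (b p) \<odot>\<^bsub>A\<^esub> b p) 2)"
      by (rule finsum_A) (use smult in \<open>auto simp: I_def\<close>)
    also have "\<dots> = triple (x 0) (x 1) (x 2)"
    proof -
      have "(\<Sum>p\<in>I. (c (b p) \<odot>\<^bsub>A\<^esub> b p) n) = x n" if "n < 3" for n
      proof -
        have "(\<Sum>p\<in>I. (c (b p) \<odot>\<^bsub>A\<^esub> b p) n) = (\<Sum>p\<in>I. case p of (i, j) \<Rightarrow> if i = n then f i j * \<theta> ^ j else 0)"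
        proof (rule sum.cong)
          fix p assume p: "p \<in> I"
          obtain i j where ij: "p = (i, j)" by (cases p)
          consider "n = 0" | "n = 1" | "n = 2" using \<open>n < 3\<close> by linarith
          then have "(c (b p) \<odot>\<^bsub>A\<^esub> b p) n = f i j * b p n"
            using cb p unfolding ij by cases (simp_all add: cyclic_algebra_def)
          also have "b p n = (if i = n then \<theta> ^ j else 0)"
            using that by (auto simp: b_def ij triple_def)
          finally show "(c (b p) \<odot>\<^bsub>A\<^esub> b p) n = (case p of (i, j) \<Rightarrow> if i = n then f i j * \<theta> ^ j else 0)"
            by (simp add: ij)
        qed simp
        also have "\<dots> = x n"
        proof -
          consider "n = 0" | "n = 1" | "n = 2" using \<open>n < 3\<close> by linarith
          then show ?thesis unfolding sum_I f(2)[of n] three by cases auto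
        qed
        finally show ?thesis .
      qed
      then show ?thesis by simp
    qed
    also have "\<dots> = x" by (simp add: x(1))
    finally show ?thesis using c_in by (intro bexI[of _ c]) auto
  qed
  then show ?thesis
    unfolding finite_dimensional_def using b_in by (intro exI[of _ "b ` I"]) (auto simp: I_def)
qed

lemma center_A: "ring_center A = (\<lambda>a. a \<odot>\<^bsub>A\<^esub> \<one>\<^bsub>A\<^esub>) ` carrier F"
proof (intro equalityI subsetI)
  fix x assume "x \<in> ring_center A"
  then have xA: "x \<in> carrier A" and comm: "\<And>y. y \<in> carrier A \<Longrightarrow> x \<otimes>\<^bsub>A\<^esub> y = y \<otimes>\<^bsub>A\<^esub> x"
    by (auto simp: ring_center_def)
  obtain a b c where x: "x = triple a b c" "a \<in> E" "b \<in> E" "c \<in> E" using xA by (rule in_A_E)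
  \<comment> \<open>Commuting with \<open>\<theta>\<close> kills the coefficients of
    \<open>z\<close> and \<open>z^2\<close>; commuting with \<open>z\<close> then puts the remaining
    one into the fixed field.\<close>
  have "b * s \<theta> = \<theta> * b" "c * s (s \<theta>) = \<theta> * c"
    using comm[of "triple \<theta> 0 0"] by (simp_all add: x(1) A_simps(2) triple_eq_iff)
  moreover have "s (s \<theta>) \<noteq> \<theta>" using \<theta> s_3[of \<theta>] by metis
  ultimately have bc: "b = 0" "c = 0" using \<theta>(2) by (auto simp: mult.commute)
  have "s a = a" using comm[of "triple 0 1 0"] by (simp add: x(1) A_simps(2) triple_eq_iff)
  with s_fixed x have "a \<in> K" by blast
  then show "x \<in> (\<lambda>a. a \<odot>\<^bsub>A\<^esub> \<one>\<^bsub>A\<^esub>) ` carrier F"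
    by (intro image_eqI[of _ _ a]) (simp_all add: x(1) bc A_simps(3,6))
next
  fix x assume "x \<in> (\<lambda>a. a \<odot>\<^bsub>A\<^esub> \<one>\<^bsub>A\<^esub>) ` carrier F"
  then obtain a where a: "x = triple a 0 0" "a \<in> K" by (auto simp: A_simps(3,6))
  have "x \<otimes>\<^bsub>A\<^esub> y = y \<otimes>\<^bsub>A\<^esub> x" if "y \<in> carrier A" for y
    using that a(2) by (auto elim!: in_A_E simp: a(1) A_simps(2) triple_eq_iff)
  with a show "x \<in> ring_center A" by (simp add: ring_center_def)
qed

text \<open>Euclidean elimination in the left ideal \<open>J\<close> generated by \<open>x\<close>:
  the degree in \<open>z\<close> is lowered until a nonzero scalar appears. A step could fail only
  if \<open>m\<close> were a norm from \<open>E\<close>.\<close>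

lemma left_inverse_A:
  assumes not_norm: "\<And>b. b \<in> E \<Longrightarrow> m \<noteq> b * s b * s (s b)"
    and x: "x \<in> carrier A" "x \<noteq> \<zero>\<^bsub>A\<^esub>"
  shows "\<exists>y\<in>carrier A. y \<otimes>\<^bsub>A\<^esub> x = \<one>\<^bsub>A\<^esub>"
proof -
  interpret A: ring A by (rule ring_A)
  define J where "J = {y \<otimes>\<^bsub>A\<^esub> x |y. y \<in> carrier A}"
  have J_mult: "y \<otimes>\<^bsub>A\<^esub> z \<in> J" if "y \<in> carrier A" "z \<in> J" for y z
    using that x by (auto simp: J_def A.m_assoc[symmetric])
  have scalar: "\<one>\<^bsub>A\<^esub> \<in> J" if "triple u 0 0 \<in> J" "u \<noteq> 0" "u \<in> E" for u
    using J_mult[of "triple (inverse u) 0 0" "triple u 0 0"] that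
    by (simp add: A_simps(2,3))
  have linear: "\<one>\<^bsub>A\<^esub> \<in> J" if J: "triple a b 0 \<in> J" and ab: "a \<noteq> 0 \<or> b \<noteq> 0" "a \<in> E" "b \<in> E" for a b
  proof (cases "b = 0")
    case True
    with ab J scalar show ?thesis by auto
  next
    case False
    define c where "c = - (a / b)"
    have c: "c \<in> E" using ab by (simp add: c_def)
    have "triple (inverse b) 0 0 \<otimes>\<^bsub>A\<^esub> triple a b 0 = triple (- c) 1 0"
      using False by (simp add: A_simps(2) triple_eq_iff c_def field_simps)
    then have "triple (- c) 1 0 \<in> J"
      using J_mult[OF _ J, of "triple (inverse b) 0 0"] ab by simp
    \<comment> \<open>The left factor is the cofactor of \<open>z - c\<close> in \<open>z^3\<close>
      minus the norm of \<open>c\<close>, and \<open>z^3 = m\<close>.\<close>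
    then have "triple (s (s c) * s c) (s (s c)) 1 \<otimes>\<^bsub>A\<^esub> triple (- c) 1 0 \<in> J"
      using c by (intro J_mult) auto
    also have "triple (s (s c) * s c) (s (s c)) 1 \<otimes>\<^bsub>A\<^esub> triple (- c) 1 0 = triple (m - c * s c * s (s c)) 0 0"
      using c by (simp add: A_simps(2) triple_eq_iff algebra_simps)
    finally show ?thesis by (rule scalar) (use not_norm[OF c] c in simp_all)
  qed
  obtain p q r where pqr: "x = triple p q r" "p \<in> E" "q \<in> E" "r \<in> E" using x(1) by (rule in_A_E)
  have xJ: "x \<in> J" using x(1) by (auto simp: J_def intro!: exI[of _ "\<one>\<^bsub>A\<^esub>"])
  have "\<one>\<^bsub>A\<^esub> \<in> J"
  proof (cases "r = 0")
    case True
    then show ?thesis using linear[of p q] xJ x(2) pqr by (auto simp: A_simps(4))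
  next
    case False
    define b c where "b = q / r" and "c = p / r"
    have bc: "b \<in> E" "c \<in> E" using pqr by (simp_all add: b_def c_def)
    have "triple (inverse r) 0 0 \<otimes>\<^bsub>A\<^esub> x = triple c b 1"
      using False by (simp add: A_simps(2) triple_eq_iff b_def c_def pqr(1) field_simps)
    then have "triple c b 1 \<in> J"
      using J_mult[OF _ xJ, of "triple (inverse r) 0 0"] pqr by simp
    \<comment> \<open>Left multiplication of \<open>z^2 + b z + c\<close> by \<open>z - s b\<close>
      removes the term in \<open>z^2\<close>.\<close>
    then have "triple (- s b) 1 0 \<otimes>\<^bsub>A\<^esub> triple c b 1 \<in> J"
      using bc by (intro J_mult) auto
    also have "triple (- s b) 1 0 \<otimes>\<^bsub>A\<^esub> triple c b 1 = triple (m - s b * c) (s c - b * s b) 0"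
      using bc by (simp add: A_simps(2) triple_eq_iff algebra_simps)
    finally have *: "triple (m - s b * c) (s c - b * s b) 0 \<in> J" .
    have "m - s b * c \<noteq> 0 \<or> s c - b * s b \<noteq> 0"
    proof (rule ccontr)
      assume "\<not> ?thesis"
      then have eq: "m = s b * c" "s c = b * s b" by auto
      have "c = s (s (s c))" using bc by simp
      also have "\<dots> = s (s b) * b" unfolding eq(2) using bc by simp
      finally show False using not_norm[OF bc(1)] eq(1) by (simp add: algebra_simps)
    qed
    then show ?thesis using linear[OF *] bc by simp
  qed
  then show ?thesis by (auto simp: J_def)
qed

lemma central_simple_A:
  assumes not_norm: "\<And>b. b \<in> E \<Longrightarrow> m \<noteq> b * s b * s (s b)"
  shows "central_simple_algebra F A"
proof -
  interpret A: ring A by (rule ring_A)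
  have "I = {\<zero>\<^bsub>A\<^esub>} \<or> I = carrier A" if I: "ideal I A" for I
  proof (cases "I \<subseteq> {\<zero>\<^bsub>A\<^esub>}")
    case True
    interpret I: ideal I A by fact
    show ?thesis using True I.zero_closed by auto
  next
    case False
    interpret I: ideal I A by fact
    obtain x where x: "x \<in> I" "x \<noteq> \<zero>\<^bsub>A\<^esub>" using False by auto
    then obtain y where "y \<in> carrier A" "y \<otimes>\<^bsub>A\<^esub> x = \<one>\<^bsub>A\<^esub>"
      using left_inverse_A[OF not_norm] I.a_subset by blast
    then have "\<one>\<^bsub>A\<^esub> \<in> I" using I.I_l_closed[OF x(1)] by metis
    then show ?thesis using I.one_imp_carrier by simp
  qed
  then have "simple_ring A"
    by (simp add: simple_ring_def A.ring_axioms A_simps(3,4) triple_eq_iff)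
  then show ?thesis
    by (simp add: central_simple_algebra_def field_subfield_ring[OF K] assoc_algebra_A
        finite_dimensional_A center_A)
qed

text \<open>If \<open>m\<close> were not a norm, the cyclic algebra would be a central division
  algebra, hence consist of scalars, although it contains \<open>z\<close>.\<close>

lemma norm_surjective:
  assumes "brauer_group_trivial F"
  shows "\<exists>b\<in>E. m = b * s b * s (s b)"
proof (rule ccontr)
  assume "\<not> ?thesis"
  then have not_norm: "\<And>b. b \<in> E \<Longrightarrow> m \<noteq> b * s b * s (s b)" by blast
  have "\<exists>c\<in>carrier F. triple 0 1 0 = c \<odot>\<^bsub>A\<^esub> \<one>\<^bsub>A\<^esub>"
    by (rule central_division_algebra_trivial[OF assms central_simple_A[OF not_norm]])
      (auto intro: left_inverse_A[OF not_norm])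
  then show False by (auto simp: A_simps(3,6) triple_eq_iff)
qed

end

section \<open>Norms of cubic extensions\<close>

text \<open>The norm of \<open>p0 + p1 X + p2 X^2\<close> modulo the cubic
  \<open>X^3 - t X^2 + t' X - 1\<close>, expanded so that it makes sense without the roots.\<close>

definition cubic_norm :: "'l :: field \<Rightarrow> 'l \<Rightarrow> 'l \<Rightarrow> 'l \<Rightarrow> 'l \<Rightarrow> 'l" where
  "cubic_norm t t' p0 p1 p2 = p0^3 + p0^2 * p1 * t + p0^2 * p2 * (t^2 - 2 * t') + p0 * p1^2 * t' +
     p0 * p1 * p2 * (t * t' - 3) + p0 * p2^2 * (t'^2 - 2 * t) + p1^3 + p1^2 * p2 * t + p1 * p2^2 * t' + p2^3"

locale cubic_roots =
  fixes \<alpha> \<beta> \<gamma> t t' :: "'l :: field"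
  assumes t: "t = \<alpha> + \<beta> + \<gamma>" and t': "t' = \<alpha> * \<beta> + \<beta> * \<gamma> + \<gamma> * \<alpha>" and prod: "\<alpha> * \<beta> * \<gamma> = 1"
begin

lemma root_factor: "x^3 - t * x^2 + t' * x - 1 = (x - \<alpha>) * (x - \<beta>) * (x - \<gamma>)"
  unfolding t t' using prod by Groebner_Basis.algebra

lemma root_iff: "x^3 - t * x^2 + t' * x - 1 = 0 \<longleftrightarrow> x = \<alpha> \<or> x = \<beta> \<or> x = \<gamma>"
  unfolding root_factor by auto

lemma cubic_norm_eq:
  "cubic_norm t t' p0 p1 p2 =
     (p0 + p1 * \<alpha> + p2 * \<alpha>^2) * (p0 + p1 * \<beta> + p2 * \<beta>^2) * (p0 + p1 * \<gamma> + p2 * \<gamma>^2)"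
  unfolding cubic_norm_def t t' using prod by Groebner_Basis.algebra

end

section \<open>Adjoining a square root\<close>

definition adjoin_sqrt :: "'l :: field set \<Rightarrow> 'l \<Rightarrow> 'l set" where
  "adjoin_sqrt K r = {u + v * r |u v. u \<in> K \<and> v \<in> K}"

lemma subset_adjoin_sqrt:
  assumes "subfield_set K"
  shows "K \<subseteq> adjoin_sqrt K r" "r \<in> adjoin_sqrt K r"
proof -
  have "\<exists>u v. x = u + v * r \<and> u \<in> K \<and> v \<in> K" if "x \<in> K" for x
    using that subfield_setD(1)[OF assms] by (intro exI[of _ x] exI[of _ 0]) auto
  then show "K \<subseteq> adjoin_sqrt K r" by (auto simp: adjoin_sqrt_def)
  have "\<exists>u v. r = u + v * r \<and> u \<in> K \<and> v \<in> K"
    using subfield_setD(1,2)[OF assms] by (intro exI[of _ 0] exI[of _ 1]) auto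
  then show "r \<in> adjoin_sqrt K r" by (auto simp: adjoin_sqrt_def)
qed

lemma adjoin_sqrtI: "u \<in> K \<Longrightarrow> v \<in> K \<Longrightarrow> u + v * r \<in> adjoin_sqrt K r"
  by (auto simp: adjoin_sqrt_def)

lemma subfield_adjoin_sqrt:
  assumes K: "subfield_set K" and r: "r^2 \<in> K"
  shows "subfield_set (adjoin_sqrt K r)"
  unfolding subfield_set_def
proof (intro conjI ballI)
  note [simp] = subfield_setD[OF K]
  show "0 \<in> adjoin_sqrt K r" "1 \<in> adjoin_sqrt K r"
    using subset_adjoin_sqrt(1)[OF K, of r] subfield_setD(1,2)[OF K] by blast+
  fix x assume "x \<in> adjoin_sqrt K r"
  then obtain u v where x: "x = u + v * r" "u \<in> K" "v \<in> K" by (auto simp: adjoin_sqrt_def)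
  have "- x = (- u) + (- v) * r" by (simp add: x)
  then show "- x \<in> adjoin_sqrt K r" using x adjoin_sqrtI[of "- u" K "- v" r] by simp
  show "inverse x \<in> adjoin_sqrt K r"
  proof (cases "u^2 - v^2 * r^2 = 0")
    case False
    have "x * (u - v * r) = u^2 - v^2 * r^2"
      unfolding x by (simp add: algebra_simps power2_eq_square)
    with False have "inverse x = (u - v * r) / (u^2 - v^2 * r^2)"
      by (intro inverse_unique) (auto simp: field_simps)
    also have "\<dots> = u / (u^2 - v^2 * r^2) + (- v / (u^2 - v^2 * r^2)) * r"
      by (simp add: diff_divide_distrib)
    finally show ?thesis using x r by (simp only:) (intro adjoin_sqrtI, simp_all)
  next
    \<comment> \<open>Dividing by the norm is impossible here, but \<open>x\<close> is then 0 or
      equal to \<open>2 u\<close>.\<close>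
    case True
    then have "(u - v * r) * (u + v * r) = 0" by (simp add: algebra_simps power2_eq_square)
    then consider "x = 0" | "u = v * r" by (auto simp: x)
    then have "x \<in> K"
    proof cases
      case 2
      then show ?thesis using x subfield_setD(3)[OF K x(2,2)] by simp
    qed simp
    then show ?thesis using subset_adjoin_sqrt(1)[OF K, of r] subfield_setD(6)[OF K] by blast
  qed
  fix y assume "y \<in> adjoin_sqrt K r"
  then obtain u' v' where y: "y = u' + v' * r" "u' \<in> K" "v' \<in> K" by (auto simp: adjoin_sqrt_def)
  have "x + y = (u + u') + (v + v') * r" by (simp add: x y algebra_simps)
  then show "x + y \<in> adjoin_sqrt K r" using x y adjoin_sqrtI[of "u + u'" K "v + v'" r] by (simp only:) simp
  have "x * y = (u * u' + v * v' * r^2) + (u * v' + v * u') * r"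
    by (simp add: x y algebra_simps power2_eq_square)
  then show "x * y \<in> adjoin_sqrt K r"
    using x y r adjoin_sqrtI[of "u * u' + v * v' * r^2" K "u * v' + v * u'" r] by simp
qed

lemma adjoin_sqrt_unique:
  assumes "subfield_set K" "r \<notin> K" "u \<in> K" "v \<in> K" "u' \<in> K" "v' \<in> K" "u + v * r = u' + v' * r"
  shows "u = u' \<and> v = v'"
proof -
  have eq: "(v - v') * r = u' - u" using assms(7) by (simp add: algebra_simps)
  have "v = v'"
  proof (rule ccontr)
    assume "v \<noteq> v'"
    with eq have "r = (u' - u) / (v - v')" by (simp add: field_simps)
    also have "\<dots> \<in> K" using assms by (intro subfield_setD[OF assms(1)])
    finally show False using assms(2) by simp
  qed
  with eq show ?thesis by simp
qed

section \<open>Irreducible cubics with constant term -1\<close>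

locale cubic_irreducible = cubic_roots \<alpha> \<beta> \<gamma> t t' for \<alpha> \<beta> \<gamma> t t' :: "'l :: field" +
  fixes K :: "'l set"
  assumes K: "subfield_set K" and tK: "t \<in> K" "t' \<in> K" and two: "(2 :: 'l) \<noteq> 0"
    and no_root: "x \<in> K \<Longrightarrow> x^3 - t * x^2 + t' * x - 1 \<noteq> 0"
begin

lemmas K_simps [simp] = subfield_setD[OF K]
declare tK [simp]

lemma root_notin:
  assumes "\<rho> = \<alpha> \<or> \<rho> = \<beta> \<or> \<rho> = \<gamma>" shows "\<rho> \<notin> K"
  using no_root[of \<rho>] root_iff[of \<rho>] assms by auto

text \<open>A quadratic relation over \<open>K\<close> would give a factor
  \<open>X^2 - A X - B\<close> of the cubic, and its linear cofactor \<open>X - c\<close> would have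
  a root in \<open>K\<close>.\<close>

lemma independent:
  assumes \<rho>: "\<rho> = \<alpha> \<or> \<rho> = \<beta> \<or> \<rho> = \<gamma>" and p: "p0 \<in> K" "p1 \<in> K" "p2 \<in> K"
    and eq: "p0 + p1 * \<rho> + p2 * \<rho>^2 = 0"
  shows "p0 = 0 \<and> p1 = 0 \<and> p2 = 0"
proof -
  have linear: "b = 0 \<and> a = 0" if "a + b * \<rho> = 0" "a \<in> K" "b \<in> K" for a b
  proof -
    have "b = 0"
    proof (rule ccontr)
      assume "b \<noteq> 0"
      moreover have "b * \<rho> = - a" using that(1) by (simp add: eq_neg_iff_add_eq_0 add.commute)
      ultimately have "\<rho> = - a / b" by (metis nonzero_mult_div_cancel_left)
      with that show False using root_notin[OF \<rho>] by simp
    qed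
    with that show ?thesis by simp
  qed
  have "p2 = 0"
  proof (rule ccontr)
    assume p2: "p2 \<noteq> 0"
    define A B c where "A = - p1 / p2" and "B = - p0 / p2" and "c = t - A"
    have in_K: "A \<in> K" "B \<in> K" "c \<in> K" using p by (simp_all add: A_def B_def c_def)
    have "\<rho>^2 = A * \<rho> + B"
    proof -
      have "p2 * \<rho>^2 = - p1 * \<rho> - p0" using eq by (simp add: eq_neg_iff_add_eq_0 algebra_simps)
      then have "\<rho>^2 = (- p1 * \<rho> - p0) / p2" using p2 by (metis nonzero_mult_div_cancel_left)
      then show ?thesis by (simp add: A_def B_def diff_divide_distrib)
    qed
    moreover have "\<rho>^3 - t * \<rho>^2 + t' * \<rho> - 1 = 0" using \<rho> root_iff by blast
    moreover have "\<rho>^3 - t * \<rho>^2 + t' * \<rho> - 1 =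
        (\<rho>^2 - A * \<rho> - B) * (\<rho> - c) + ((- 1 - B * c) + (t' - (A * c - B)) * \<rho>)"
      unfolding c_def by Groebner_Basis.algebra
    ultimately have "(- 1 - B * c) + (t' - (A * c - B)) * \<rho> = 0" by simp
    then have *: "- 1 - B * c = 0" "t' - (A * c - B) = 0"
      using linear[of "- 1 - B * c" "t' - (A * c - B)"] in_K by auto
    have "c^3 - t * c^2 + t' * c - 1 = (c^2 - A * c - B) * (c - c) + ((- 1 - B * c) + (t' - (A * c - B)) * c)"
      unfolding c_def by Groebner_Basis.algebra
    then show False using no_root[OF in_K(3)] * by simp
  qed
  with linear[of p0 p1] eq p show ?thesis by simp
qed

text \<open>Separability. A double root is a rational function of the coefficients, and so is a
  triple root outside characteristic 3; in characteristic 3 the constant term -1 forces a triple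
  root to be 1.\<close>

lemma roots_neq: "\<alpha> \<noteq> \<beta>"
proof
  assume ab: "\<alpha> = \<beta>"
  show False
  proof (cases "\<alpha> = \<gamma>")
    case True
    show False
    proof (cases "(3 :: 'l) = 0")
      case 3: True
      have "\<alpha>^3 = 1" using prod ab True by (simp add: power3_eq_cube)
      moreover have "\<alpha>^3 - 1 = (\<alpha> - 1)^3 + 3 * (\<alpha>^2 - \<alpha>)" by Groebner_Basis.algebra
      ultimately have "\<alpha> = 1" using 3 by simp
      then show False using root_notin[of \<alpha>] by simp
    next
      case False
      have "t = 3 * \<alpha>" using t ab True by simp
      then have "\<alpha> = t / 3" using False by simp
      also have "t / 3 \<in> K" by simp
      finally show False using root_notin[of \<alpha>] by simp
    qed
  next
    case False
    have "t^2 - 3 * t' = (\<alpha> - \<gamma>)^2" unfolding t t' ab by Groebner_Basis.algebra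
    moreover have "t * t' - 9 = 2 * \<alpha> * (\<alpha> - \<gamma>)^2"
      using prod unfolding t t' ab by Groebner_Basis.algebra
    ultimately have "\<alpha> = (t * t' - 9) / (2 * (t^2 - 3 * t'))"
      using False two by simp
    also have "\<dots> \<in> K" by simp
    finally show False using root_notin[of \<alpha>] by simp
  qed
qed

lemma rotate: "cubic_irreducible \<beta> \<gamma> \<alpha> t t' K"
  by unfold_locales (use t t' prod K tK two no_root in \<open>auto simp: algebra_simps\<close>)

lemma roots_distinct: "\<alpha> \<noteq> \<beta>" "\<beta> \<noteq> \<gamma>" "\<gamma> \<noteq> \<alpha>"
proof -
  interpret r: cubic_irreducible \<beta> \<gamma> \<alpha> t t' K by (rule rotate)
  interpret r2: cubic_irreducible \<gamma> \<alpha> \<beta> t t' K by (rule r.rotate)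
  show "\<alpha> \<noteq> \<beta>" "\<beta> \<noteq> \<gamma>" "\<gamma> \<noteq> \<alpha>"
    by (rule roots_neq r.roots_neq r2.roots_neq)+
qed

definition \<delta> where "\<delta> = (\<alpha> - \<beta>) * (\<beta> - \<gamma>) * (\<gamma> - \<alpha>)"

lemma \<delta>_square: "\<delta>^2 = t^2 * t'^2 - 4 * t'^3 - 4 * t^3 + 18 * t * t' - 27"
  unfolding \<delta>_def t t' using prod by Groebner_Basis.algebra

lemma \<delta>_nonzero: "\<delta> \<noteq> 0"
  using roots_distinct by (simp add: \<delta>_def)

text \<open>The conjugate of a root \<open>x\<close> in the quadratic extension is a second root, so
  the third one, \<open>t\<close> minus their sum, would lie in \<open>K\<close>.\<close>

lemma no_root_adjoin:
  assumes "x \<in> adjoin_sqrt K \<delta>"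
  shows "x^3 - t * x^2 + t' * x - 1 \<noteq> 0"
proof
  assume root: "x^3 - t * x^2 + t' * x - 1 = 0"
  obtain u v where x: "x = u + v * \<delta>" "u \<in> K" "v \<in> K" using assms by (auto simp: adjoin_sqrt_def)
  have "x \<notin> K" using root no_root by auto
  then have v: "v \<noteq> 0" and notin: "\<delta> \<notin> K" using x by auto
  define P where "P = u^3 + 3 * u * v^2 * \<delta>^2 - t * (u^2 + v^2 * \<delta>^2) + t' * u - 1"
  define Q where "Q = 3 * u^2 * v + v^3 * \<delta>^2 - t * (2 * u * v) + t' * v"
  have PQ: "P \<in> K" "Q \<in> K" using x by (simp_all add: P_def Q_def \<delta>_square)
  have "P + Q * \<delta> = 0 + 0 * \<delta>" using root unfolding P_def Q_def x(1) by Groebner_Basis.algebra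
  then have "P = 0" "Q = 0" using adjoin_sqrt_unique[OF K notin PQ, of 0 0] by simp_all
  define y where "y = u - v * \<delta>"
  have "y^3 - t * y^2 + t' * y - 1 = P - Q * \<delta>" unfolding P_def Q_def y_def by Groebner_Basis.algebra
  then have "y = \<alpha> \<or> y = \<beta> \<or> y = \<gamma>" using root_iff \<open>P = 0\<close> \<open>Q = 0\<close> by simp
  moreover have "x = \<alpha> \<or> x = \<beta> \<or> x = \<gamma>" using root root_iff by blast
  moreover have "x \<noteq> y"
  proof
    assume "x = y"
    then have "2 * v * \<delta> = 0" by (simp add: x y_def algebra_simps)
    then show False using two v \<delta>_nonzero by simp
  qed
  ultimately have "t - x - y = \<alpha> \<or> t - x - y = \<beta> \<or> t - x - y = \<gamma>"
    unfolding t by (auto simp: algebra_simps)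
  then have "t - x - y \<notin> K" by (rule root_notin)
  moreover have "t - x - y = t - 2 * u" unfolding x(1) y_def by simp
  ultimately have "t - 2 * u \<notin> K" by simp
  then show False using x(2) by simp
qed

definition E where "E = {p0 + p1 * \<alpha> + p2 * \<alpha>^2 |p0 p1 p2. p0 \<in> K \<and> p1 \<in> K \<and> p2 \<in> K}"

text \<open>The embedding of \<open>E = K(\<alpha>)\<close> that sends \<open>\<alpha>\<close> to
  \<open>\<beta>\<close>; by \<open>independent\<close> the coefficients, and so the value, are
  determined by \<open>x\<close>. That it maps \<open>E\<close> to itself is shown in
  \<open>cubic_galois\<close>.\<close>

definition s where
  "s x = (THE y. \<exists>p0\<in>K. \<exists>p1\<in>K. \<exists>p2\<in>K. x = p0 + p1 * \<alpha> + p2 * \<alpha>^2 \<and> y = p0 + p1 * \<beta> + p2 * \<beta>^2)"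

lemma s_eval:
  assumes p: "p0 \<in> K" "p1 \<in> K" "p2 \<in> K"
  shows "s (p0 + p1 * \<alpha> + p2 * \<alpha>^2) = p0 + p1 * \<beta> + p2 * \<beta>^2"
  unfolding s_def
proof (rule the_equality)
  show "\<exists>q0\<in>K. \<exists>q1\<in>K. \<exists>q2\<in>K. p0 + p1 * \<alpha> + p2 * \<alpha>^2 = q0 + q1 * \<alpha> + q2 * \<alpha>^2 \<and>
          p0 + p1 * \<beta> + p2 * \<beta>^2 = q0 + q1 * \<beta> + q2 * \<beta>^2"
    using p by blast
  fix y assume "\<exists>q0\<in>K. \<exists>q1\<in>K. \<exists>q2\<in>K. p0 + p1 * \<alpha> + p2 * \<alpha>^2 = q0 + q1 * \<alpha> + q2 * \<alpha>^2 \<and>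
          y = q0 + q1 * \<beta> + q2 * \<beta>^2"
  then obtain q0 q1 q2 where q: "q0 \<in> K" "q1 \<in> K" "q2 \<in> K" and eq: "p0 + p1 * \<alpha> + p2 * \<alpha>^2 = q0 + q1 * \<alpha> + q2 * \<alpha>^2"
    and y: "y = q0 + q1 * \<beta> + q2 * \<beta>^2" by blast
  from eq have "(p0 - q0) + (p1 - q1) * \<alpha> + (p2 - q2) * \<alpha>^2 = 0" by Groebner_Basis.algebra
  then have "p0 - q0 = 0 \<and> p1 - q1 = 0 \<and> p2 - q2 = 0"
    using p q by (intro independent[of \<alpha>]) auto
  then show "y = p0 + p1 * \<beta> + p2 * \<beta>^2" by (simp add: y)
qed

lemma E_E:
  assumes "x \<in> E"
  obtains p0 p1 p2 where "p0 \<in> K" "p1 \<in> K" "p2 \<in> K"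
    "x = p0 + p1 * \<alpha> + p2 * \<alpha>^2" "s x = p0 + p1 * \<beta> + p2 * \<beta>^2"
  using assms by (auto simp: E_def s_eval)

lemma E_I: "p0 \<in> K \<Longrightarrow> p1 \<in> K \<Longrightarrow> p2 \<in> K \<Longrightarrow> p0 + p1 * \<alpha> + p2 * \<alpha>^2 \<in> E"
  by (auto simp: E_def)

text \<open>The same reduction modulo the cubic is valid at every root; comparing
  \<open>\<alpha>\<close> with \<open>\<beta>\<close> makes \<open>s\<close> multiplicative.\<close>

lemma mult_reduce:
  assumes "\<rho> = \<alpha> \<or> \<rho> = \<beta> \<or> \<rho> = \<gamma>"
  shows "(p0 + p1 * \<rho> + p2 * \<rho>^2) * (q0 + q1 * \<rho> + q2 * \<rho>^2) =
    (p0 * q0 + (p1 * q2 + p2 * q1) + t * (p2 * q2)) +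
    (p0 * q1 + p1 * q0 - t' * (p1 * q2 + p2 * q1) + (1 - t * t') * (p2 * q2)) * \<rho> +
    (p0 * q2 + p1 * q1 + p2 * q0 + t * (p1 * q2 + p2 * q1) + (t^2 - t') * (p2 * q2)) * \<rho>^2"
proof -
  have "\<rho>^3 - t * \<rho>^2 + t' * \<rho> - 1 = 0" using root_iff assms by blast
  then show ?thesis by Groebner_Basis.algebra
qed

lemma E_add:
  assumes "x \<in> E" "y \<in> E" shows "x + y \<in> E" "s (x + y) = s x + s y"
proof -
  obtain p0 p1 p2 where x: "p0 \<in> K" "p1 \<in> K" "p2 \<in> K"
    "x = p0 + p1 * \<alpha> + p2 * \<alpha>^2" "s x = p0 + p1 * \<beta> + p2 * \<beta>^2" using assms(1) by (rule E_E)
  obtain q0 q1 q2 where y: "q0 \<in> K" "q1 \<in> K" "q2 \<in> K"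
    "y = q0 + q1 * \<alpha> + q2 * \<alpha>^2" "s y = q0 + q1 * \<beta> + q2 * \<beta>^2" using assms(2) by (rule E_E)
  have eq: "x + y = (p0 + q0) + (p1 + q1) * \<alpha> + (p2 + q2) * \<alpha>^2" unfolding x y by Groebner_Basis.algebra
  show "x + y \<in> E" unfolding eq by (rule E_I) (use x y in auto)
  show "s (x + y) = s x + s y" unfolding eq by (subst s_eval) (use x y in \<open>auto simp: algebra_simps\<close>)
qed

lemma E_mult:
  assumes "x \<in> E" "y \<in> E" shows "x * y \<in> E" "s (x * y) = s x * s y"
proof -
  obtain p0 p1 p2 where x: "p0 \<in> K" "p1 \<in> K" "p2 \<in> K"
    "x = p0 + p1 * \<alpha> + p2 * \<alpha>^2" "s x = p0 + p1 * \<beta> + p2 * \<beta>^2" using assms(1) by (rule E_E)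
  obtain q0 q1 q2 where y: "q0 \<in> K" "q1 \<in> K" "q2 \<in> K"
    "y = q0 + q1 * \<alpha> + q2 * \<alpha>^2" "s y = q0 + q1 * \<beta> + q2 * \<beta>^2" using assms(2) by (rule E_E)
  show "x * y \<in> E" unfolding x(4) y(4) mult_reduce[of \<alpha>, simplified] by (rule E_I) (use x y in auto)
  show "s (x * y) = s x * s y"
    unfolding x(5) y(5) mult_reduce[of \<beta>, simplified] unfolding x(4) y(4) mult_reduce[of \<alpha>, simplified]
    by (rule s_eval) (use x y in auto)
qed

lemma K_E: "x \<in> K \<Longrightarrow> x \<in> E" "x \<in> K \<Longrightarrow> s x = x"
  using E_I[of x 0 0] s_eval[of x 0 0] by auto

lemma \<alpha>_E: "\<alpha> \<in> E" "s \<alpha> = \<beta>"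
  using E_I[of 0 1 0] s_eval[of 0 1 0] by auto

lemma E_minus:
  assumes "x \<in> E" shows "- x \<in> E" "s (- x) = - s x" "y \<in> E \<Longrightarrow> x - y \<in> E" "y \<in> E \<Longrightarrow> s (x - y) = s x - s y"
proof -
  have neg: "- z \<in> E" "s (- z) = - s z" if "z \<in> E" for z
    using E_mult[of "- 1" z] that K_E[of "- 1"] by simp_all
  show "- x \<in> E" "s (- x) = - s x" by (rule neg[OF assms])+
  show "x - y \<in> E" "s (x - y) = s x - s y" if "y \<in> E"
    using E_add[of x "- y"] neg[OF that] assms by simp_all
qed

lemma E_field: "subfield_set E"
  unfolding subfield_set_def
proof (intro conjI ballI E_add E_mult)
  show "0 \<in> E" "1 \<in> E" by (simp_all add: K_E)
  fix x assume x: "x \<in> E"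
  then show "- x \<in> E" by (rule E_minus)
  show "inverse x \<in> E"
  proof (cases "x = 0")
    case True
    then show ?thesis by (simp add: K_E)
  next
    case False
    obtain p0 p1 p2 where p: "p0 \<in> K" "p1 \<in> K" "p2 \<in> K" "x = p0 + p1 * \<alpha> + p2 * \<alpha>^2"
      "s x = p0 + p1 * \<beta> + p2 * \<beta>^2" using x by (rule E_E)
    \<comment> \<open>The product of the values at the other two roots, so that \<open>x y\<close>
      is the norm. It is symmetric in \<open>\<beta>\<close> and \<open>\<gamma>\<close>, hence a
      polynomial in \<open>S = \<beta> + \<gamma>\<close> and \<open>P = \<beta> \<gamma>\<close>,
      which in turn are polynomials in \<open>\<alpha>\<close>.\<close>
    define y where "y = (p0 + p1 * \<beta> + p2 * \<beta>^2) * (p0 + p1 * \<gamma> + p2 * \<gamma>^2)"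
    define S P where "S = t - \<alpha>" and "P = t' - \<alpha> * S"
    have y_eq: "y = p0 * p0 + p0 * p1 * S + p0 * p2 * (S * S - 2 * P) + p1 * p1 * P + p1 * p2 * (P * S) + p2 * p2 * (P * P)"
      unfolding y_def S_def P_def t t' by Groebner_Basis.algebra
    have SP: "S \<in> E" "P \<in> E" unfolding P_def S_def by (simp_all add: E_minus E_mult K_E \<alpha>_E)
    have pE: "p0 \<in> E" "p1 \<in> E" "p2 \<in> E" "2 \<in> E" using p by (simp_all add: K_E)
    then have "y \<in> E" unfolding y_eq by (simp only: E_add E_mult E_minus SP)
    have "p0 + p1 * \<rho> + p2 * \<rho>^2 \<noteq> 0" if "\<rho> = \<beta> \<or> \<rho> = \<gamma>" for \<rho>
      using independent[of \<rho> p0 p1 p2] that p False by auto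
    then have "y \<noteq> 0" by (simp add: y_def)
    have N: "x * y = cubic_norm t t' p0 p1 p2"
      unfolding cubic_norm_eq y_def p by (simp add: mult.assoc)
    have "inverse x = inverse (cubic_norm t t' p0 p1 p2) * y"
      unfolding N[symmetric] using False \<open>y \<noteq> 0\<close> by simp
    also have "\<dots> \<in> E"
      by (rule E_mult(1)[OF K_E(1) \<open>y \<in> E\<close>]) (use p in \<open>simp add: cubic_norm_def\<close>)
    finally show ?thesis .
  qed
qed

end

section \<open>Surjectivity of the cubic norm\<close>

locale cubic_galois = cubic_irreducible +
  assumes \<delta>_K: "\<delta> \<in> K"
begin

lemmas E_simps = subfield_setD[OF E_field]

text \<open>The sum \<open>\<beta> + \<gamma>\<close> is \<open>t - \<alpha>\<close>, and the
  difference \<open>\<beta> - \<gamma>\<close> is \<open>- \<delta> / c\<close>, where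
  \<open>c\<close> is the derivative of the cubic at \<open>\<alpha>\<close>; so
  \<open>\<beta>\<close> is rational in \<open>\<alpha>\<close>. Applying \<open>s\<close> to this
  formula moves \<open>\<alpha>\<close> to \<open>\<beta>\<close> and produces
  \<open>\<gamma>\<close>.\<close>

lemma \<beta>_E: "\<beta> \<in> E" "s \<beta> = \<gamma>"
proof -
  define c where "c = 3 * \<alpha>^2 - 2 * t * \<alpha> + t'"
  have c: "c = (\<alpha> - \<beta>) * (\<alpha> - \<gamma>)" unfolding c_def t t' by Groebner_Basis.algebra
  have cE: "c \<in> E" unfolding c_def
    by (intro E_simps) (auto simp: E_simps \<alpha>_E K_E)
  have c0: "c \<noteq> 0" using roots_distinct by (auto simp: c)
  have "- \<delta> = (\<beta> - \<gamma>) * c" by (simp add: c \<delta>_def algebra_simps)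
  then have dc: "\<beta> - \<gamma> = - \<delta> / c" using c0 by simp
  define i where "i = inverse c"
  have iE: "i \<in> E" using cE by (simp add: i_def E_simps)
  define b where "b = inverse 2 * (t + (- 1) * \<alpha> + (- \<delta>) * i)"
  have b: "b = \<beta>"
  proof -
    have "t + (- 1) * \<alpha> + (- \<delta>) * i = \<beta> + \<gamma> + (\<beta> - \<gamma>)"
      unfolding dc i_def by (simp add: t divide_inverse)
    also have "\<dots> = 2 * \<beta>" by simp
    finally show ?thesis using two by (simp add: b_def)
  qed
  have mem: "inverse 2 \<in> E" "- \<delta> \<in> E" "t \<in> E" "- 1 \<in> E" using \<delta>_K by (simp_all add: K_E)
  have sm: "s (inverse 2) = inverse 2" "s (- \<delta>) = - \<delta>" "s t = t" "s (- 1) = - 1"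
    by (rule K_E, simp add: \<delta>_K)+
  have "b \<in> E" using mem
    unfolding b_def by (intro E_mult E_add) (auto simp: \<alpha>_E iE)
  then show "\<beta> \<in> E" unfolding b .
  have "s c * s i = s 1" unfolding E_mult(2)[OF cE iE, symmetric] using c0 by (simp add: i_def)
  then have si: "s i = inverse (s c)" by (simp add: K_E inverse_unique)
  have sc: "s c = (\<beta> - \<alpha>) * (\<beta> - \<gamma>)"
  proof -
    have "s c = 3 * \<beta>^2 + (- 2 * t) * \<beta> + t'"
      unfolding c_def using s_eval[of t' "- 2 * t" 3] by (simp add: algebra_simps)
    also have "\<dots> = (\<beta> - \<alpha>) * (\<beta> - \<gamma>)" unfolding t t' by Groebner_Basis.algebra
    finally show ?thesis .
  qed
  have "s b = inverse 2 * (t + (- 1) * \<beta> + (- \<delta>) * s i)"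
    unfolding b_def by (simp only: E_mult E_add \<alpha>_E iE mem sm)
  also have "(- \<delta>) * s i = \<gamma> - \<alpha>"
  proof -
    have "- \<delta> = (\<gamma> - \<alpha>) * s c" unfolding sc \<delta>_def by Groebner_Basis.algebra
    moreover have "s c \<noteq> 0" unfolding sc using roots_distinct by simp
    ultimately show ?thesis unfolding si by simp
  qed
  also have "inverse 2 * (t + (- 1) * \<beta> + (\<gamma> - \<alpha>)) = \<gamma>"
    using two by (simp add: t)
  finally show "s \<beta> = \<gamma>" unfolding b .
qed

lemma \<gamma>_E: "\<gamma> \<in> E" "s \<gamma> = \<alpha>"
proof -
  have g: "\<gamma> = t - \<alpha> - \<beta>" by (simp add: t)
  show "\<gamma> \<in> E" unfolding g by (simp add: E_minus \<alpha>_E \<beta>_E K_E)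
  have "s \<gamma> = t - \<beta> - \<gamma>" by (subst g) (simp add: E_minus \<alpha>_E \<beta>_E K_E)
  then show "s \<gamma> = \<alpha>" by (simp add: t)
qed

lemma s_iterate:
  assumes p: "p0 \<in> K" "p1 \<in> K" "p2 \<in> K"
  shows "s (p0 + p1 * \<alpha> + p2 * \<alpha>^2) = p0 + p1 * \<beta> + p2 * \<beta>^2"
    "s (p0 + p1 * \<beta> + p2 * \<beta>^2) = p0 + p1 * \<gamma> + p2 * \<gamma>^2"
    "s (p0 + p1 * \<gamma> + p2 * \<gamma>^2) = p0 + p1 * \<alpha> + p2 * \<alpha>^2"
  using p by (simp_all add: power2_eq_square E_mult E_add \<alpha>_E \<beta>_E \<gamma>_E K_E)

lemma cyclic_cubic:
  assumes "m \<in> K" "m \<noteq> 0"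
  shows "cyclic_cubic K E s \<alpha> m"
proof
  show "s x \<in> E" if "x \<in> E" for x
    using that by (rule E_E) (auto intro!: E_add E_mult simp: \<beta>_E K_E power2_eq_square)
  show "s (s (s x)) = x" if "x \<in> E" for x
    using that by (rule E_E) (auto simp: s_iterate)
  show "s x = x \<longleftrightarrow> x \<in> K" if xE: "x \<in> E" for x
  proof
    assume sx: "s x = x"
    obtain p0 p1 p2 where p: "p0 \<in> K" "p1 \<in> K" "p2 \<in> K" "x = p0 + p1 * \<alpha> + p2 * \<alpha>^2"
      "s x = p0 + p1 * \<beta> + p2 * \<beta>^2" using xE by (rule E_E)
    \<comment> \<open>A polynomial of degree at most 2 with equal values at three distinct points is
      constant.\<close>
    have "p0 + p1 * \<alpha> + p2 * \<alpha>^2 = p0 + p1 * \<beta> + p2 * \<beta>^2" using sx p(4,5) by simp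
    moreover from arg_cong[OF this, of s]
    have "p0 + p1 * \<beta> + p2 * \<beta>^2 = p0 + p1 * \<gamma> + p2 * \<gamma>^2"
      unfolding s_iterate[OF p(1-3)] .
    ultimately have "p1 * \<alpha> + p2 * \<alpha>^2 = p1 * \<beta> + p2 * \<beta>^2" "p1 * \<beta> + p2 * \<beta>^2 = p1 * \<gamma> + p2 * \<gamma>^2"
      by auto
    then have "(\<alpha> - \<beta>) * (p1 + p2 * (\<alpha> + \<beta>)) = 0" "(\<beta> - \<gamma>) * (p1 + p2 * (\<beta> + \<gamma>)) = 0"
      by Groebner_Basis.algebra+
    then have *: "p1 + p2 * (\<alpha> + \<beta>) = 0" "p1 + p2 * (\<beta> + \<gamma>) = 0" using roots_distinct by auto
    then have "p2 * (\<gamma> - \<alpha>) = 0" by Groebner_Basis.algebra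
    then have "p2 = 0" using roots_distinct by auto
    with * p show "x \<in> K" by simp
  qed (simp add: K_E)
  show "\<exists>a\<in>K. \<exists>b\<in>K. \<exists>c\<in>K. x = a + b * \<alpha> + c * \<alpha>^2" if "x \<in> E" for x
    using that by (auto simp: E_def)
qed (use assms K E_field roots_distinct in \<open>auto simp: E_add E_mult K_E \<alpha>_E\<close>)

lemma cubic_norm_surjective:
  assumes "brauer_group_trivial (subfield_ring K)" "m \<in> K" "m \<noteq> 0"
  shows "\<exists>p0\<in>K. \<exists>p1\<in>K. \<exists>p2\<in>K. cubic_norm t t' p0 p1 p2 = m"
proof -
  interpret c: cyclic_cubic K E s \<alpha> m by (rule cyclic_cubic) fact+
  from c.norm_surjective[OF assms(1)] obtain b where b: "b \<in> E" "m = b * s b * s (s b)" by blast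
  obtain p0 p1 p2 where p: "p0 \<in> K" "p1 \<in> K" "p2 \<in> K" "b = p0 + p1 * \<alpha> + p2 * \<alpha>^2"
    "s b = p0 + p1 * \<beta> + p2 * \<beta>^2" using b(1) by (rule E_E)
  have "cubic_norm t t' p0 p1 p2 = m"
    unfolding b(2) p(5) s_iterate(2)[OF p(1-3)] unfolding p(4) cubic_norm_eq ..
  with p show ?thesis by blast
qed

end

text \<open>After adjoining \<open>\<delta>\<close> the cubic is cyclic. To descend, a solution over
  the quadratic extension is multiplied by its conjugate, which puts the coefficients into
  \<open>K\<close>, and by a scalar, which changes the norm by a cube.\<close>

lemma (in cubic_irreducible) cubic_norm_surjective:
  assumes brauer: "brauer_group_trivial (subfield_ring (adjoin_sqrt K \<delta>))" and m: "m \<in> K" "m \<noteq> 0"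
  shows "\<exists>p0\<in>K. \<exists>p1\<in>K. \<exists>p2\<in>K. cubic_norm t t' p0 p1 p2 = m"
proof -
  define M where "M = adjoin_sqrt K \<delta>"
  have \<delta>2: "\<delta>^2 \<in> K" by (simp add: \<delta>_square)
  have M: "subfield_set M" unfolding M_def by (rule subfield_adjoin_sqrt[OF K \<delta>2])
  have KM: "K \<subseteq> M" "\<delta> \<in> M" unfolding M_def by (rule subset_adjoin_sqrt[OF K])+
  interpret M: cubic_irreducible \<alpha> \<beta> \<gamma> t t' M
    by unfold_locales (use M KM tK two no_root_adjoin in \<open>auto simp: M_def\<close>)
  interpret M: cubic_galois \<alpha> \<beta> \<gamma> t t' M
    by unfold_locales (rule KM)
  define n where "n = inverse m"
  have n: "n \<in> K" "n \<noteq> 0" using m by (simp_all add: n_def)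
  obtain p0 p1 p2 where p: "p0 \<in> M" "p1 \<in> M" "p2 \<in> M" "cubic_norm t t' p0 p1 p2 = n"
    using M.cubic_norm_surjective[OF brauer[folded M_def], of n] n KM by blast
  show ?thesis
  proof (cases "\<delta> \<in> K")
    case True
    then have "M \<subseteq> K" by (auto simp: M_def adjoin_sqrt_def)
    then show ?thesis using M.cubic_norm_surjective[OF brauer[folded M_def], of m] m KM by blast
  next
    case False
    \<comment> \<open>\<open>R x y\<close> says that \<open>y\<close> is the conjugate of
      \<open>x\<close> over \<open>K\<close>. As a relation, conjugation is seen at once to respect
      sums and products; \<open>R_unique\<close> says that an element of \<open>K\<close> is its own
      conjugate.\<close>
    define R where "R x y \<longleftrightarrow> (\<exists>u\<in>K. \<exists>v\<in>K. x = u + v * \<delta> \<and> y = u - v * \<delta>)" for x y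
    have R_K: "R x x" if "x \<in> K" for x
      unfolding R_def using that by (intro bexI[of _ x] bexI[of _ 0]) auto
    have R_ex: "\<exists>y. R x y" if "x \<in> M" for x
      using that unfolding R_def M_def adjoin_sqrt_def by blast
    have R_add: "R (x + x') (y + y')" if RR: "R x y" "R x' y'" for x x' y y'
    proof -
      obtain u v u' v' where *: "u \<in> K" "v \<in> K" "u' \<in> K" "v' \<in> K" "x = u + v * \<delta>" "y = u - v * \<delta>"
        "x' = u' + v' * \<delta>" "y' = u' - v' * \<delta>" using RR by (auto simp: R_def)
      then show ?thesis unfolding R_def
        by (intro bexI[of _ "u + u'"] bexI[of _ "v + v'"]) (auto simp: algebra_simps)
    qed
    have R_mult: "R (x * x') (y * y')" if RR: "R x y" "R x' y'" for x x' y y'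
    proof -
      obtain u v u' v' where *: "u \<in> K" "v \<in> K" "u' \<in> K" "v' \<in> K" "x = u + v * \<delta>" "y = u - v * \<delta>"
        "x' = u' + v' * \<delta>" "y' = u' - v' * \<delta>" using RR by (auto simp: R_def)
      then show ?thesis unfolding R_def using \<delta>2
        by (intro bexI[of _ "u * u' + v * v' * \<delta>^2"] bexI[of _ "u * v' + v * u'"])
          (auto simp: algebra_simps power2_eq_square)
    qed
    have R_trace: "x * y' + x' * y \<in> K" if RR: "R x y" "R x' y'" for x x' y y'
    proof -
      obtain u v u' v' where *: "u \<in> K" "v \<in> K" "u' \<in> K" "v' \<in> K" "x = u + v * \<delta>" "y = u - v * \<delta>"
        "x' = u' + v' * \<delta>" "y' = u' - v' * \<delta>" using RR by (auto simp: R_def)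
      have "x * y' + x' * y = 2 * (u * u' - v * v' * \<delta>^2)" unfolding * by Groebner_Basis.algebra
      then show ?thesis using * \<delta>2 by simp
    qed
    have R_norm: "x * y \<in> K" if RR: "R x y" for x y
    proof -
      obtain u v where *: "u \<in> K" "v \<in> K" "x = u + v * \<delta>" "y = u - v * \<delta>" using RR by (auto simp: R_def)
      have "x * y = u^2 - v^2 * \<delta>^2" unfolding * by Groebner_Basis.algebra
      then show ?thesis using * \<delta>2 by simp
    qed
    have R_unique: "y = x" if RR: "R x y" "x \<in> K" for x y
    proof -
      obtain u v where *: "u \<in> K" "v \<in> K" "x = u + v * \<delta>" "y = u - v * \<delta>" using RR by (auto simp: R_def)
      have "u + v * \<delta> = x + 0 * \<delta>" using *(3) by simp
      then have "u = x \<and> v = 0"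
        by (rule adjoin_sqrt_unique[OF K False *(1,2) RR(2) K_simps(1)])
      then have "v = 0" by simp
      then show ?thesis using *(3,4) by simp
    qed
    obtain q0 q1 q2 where q: "R p0 q0" "R p1 q1" "R p2 q2" using R_ex p by metis
    have "R (cubic_norm t t' p0 p1 p2) (cubic_norm t t' q0 q1 q2)"
      unfolding cubic_norm_def power2_eq_square power3_eq_cube
      by (intro R_add R_mult R_K q) simp_all
    then have nq: "cubic_norm t t' q0 q1 q2 = n" using R_unique p(4) n by auto
    \<comment> \<open>The coefficients of the product \<open>p q\<close>, reduced modulo the cubic
      as in \<open>mult_reduce\<close>; each is invariant under conjugation.\<close>
    define r0 where "r0 = p0 * q0 + (p1 * q2 + p2 * q1) + t * (p2 * q2)"
    define r1 where "r1 = p0 * q1 + p1 * q0 - t' * (p1 * q2 + p2 * q1) + (1 - t * t') * (p2 * q2)"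
    define r2 where "r2 = p0 * q2 + p1 * q1 + p2 * q0 + t * (p1 * q2 + p2 * q1) + (t^2 - t') * (p2 * q2)"
    have tr: "p0 * q1 + p1 * q0 \<in> K" "p1 * q2 + p2 * q1 \<in> K" "p0 * q2 + p2 * q0 \<in> K"
      using R_trace q by blast+
    have no: "p0 * q0 \<in> K" "p1 * q1 \<in> K" "p2 * q2 \<in> K" using R_norm q by blast+
    have r2': "r2 = (p0 * q2 + p2 * q0) + p1 * q1 + t * (p1 * q2 + p2 * q1) + (t^2 - t') * (p2 * q2)"
      by (simp add: r2_def)
    have rK: "r0 \<in> K" "r1 \<in> K" "r2 \<in> K"
      unfolding r0_def r1_def r2' using tr no by simp_all
    \<comment> \<open>If \<open>p\<close> and its conjugate \<open>q\<close> have norm \<open>1/m\<close>, then \<open>m p q\<close> is invariant and has norm \<open>m\<^sup>3 m\<^sup>-\<^sup>2 = m\<close>.\<close>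
    have "cubic_norm t t' r0 r1 r2 = cubic_norm t t' p0 p1 p2 * cubic_norm t t' q0 q1 q2"
    proof -
      have "r0 + r1 * \<rho> + r2 * \<rho>^2 = (p0 + p1 * \<rho> + p2 * \<rho>^2) * (q0 + q1 * \<rho> + q2 * \<rho>^2)"
        if "\<rho> = \<alpha> \<or> \<rho> = \<beta> \<or> \<rho> = \<gamma>" for \<rho>
        unfolding mult_reduce[OF that] r0_def r1_def r2_def ..
      then show ?thesis unfolding cubic_norm_eq by (simp add: mult_ac)
    qed
    then have nr: "cubic_norm t t' r0 r1 r2 = n^2" by (simp add: p(4) nq power2_eq_square)
    have "cubic_norm t t' (m * r0) (m * r1) (m * r2) = m^3 * cubic_norm t t' r0 r1 r2"
      unfolding cubic_norm_def by Groebner_Basis.algebra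
    also have "\<dots> = m" unfolding nr n_def using m(2) by (simp add: power2_eq_square power3_eq_cube field_simps)
    finally show ?thesis using rK m by (intro bexI[of _ "m * r0"] bexI[of _ "m * r1"] bexI[of _ "m * r2"]) auto
  qed
qed

lemma cubic_roots_exist:
  fixes t t' :: "'l :: alg_closed_field"
  shows "\<exists>\<alpha> \<beta> \<gamma>. cubic_roots \<alpha> \<beta> \<gamma> t t'"
proof -
  have "\<exists>x. poly [:- 1, t', - t, 1:] x = 0" by (rule alg_closed_imp_poly_has_root) auto
  then obtain \<alpha> where "poly [:- 1, t', - t, 1:] \<alpha> = 0" ..
  then have \<alpha>: "\<alpha>^3 - t * \<alpha>^2 + t' * \<alpha> = 1" by (simp add: algebra_simps power2_eq_square power3_eq_cube)
  then have "\<alpha> \<noteq> 0" by auto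
  \<comment> \<open>The quotient of the cubic by \<open>X - \<alpha>\<close>; its constant term is
    \<open>inverse \<alpha>\<close> because the roots have product 1.\<close>
  have "\<exists>x. poly [:inverse \<alpha>, \<alpha> - t, 1:] x = 0" by (rule alg_closed_imp_poly_has_root) auto
  then obtain \<beta> where "poly [:inverse \<alpha>, \<alpha> - t, 1:] \<beta> = 0" ..
  then have "inverse \<alpha> + (\<alpha> - t) * \<beta> + \<beta>^2 = 0" by (simp add: algebra_simps power2_eq_square)
  then have "\<alpha> * (inverse \<alpha> + (\<alpha> - t) * \<beta> + \<beta>^2) = 0" by simp
  then have \<beta>: "\<alpha> * \<beta> * (t - \<alpha> - \<beta>) = 1"
    using \<open>\<alpha> \<noteq> 0\<close> by (simp add: algebra_simps power2_eq_square)
  have "\<alpha> * t' = \<alpha> * (\<alpha> * \<beta> + \<beta> * (t - \<alpha> - \<beta>) + (t - \<alpha> - \<beta>) * \<alpha>)"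
    using \<alpha> \<beta> by Groebner_Basis.algebra
  with \<open>\<alpha> \<noteq> 0\<close> have "t' = \<alpha> * \<beta> + \<beta> * (t - \<alpha> - \<beta>) + (t - \<alpha> - \<beta>) * \<alpha>" by simp
  with \<beta> show ?thesis
    by (intro exI[of _ \<alpha>] exI[of _ \<beta>] exI[of _ "t - \<alpha> - \<beta>"]) (unfold_locales, auto)
qed

lemma cubic_norm_surjective:
  fixes K :: "'k :: field alg_closure set"
  assumes cd: "cd_le_one TYPE('k)" and two: "(2 :: 'k alg_closure) \<noteq> 0"
    and Kk: "subfield_set K" "range to_ac \<subseteq> K" and tK: "t \<in> K" "t' \<in> K"
    and no_root: "\<And>x. x \<in> K \<Longrightarrow> x^3 - t * x^2 + t' * x - 1 \<noteq> 0" and m: "m \<in> K" "m \<noteq> 0"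
  shows "\<exists>p0\<in>K. \<exists>p1\<in>K. \<exists>p2\<in>K. cubic_norm t t' p0 p1 p2 = m"
proof -
  obtain \<alpha> \<beta> \<gamma> where "cubic_roots \<alpha> \<beta> \<gamma> t t'" using cubic_roots_exist by blast
  then interpret cubic_roots \<alpha> \<beta> \<gamma> t t' .
  interpret cubic_irreducible \<alpha> \<beta> \<gamma> t t' K
    by unfold_locales (rule Kk(1) tK two no_root, assumption?)+
  have "subfield_set (adjoin_sqrt K \<delta>)"
    by (rule subfield_adjoin_sqrt[OF Kk(1)]) (simp add: \<delta>_square)
  moreover have "range to_ac \<subseteq> adjoin_sqrt K \<delta>"
    using Kk(2) subset_adjoin_sqrt(1)[OF Kk(1)] by blast
  ultimately show ?thesis
    by (intro cubic_norm_surjective cd_le_oneD[OF cd] m)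
qed

section \<open>Alternating trilinear forms of rank three\<close>

text \<open>\<open>T\<close> plays the role of a determinant in rank 3, but scalars do not act on
  \<open>W\<close>: vectors are compared only through the values of \<open>T\<close>. This admits a
  module over \<open>k x k\<close> of which \<open>T\<close> sees just one component.\<close>

locale alternating_rank3 =
  fixes W :: "'c set" and T :: "'c \<Rightarrow> 'c \<Rightarrow> 'c \<Rightarrow> 'l :: field" and g gi :: "'c \<Rightarrow> 'c"
    and u v w :: 'c and K :: "'l set"
  assumes uvw: "u \<in> W" "v \<in> W" "w \<in> W"
    and g: "x \<in> W \<Longrightarrow> g x \<in> W" "x \<in> W \<Longrightarrow> gi x \<in> W" "x \<in> W \<Longrightarrow> g (gi x) = x"
    and T_g: "x \<in> W \<Longrightarrow> y \<in> W \<Longrightarrow> z \<in> W \<Longrightarrow> T (g x) (g y) (g z) = T x y z"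
    and T_swap12: "x \<in> W \<Longrightarrow> y \<in> W \<Longrightarrow> z \<in> W \<Longrightarrow> T y x z = - T x y z"
    and T_swap23: "x \<in> W \<Longrightarrow> y \<in> W \<Longrightarrow> z \<in> W \<Longrightarrow> T x z y = - T x y z"
    and T_alt: "x \<in> W \<Longrightarrow> y \<in> W \<Longrightarrow> T x x y = 0"
    and T_uvw: "T u v w \<noteq> 0"
    and expand: "x \<in> W \<Longrightarrow> \<exists>a b c. \<forall>y\<in>W. \<forall>z\<in>W. T x y z = a * T u y z + b * T v y z + c * T w y z"
    and K: "subfield_set K" and T_K: "x \<in> W \<Longrightarrow> y \<in> W \<Longrightarrow> z \<in> W \<Longrightarrow> T x y z \<in> K"
begin

declare uvw [simp] g [simp]
lemmas K_simps [simp] = subfield_setD[OF K]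
declare T_K [simp] T_alt [simp] T_g [simp]

lemma T_alt' [simp]:
  assumes "x \<in> W" "y \<in> W" shows "T x y x = 0" "T y x x = 0"
proof -
  show "T x y x = 0" unfolding T_swap23[OF assms(1,1,2)] using assms by simp
  then show "T y x x = 0" unfolding T_swap12[OF assms assms(1)] by simp
qed

lemma T_cyclic: "x \<in> W \<Longrightarrow> y \<in> W \<Longrightarrow> z \<in> W \<Longrightarrow> T y z x = T x y z"
  by (simp add: T_swap12[of x y z] T_swap23[of y x z])

text \<open>Coordinates with respect to \<open>u\<close>, \<open>v\<close>, \<open>w\<close>, by
  Cramer's rule.\<close>

definition c1 where "c1 x = T x v w / T u v w"
definition c2 where "c2 x = T u x w / T u v w"
definition c3 where "c3 x = T u v x / T u v w"

lemma T_expand: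
  assumes "x \<in> W" "y \<in> W" "z \<in> W"
  shows "T x y z = c1 x * T u y z + c2 x * T v y z + c3 x * T w y z"
proof -
  obtain a b c where *: "\<And>y z. y \<in> W \<Longrightarrow> z \<in> W \<Longrightarrow> T x y z = a * T u y z + b * T v y z + c * T w y z"
    using expand[OF assms(1)] by blast
  have "c1 x = a" using T_uvw by (simp add: c1_def *)
  moreover have "c2 x = b"
    using T_uvw assms(1) by (simp add: c2_def T_swap12[of x u w] *) (simp add: T_swap12[of u v w])
  moreover have "c3 x = c"
    using T_uvw assms(1) by (simp add: c3_def T_cyclic[of x u v] *) (simp add: T_cyclic[of w u v])
  ultimately show ?thesis using * assms by simp
qed

lemma T_det:
  assumes "x \<in> W" "y \<in> W" "z \<in> W"
  shows "T x y z = T u v w * (c1 x * (c2 y * c3 z - c3 y * c2 z) - c2 x * (c1 y * c3 z - c3 y * c1 z)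
    + c3 x * (c1 y * c2 z - c2 y * c1 z))"
proof -
  have *: "T u v z = T u v w * c3 z" "T u w z = - (T u v w * c2 z)" "T v w z = T u v w * c1 z"
    using T_uvw assms by (simp_all add: c1_def c2_def c3_def T_swap23[of u z w] T_cyclic[of z v w])
  have u: "T u y z = T u v w * (c2 y * c3 z - c3 y * c2 z)"
    using assms T_expand[of y u z] T_swap12[of y u z] T_swap12[of u v z] T_swap12[of u w z]
    by (simp add: * algebra_simps)
  have v: "T v y z = - T u v w * (c1 y * c3 z - c3 y * c1 z)"
    using assms T_expand[of y v z] T_swap12[of y v z] T_swap12[of v w z]
    by (simp add: * algebra_simps)
  have w: "T w y z = T u v w * (c1 y * c2 z - c2 y * c1 z)"
    using assms T_expand[of y w z] T_swap12[of y w z]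
    by (simp add: * algebra_simps)
  show ?thesis
    unfolding T_expand[OF assms] u v w by (simp add: algebra_simps)
qed

lemma T_g_first:
  assumes "x \<in> W" "y \<in> W" "z \<in> W"
  shows "T (g x) y z = T x (gi y) (gi z)"
  using T_g[of x "gi y" "gi z"] assms by simp

lemma c_g:
  assumes "x \<in> W"
  shows "c1 (g x) = c1 x * c1 (g u) + c2 x * c1 (g v) + c3 x * c1 (g w)"
    "c2 (g x) = c1 x * c2 (g u) + c2 x * c2 (g v) + c3 x * c2 (g w)"
    "c3 (g x) = c1 x * c3 (g u) + c2 x * c3 (g v) + c3 x * c3 (g w)"
proof -
  have *: "T (g x) y z = c1 x * T (g u) y z + c2 x * T (g v) y z + c3 x * T (g w) y z" if "y \<in> W" "z \<in> W" for y z
    using assms that T_expand[of x "gi y" "gi z"] by (simp add: T_g_first)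
  show "c1 (g x) = c1 x * c1 (g u) + c2 x * c1 (g v) + c3 x * c1 (g w)"
    using * by (simp add: c1_def add_divide_distrib)
  have c2: "c2 z = - T z u w / T u v w" if "z \<in> W" for z using that by (simp add: c2_def T_swap12[of u z w])
  show "c2 (g x) = c1 x * c2 (g u) + c2 x * c2 (g v) + c3 x * c2 (g w)"
    using assms by (simp add: c2[of "g x"] c2[of "g u"] c2[of "g v"] c2[of "g w"] * add_divide_distrib diff_divide_distrib)
  have c3: "c3 z = T z u v / T u v w" if "z \<in> W" for z using that by (simp add: c3_def T_cyclic[of z u v])
  show "c3 (g x) = c1 x * c3 (g u) + c2 x * c3 (g v) + c3 x * c3 (g w)"
    using assms by (simp add: c3[of "g x"] c3[of "g u"] c3[of "g v"] c3[of "g w"] * add_divide_distrib)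
qed

text \<open>\<open>t\<close> and \<open>t'\<close> are the coefficients of the characteristic
  polynomial \<open>X^3 - t X^2 + t' X - 1\<close> of \<open>g\<close>, obtained by expanding the
  determinant of a shift of \<open>g\<close>; the constant term is -1 by \<open>T_g\<close>.\<close>

definition t where "t = (T (g u) v w + T u (g v) w + T u v (g w)) / T u v w"
definition t' where "t' = (T (g u) (g v) w + T (g u) v (g w) + T u (g v) (g w)) / T u v w"

lemma t_K: "t \<in> K" "t' \<in> K"
  by (simp_all add: t_def t'_def)

lemma t_eq: "t = c1 (g u) + c2 (g v) + c3 (g w)"
  by (simp add: t_def c1_def c2_def c3_def add_divide_distrib)

lemma c_uvw: "c1 u = 1" "c2 u = 0" "c3 u = 0" "c1 v = 0" "c2 v = 1" "c3 v = 0" "c1 w = 0" "c2 w = 0" "c3 w = 1"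
  using T_uvw by (simp_all add: c1_def c2_def c3_def)

lemma t'_eq: "t' = (c1 (g u) * c2 (g v) - c2 (g u) * c1 (g v)) + (c1 (g u) * c3 (g w) - c3 (g u) * c1 (g w))
    + (c2 (g v) * c3 (g w) - c3 (g v) * c2 (g w))"
  using T_uvw by (simp add: t'_def T_det[of "g u" "g v" w] T_det[of "g u" v "g w"] T_det[of u "g v" "g w"] c_uvw)
    (simp add: add_divide_distrib diff_divide_distrib)

lemma T_trace:
  assumes "x \<in> W" "y \<in> W" "z \<in> W"
  shows "T (g x) y z + T x (g y) z + T x y (g z) = t * T x y z"
  unfolding t_eq using assms
  by (simp add: T_det[of "g x" y z] T_det[of x "g y" z] T_det[of x y "g z"] T_det[of x y z] c_g[of x] c_g[of y] c_g[of z])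
    (simp add: algebra_simps)

lemma T_trace':
  assumes "x \<in> W" "y \<in> W" "z \<in> W"
  shows "T (g x) (g y) z + T (g x) y (g z) + T x (g y) (g z) = t' * T x y z"
  unfolding t'_eq using assms
  by (simp add: T_det[of "g x" "g y" z] T_det[of x "g y" "g z"] T_det[of "g x" y "g z"] T_det[of x y z] c_g[of x] c_g[of y] c_g[of z])
    (simp add: algebra_simps)

text \<open>The Cayley-Hamilton theorem: the trace identity at \<open>g (g x)\<close> and the second
  identity at \<open>g x\<close> share two terms, which cancel.\<close>

lemma T_cubic:
  assumes "x \<in> W" "y \<in> W" "z \<in> W"
  shows "T (g (g (g x))) y z = t * T (g (g x)) y z - t' * T (g x) y z + T x y z"
proof -
  have "T (g (g (g x))) y z + T (g (g x)) (g y) z + T (g (g x)) y (g z) = t * T (g (g x)) y z"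
    using T_trace[of "g (g x)" y z] assms by simp
  moreover have "T (g (g x)) (g y) z + T (g (g x)) y (g z) + T x y z = t' * T (g x) y z"
    using T_trace'[of "g x" y z] assms by simp
  ultimately show ?thesis by Groebner_Basis.algebra
qed

text \<open>Four vectors in rank 3 satisfy Cramer's relation; \<open>r\<close> and \<open>s\<close>
  serve to test it.\<close>

lemma cramer:
  assumes "a \<in> W" "b \<in> W" "c \<in> W" "y \<in> W" "r \<in> W" "s \<in> W"
  shows "T b c y * T a r s - T a c y * T b r s + T a b y * T c r s = T a b c * T y r s"
  using assms
  by (simp add: T_det[of b c y] T_det[of a r s] T_det[of a c y] T_det[of b r s] T_det[of a b y]
      T_det[of c r s] T_det[of a b c] T_det[of y r s]) (simp add: algebra_simps)

text \<open>The determinant of \<open>l - g\<close>; as far as \<open>T\<close> can tell,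
  \<open>x'\<close> is \<open>(l - g) x\<close>, and likewise for \<open>y'\<close> and
  \<open>z'\<close>.\<close>

lemma T_shift:
  assumes xyz: "x \<in> W" "y \<in> W" "z \<in> W" "x' \<in> W" "y' \<in> W" "z' \<in> W"
    and x': "\<And>r s. r \<in> W \<Longrightarrow> s \<in> W \<Longrightarrow> T x' r s = l * T x r s - T (g x) r s"
    and y': "\<And>r s. r \<in> W \<Longrightarrow> s \<in> W \<Longrightarrow> T y' r s = l * T y r s - T (g y) r s"
    and z': "\<And>r s. r \<in> W \<Longrightarrow> s \<in> W \<Longrightarrow> T z' r s = l * T z r s - T (g z) r s"
  shows "T x' y' z' = (l^3 - t * l^2 + t' * l - 1) * T x y z"
proof -
  have y2: "T a y' b = l * T a y b - T a (g y) b" if "a \<in> W" "b \<in> W" for a b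
    using y'[OF that(2,1)] that xyz by (simp add: T_cyclic[of a y b] T_cyclic[of a y' b] T_cyclic[of a "g y" b])
  have z3: "T a b z' = l * T a b z - T a b (g z)" if "a \<in> W" "b \<in> W" for a b
    using z'[OF that] that xyz by (simp add: T_cyclic[of z a b] T_cyclic[of z' a b] T_cyclic[of "g z" a b])
  have "T x' y' z' = l^3 * T x y z - l^2 * (T (g x) y z + T x (g y) z + T x y (g z))
      + l * (T (g x) (g y) z + T (g x) y (g z) + T x (g y) (g z)) - T (g x) (g y) (g z)"
    using xyz by (simp add: x' y2 z3 del: T_g) (simp add: algebra_simps power2_eq_square power3_eq_cube)
  then show ?thesis
    unfolding T_trace[OF xyz(1-3)] T_trace'[OF xyz(1-3)] T_g[OF xyz(1-3)] by (simp add: algebra_simps)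
qed

text \<open>Otherwise \<open>x\<close> would be an eigenvector in the eyes of \<open>T\<close>, and
  \<open>T_cubic\<close> would make its eigenvalue a root. The witnesses \<open>y0\<close> and
  \<open>z0\<close> say that \<open>x\<close> is visible to \<open>T\<close>.\<close>

lemma linear_independent:
  assumes no_root: "\<And>l. l \<in> K \<Longrightarrow> l^3 - t * l^2 + t' * l - 1 \<noteq> 0"
    and x: "x \<in> W" "y0 \<in> W" "z0 \<in> W" "T x y0 z0 \<noteq> 0"
    and p: "p0 \<in> K" "p1 \<in> K" "\<And>r s. r \<in> W \<Longrightarrow> s \<in> W \<Longrightarrow> p0 * T x r s + p1 * T (g x) r s = 0"
  shows "p0 = 0 \<and> p1 = 0"
proof -
  have "p1 = 0"
  proof (rule ccontr)
    assume p1: "p1 \<noteq> 0"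
    define l where "l = - p0 / p1"
    have l: "T (g x) r s = l * T x r s" if "r \<in> W" "s \<in> W" for r s
    proof -
      have "p1 * T (g x) r s = - p0 * T x r s" using p(3)[OF that] by (simp add: eq_neg_iff_add_eq_0 add.commute)
      then have "T (g x) r s = (- p0 * T x r s) / p1" using p1 by (metis nonzero_mult_div_cancel_left)
      then show ?thesis by (simp add: l_def)
    qed
    have l2: "T (g (g x)) r s = l^2 * T x r s" if "r \<in> W" "s \<in> W" for r s
      using that x l[of "gi r" "gi s"] T_g_first[of "g x" r s] T_g_first[of x r s] l[of r s]
      by (simp add: power2_eq_square)
    have l3: "T (g (g (g x))) r s = l^3 * T x r s" if "r \<in> W" "s \<in> W" for r s
      using that x l2[of "gi r" "gi s"] T_g_first[of "g (g x)" r s] T_g_first[of x r s] l[of r s]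
      by (simp add: power2_eq_square power3_eq_cube)
    have "(l^3 - t * l^2 + t' * l - 1) * T x y0 z0 = 0"
      using T_cubic[of x y0 z0] x l2 l3 l by (simp add: algebra_simps)
    then show False using no_root[of l] x p by (simp add: l_def)
  qed
  with p x show ?thesis by force
qed

text \<open>A dependence between \<open>x\<close>, \<open>g x\<close> and \<open>g (g x)\<close>
  would give a relation \<open>g^2 = A g + B\<close> at \<open>x\<close>. This quadratic divides the
  cubic, and the cofactor has the root \<open>t - A\<close>.\<close>

lemma generator:
  assumes no_root: "\<And>l. l \<in> K \<Longrightarrow> l^3 - t * l^2 + t' * l - 1 \<noteq> 0"
    and x: "x \<in> W" "y0 \<in> W" "z0 \<in> W" "T x y0 z0 \<noteq> 0"
  shows "T x (g x) (g (g x)) \<noteq> 0"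
proof
  assume zero: "T x (g x) (g (g x)) = 0"
  note lin = linear_independent[OF no_root x]
  have *: "T (g x) (g (g x)) y * T x r s - T x (g (g x)) y * T (g x) r s + T x (g x) y * T (g (g x)) r s = 0"
    if "y \<in> W" "r \<in> W" "s \<in> W" for y r s
    using cramer[of x "g x" "g (g x)" y r s] that x zero by simp
  have "T x (g x) y = 0" if y: "y \<in> W" for y
  proof (rule ccontr)
    assume nz: "T x (g x) y \<noteq> 0"
    define A B where "A = T x (g (g x)) y / T x (g x) y" and "B = - T (g x) (g (g x)) y / T x (g x) y"
    have AB_K: "A \<in> K" "B \<in> K" using x y by (simp_all add: A_def B_def)
    have AB: "T (g (g x)) r s = A * T (g x) r s + B * T x r s" if "r \<in> W" "s \<in> W" for r s
    proof -
      have "T x (g x) y * T (g (g x)) r s = T x (g (g x)) y * T (g x) r s - T (g x) (g (g x)) y * T x r s"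
        using *[OF y that] by (simp add: algebra_simps)
      then have "T (g (g x)) r s = (T x (g (g x)) y * T (g x) r s - T (g x) (g (g x)) y * T x r s) / T x (g x) y"
        using nz by (metis nonzero_mult_div_cancel_left)
      then show ?thesis by (simp add: A_def B_def diff_divide_distrib)
    qed
    have AB3: "T (g (g (g x))) r s = A * T (g (g x)) r s + B * T (g x) r s" if "r \<in> W" "s \<in> W" for r s
      using AB[of "gi r" "gi s"] that x by (simp add: T_g_first)
    have "(A * B - t * B - 1) * T x r s + (A^2 + B - t * A + t') * T (g x) r s = 0" if "r \<in> W" "s \<in> W" for r s
      using T_cubic[of x r s] AB[OF that] AB3[OF that] x that by (simp add: algebra_simps power2_eq_square)
    then have "A * B - t * B - 1 = 0 \<and> A^2 + B - t * A + t' = 0"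
      using AB_K t_K by (intro lin) auto
    then have "(t - A)^3 - t * (t - A)^2 + t' * (t - A) - 1 = 0"
      by Groebner_Basis.algebra
    then show False using no_root[of "t - A"] AB_K t_K by simp
  qed
  then have "T (g x) y0 z0 * T x r s - T x y0 z0 * T (g x) r s = 0" if "r \<in> W" "s \<in> W" for r s
    using cramer[of x "g x" y0 z0 r s] x that by simp
  then have "T (g x) y0 z0 = 0 \<and> - T x y0 z0 = 0"
    using x by (intro lin) auto
  then show False using x by simp
qed

text \<open>The determinant of \<open>p(g)\<close> is the norm of \<open>p\<close>. The third and
  fourth powers of \<open>g\<close> are reduced by \<open>T_cubic\<close>, so that every term
  becomes a multiple of the same value of \<open>T\<close>.\<close>

lemma T_cubic_norm:
  assumes x: "x \<in> W" "x' \<in> W"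
    and x': "\<And>r s. r \<in> W \<Longrightarrow> s \<in> W \<Longrightarrow> T x' r s = p0 * T x r s + p1 * T (g x) r s + p2 * T (g (g x)) r s"
  shows "T x' (g x') (g (g x')) = cubic_norm t t' p0 p1 p2 * T x (g x) (g (g x))"
proof -
  define e1 e2 e3 e4 where "e1 = g x" and "e2 = g e1" and "e3 = g e2" and "e4 = g e3"
  have e: "e1 \<in> W" "e2 \<in> W" "e3 \<in> W" "e4 \<in> W" using x by (simp_all add: e1_def e2_def e3_def e4_def)
  have E1: "T x' r s = p0 * T x r s + p1 * T e1 r s + p2 * T e2 r s" if "r \<in> W" "s \<in> W" for r s
    using x'[OF that] by (simp add: e1_def e2_def)
  have "T (g x') r s = p0 * T e1 r s + p1 * T e2 r s + p2 * T e3 r s" if "r \<in> W" "s \<in> W" for r s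
    using E1[of "gi r" "gi s"] that x e by (simp add: T_g_first e1_def e2_def e3_def)
  then have E2: "T r (g x') s = p0 * T r e1 s + p1 * T r e2 s + p2 * T r e3 s" if "r \<in> W" "s \<in> W" for r s
    using that x e by (simp add: T_swap12[of _ r s])
  have "T (g x') r s = p0 * T e1 r s + p1 * T e2 r s + p2 * T e3 r s" if "r \<in> W" "s \<in> W" for r s
    using E1[of "gi r" "gi s"] that x e by (simp add: T_g_first e1_def e2_def e3_def)
  from this[of "gi _" "gi _"]
  have "T (g (g x')) r s = p0 * T e2 r s + p1 * T e3 r s + p2 * T e4 r s" if "r \<in> W" "s \<in> W" for r s
    using that x e by (simp add: T_g_first e2_def e3_def e4_def)
  then have E3: "T r s (g (g x')) = p0 * T r s e2 + p1 * T r s e3 + p2 * T r s e4" if "r \<in> W" "s \<in> W" for r s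
    using that x e by (simp add: T_cyclic[of _ r s])
  have R3: "T e3 r s = t * T e2 r s - t' * T e1 r s + T x r s"
    "T e4 r s = t * T e3 r s - t' * T e2 r s + T e1 r s" if "r \<in> W" "s \<in> W" for r s
    using T_cubic[of x r s] T_cubic[of e1 r s] that x e by (simp_all add: e1_def e2_def e3_def e4_def)
  have S3: "T r e3 s = t * T r e2 s - t' * T r e1 s + T r x s" if "r \<in> W" "s \<in> W" for r s
    using R3(1)[OF that] that x e by (simp add: T_swap12[of _ r s] algebra_simps)
  have S4: "T r s e3 = t * T r s e2 - t' * T r s e1 + T r s x"
    "T r s e4 = t * T r s e3 - t' * T r s e2 + T r s e1" if "r \<in> W" "s \<in> W" for r s
    using R3[OF that] that x e by (simp_all add: T_cyclic[of _ r s])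
  have perm: "T e1 e2 x = T x e1 e2" "T e2 x e1 = T x e1 e2" "T x e2 e1 = - T x e1 e2"
    "T e1 x e2 = - T x e1 e2" "T e2 e1 x = - T x e1 e2"
    using T_cyclic[of x e1 e2] T_cyclic[of e1 e2 x] T_swap23[of x e1 e2] T_swap12[of x e1 e2] T_swap12[of e1 e2 x] x e by auto
  have "T x' (g x') (g (g x')) = cubic_norm t t' p0 p1 p2 * T x e1 e2"
    using x e by (simp add: E1 E2 E3 S3 S4 perm) (simp add: cubic_norm_def algebra_simps power2_eq_square power3_eq_cube)
  then show ?thesis by (simp add: e1_def e2_def)
qed

end

section \<open>Octonion algebras and their semisimple automorphisms\<close>

locale normed_octonion = octonion_algebra scale mul e
  for scale :: "'a :: field \<Rightarrow> 'b :: ab_group_add \<Rightarrow> 'b" (infixr \<open>\<triangleright>\<close> 75)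
    and mul :: "'b \<Rightarrow> 'b \<Rightarrow> 'b" (infixl \<open>\<star>\<close> 70) and e :: 'b +
  fixes N :: "'b \<Rightarrow> 'a"
  assumes quadratic: "quadratic_form scale N" and nondeg: "nondegenerate N"
    and N_mult: "N (x \<star> y) = N x * N y" and two: "(2 :: 'a) \<noteq> 0"
begin

definition B :: "'b \<Rightarrow> 'b \<Rightarrow> 'a" where "B = polar_form N"

lemma N_scale: "N (a \<triangleright> x) = a^2 * N x"
  using quadratic by (simp add: quadratic_form_def)

lemma N_zero [simp]: "N 0 = 0"
  using N_scale[of 0 0] by simp

lemma N_add: "N (x + y) = N x + N y + B x y"
  by (simp add: B_def polar_form_def)

lemma B_linear: "Vector_Spaces.linear scale (*) (\<lambda>x. B x y)" "Vector_Spaces.linear scale (*) (B x)"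
  using quadratic by (simp_all add: quadratic_form_def B_def)

lemma B_simps [simp]:
  "B (x + x') y = B x y + B x' y" "B (x - x') y = B x y - B x' y" "B (- x) y = - B x y"
  "B (a \<triangleright> x) y = a * B x y" "B 0 y = 0"
  "B x (y + y') = B x y + B x y'" "B x (y - y') = B x y - B x y'" "B x (- y) = - B x y"
  "B x (a \<triangleright> y) = a * B x y" "B x 0 = 0"
proof -
  interpret l: Vector_Spaces.linear scale "(*)" "\<lambda>x. B x y" for y by (rule B_linear)
  interpret r: Vector_Spaces.linear scale "(*)" "B x" for x by (rule B_linear)
  show "B (x + x') y = B x y + B x' y" "B (x - x') y = B x y - B x' y" "B (- x) y = - B x y"
    "B (a \<triangleright> x) y = a * B x y" "B 0 y = 0"
    by (rule l.add l.diff l.neg l.scale l.zero)+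
  show "B x (y + y') = B x y + B x y'" "B x (y - y') = B x y - B x y'" "B x (- y) = - B x y"
    "B x (a \<triangleright> y) = a * B x y" "B x 0 = 0"
    by (rule r.add r.diff r.neg r.scale r.zero)+
qed

lemma B_sum: "B (sum f S) y = (\<Sum>i\<in>S. B (f i) y)" "B y (sum f S) = (\<Sum>i\<in>S. B y (f i))"
proof -
  interpret l: Vector_Spaces.linear scale "(*)" "\<lambda>x. B x y" by (rule B_linear)
  interpret r: Vector_Spaces.linear scale "(*)" "B y" by (rule B_linear)
  show "B (sum f S) y = (\<Sum>i\<in>S. B (f i) y)" "B y (sum f S) = (\<Sum>i\<in>S. B y (f i))"
    by (rule l.sum r.sum)+
qed

lemma B_commute: "B x y = B y x"
  by (simp add: B_def polar_form_def add.commute)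

lemma B_self: "B x x = 2 * N x"
proof -
  have "N (2 \<triangleright> x) = 4 * N x" by (simp add: N_scale)
  moreover have "2 \<triangleright> x = x + x" using scale_left_distrib[of 1 1 x] by simp
  ultimately show ?thesis by (simp add: B_def polar_form_def)
qed

lemma B_eqI: "(\<And>z. B x z = B y z) \<Longrightarrow> x = y"
  using nondeg[unfolded nondegenerate_def, rule_format, of "x - y"] by (simp flip: B_def)

lemma mul_simps [simp]:
  "(x + x') \<star> y = x \<star> y + x' \<star> y" "(x - x') \<star> y = x \<star> y - x' \<star> y" "(- x) \<star> y = - (x \<star> y)"
  "(a \<triangleright> x) \<star> y = a \<triangleright> (x \<star> y)" "0 \<star> y = 0"
  "x \<star> (y + y') = x \<star> y + x \<star> y'" "x \<star> (y - y') = x \<star> y - x \<star> y'" "x \<star> (- y) = - (x \<star> y)"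
  "x \<star> (a \<triangleright> y) = a \<triangleright> (x \<star> y)" "x \<star> 0 = 0" "e \<star> x = x" "x \<star> e = x"
proof -
  interpret l: Vector_Spaces.linear scale scale "\<lambda>x. x \<star> y" for y by (rule linear_left)
  interpret r: Vector_Spaces.linear scale scale "mul x" for x by (rule linear_right)
  show "(x + x') \<star> y = x \<star> y + x' \<star> y" "(x - x') \<star> y = x \<star> y - x' \<star> y" "(- x) \<star> y = - (x \<star> y)"
    "(a \<triangleright> x) \<star> y = a \<triangleright> (x \<star> y)" "0 \<star> y = 0"
    by (rule l.add l.diff l.neg l.scale l.zero)+
  show "x \<star> (y + y') = x \<star> y + x \<star> y'" "x \<star> (y - y') = x \<star> y - x \<star> y'" "x \<star> (- y) = - (x \<star> y)"
    "x \<star> (a \<triangleright> y) = a \<triangleright> (x \<star> y)" "x \<star> 0 = 0"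
    by (rule r.add r.diff r.neg r.scale r.zero)+
qed (rule unit_left unit_right)+

lemma B_mul_left: "B (x \<star> y) (x \<star> z) = N x * B y z"
  using N_mult[of x "y + z"] by (simp add: N_add N_mult algebra_simps)

lemma B_mul_right: "B (y \<star> x) (z \<star> x) = B y z * N x"
  using N_mult[of "y + z" x] by (simp add: N_add N_mult algebra_simps)

text \<open>Multiplicativity of \<open>N\<close>, polarized in both factors; the adjoint rules come
  from it.\<close>

lemma B_exchange: "B (x \<star> y) (z \<star> w) + B (x \<star> w) (z \<star> y) = B x z * B y w"
  using B_mul_left[of "x + z" y w] by (simp add: N_add B_mul_left algebra_simps B_commute[of "z \<star> y" "x \<star> w"])

lemma ex_anisotropic:
  assumes "x \<noteq> 0"
  shows "\<exists>y. N y \<noteq> 0 \<and> B x y \<noteq> 0"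
proof -
  obtain y where y: "B x y \<noteq> 0" using B_eqI[of x 0] assms by auto
  show ?thesis
  proof (cases "N y = 0 \<and> N x = 0")
    case True
    then have "N (x + y) \<noteq> 0" "B x (x + y) \<noteq> 0" using y by (simp_all add: N_add B_self)
    then show ?thesis by blast
  next
    case False
    then show ?thesis
    proof (cases "N y = 0")
      case True
      then have "N x \<noteq> 0" using False by simp
      then have "B x x \<noteq> 0" using two by (simp add: B_self)
      with \<open>N x \<noteq> 0\<close> show ?thesis by blast
    qed (use y in blast)
  qed
qed

lemma e_nonzero: "e \<noteq> 0"
proof
  assume "e = 0"
  then have "x = 0" for x :: 'b using mul_simps(11)[of x] by simp
  then have "UNIV = {0 :: 'b}" by auto
  then have "span {} = (UNIV :: 'b set)" by simp
  then have "dim (UNIV :: 'b set) \<le> card ({} :: 'b set)" by (intro dim_le_card) auto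
  then show False using dim_eq_8 by simp
qed

lemma N_e [simp]: "N e = 1"
proof -
  obtain x where "N x \<noteq> 0" using ex_anisotropic[OF e_nonzero] by blast
  then show ?thesis using N_mult[of e x] by simp
qed

definition conj :: "'b \<Rightarrow> 'b" where "conj x = B x e \<triangleright> e - x"

lemma conj_pure [simp]: "B x e = 0 \<Longrightarrow> conj x = - x"
  by (simp add: conj_def)

lemma B_adjoint_left: "B (x \<star> y) z = B y (conj x \<star> z)"
  using B_exchange[of x y e z] by (simp add: conj_def algebra_simps B_commute[of "x \<star> z" y])

lemma B_adjoint_right: "B (x \<star> y) z = B x (z \<star> conj y)"
  using B_exchange[of x y z e] by (simp add: conj_def algebra_simps B_commute[of x "z \<star> y"])

lemma conj_mul_mul: "conj x \<star> (x \<star> y) = N x \<triangleright> y"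
proof (rule B_eqI)
  fix z
  have "B (x \<star> z) (x \<star> y) = B z (conj x \<star> (x \<star> y))" by (rule B_adjoint_left)
  then show "B (conj x \<star> (x \<star> y)) z = B (N x \<triangleright> y) z"
    by (simp add: B_mul_left B_commute[of z])
qed

lemma mul_mul_conj: "y \<star> x \<star> conj x = N x \<triangleright> y"
proof (rule B_eqI)
  fix z
  have "B (z \<star> x) (y \<star> x) = B z (y \<star> x \<star> conj x)" by (rule B_adjoint_right)
  then show "B (y \<star> x \<star> conj x) z = B (N x \<triangleright> y) z"
    by (simp add: B_mul_right B_commute[of z] mult.commute)
qed

abbreviation pure where "pure x \<equiv> B x e = 0"

lemma pure_mul_self: "pure x \<Longrightarrow> x \<star> (x \<star> y) = - N x \<triangleright> y" "pure x \<Longrightarrow> y \<star> x \<star> x = - N x \<triangleright> y"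
  "pure x \<Longrightarrow> x \<star> x = - N x \<triangleright> e"
proof -
  assume x: "pure x"
  show 1: "x \<star> (x \<star> y) = - N x \<triangleright> y" for y using conj_mul_mul[of x y] x by (simp add: minus_equation_iff)
  show "y \<star> x \<star> x = - N x \<triangleright> y" using mul_mul_conj[of y x] x by (simp add: minus_equation_iff)
  show "x \<star> x = - N x \<triangleright> e" using 1[of e] by simp
qed

lemma pure_adjoint: "pure x \<Longrightarrow> B (x \<star> y) z = - B y (x \<star> z)" "pure x \<Longrightarrow> B (y \<star> x) z = - B y (z \<star> x)"
  by (simp_all add: B_adjoint_left[of x y z] B_adjoint_right[of y x z])

lemma pure_anticommute: "pure x \<Longrightarrow> pure y \<Longrightarrow> x \<star> y + y \<star> x = - B x y \<triangleright> e"
proof -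
  assume xy: "pure x" "pure y"
  then have "(x + y) \<star> (x + y) = - N (x + y) \<triangleright> e" by (intro pure_mul_self) simp
  then have "x \<star> y + y \<star> x + B x y \<triangleright> e = 0"
    using xy by (simp add: pure_mul_self N_add scale_left_distrib algebra_simps)
  then show ?thesis by (simp add: eq_neg_iff_add_eq_0)
qed

lemma pure_mul_swap: "pure x \<Longrightarrow> pure y \<Longrightarrow> B x y = 0 \<Longrightarrow> x \<star> y = - (y \<star> x)"
  using pure_anticommute[of x y] by (simp add: eq_neg_iff_add_eq_0)

lemma B_e_mul: "B (x \<star> y) e = B x (conj y)"
  using B_adjoint_right[of x y e] by simp

section \<open>Orthogonal bases for the norm\<close>

definition orthogonal_set :: "'b set \<Rightarrow> bool" where
  "orthogonal_set S \<longleftrightarrow> finite S \<and> (\<forall>x\<in>S. N x \<noteq> 0) \<and> (\<forall>x\<in>S. \<forall>y\<in>S. x \<noteq> y \<longrightarrow> B x y = 0)"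

lemma B_self_nonzero: "N x \<noteq> 0 \<Longrightarrow> B x x \<noteq> 0"
  using two by (simp add: B_self)

definition proj :: "'b set \<Rightarrow> 'b \<Rightarrow> 'b" where
  "proj S z = (\<Sum>b\<in>S. (B z b / B b b) \<triangleright> b)"

lemma B_proj:
  assumes "orthogonal_set S" "b \<in> S"
  shows "B (proj S z) b = B z b"
proof -
  have "B (proj S z) b = (\<Sum>b'\<in>S. B z b' / B b' b' * B b' b)"
    by (simp add: proj_def B_sum)
  also have "\<dots> = (\<Sum>b'\<in>S. if b' = b then B z b else 0)"
    using assms B_self_nonzero by (intro sum.cong) (auto simp: orthogonal_set_def)
  also have "\<dots> = B z b" using assms by (simp add: orthogonal_set_def)
  finally show ?thesis .
qed

lemma proj_span: "proj S z \<in> span S"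
  unfolding proj_def by (intro span_sum span_scale span_base)

lemma orthogonal_span:
  assumes "\<forall>b\<in>S. B x b = 0" "y \<in> span S"
  shows "B x y = 0"
proof -
  have "span S \<subseteq> {y. B x y = 0}"
    by (rule span_minimal) (use assms(1) in \<open>auto simp: subspace_def\<close>)
  then show ?thesis using assms(2) by blast
qed

lemma orthogonal_independent:
  assumes S: "orthogonal_set S"
  shows "independent S"
proof (rule independent_if_scalars_zero)
  show "finite S" using S by (simp add: orthogonal_set_def)
  fix f x assume eq: "(\<Sum>x\<in>S. f x \<triangleright> x) = 0" and x: "x \<in> S"
  have "0 = B (\<Sum>x\<in>S. f x \<triangleright> x) x" by (simp add: eq)
  also have "\<dots> = (\<Sum>y\<in>S. if y = x then f x * B x x else 0)"
    unfolding B_sum using S x by (intro sum.cong) (auto simp: orthogonal_set_def)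
  also have "\<dots> = f x * B x x" using S x by (simp add: orthogonal_set_def)
  finally show "f x = 0" using S x B_self_nonzero by (auto simp: orthogonal_set_def)
qed

text \<open>A nonzero \<open>x\<close> orthogonal to \<open>S\<close> pairs nontrivially with
  another such vector \<open>y'\<close>; one of \<open>x\<close>, \<open>y'\<close>,
  \<open>x + y'\<close> is anisotropic.\<close>

lemma orthogonal_extend:
  assumes S: "orthogonal_set S" and card: "card S < 8"
  shows "\<exists>y. N y \<noteq> 0 \<and> (\<forall>b\<in>S. B y b = 0)"
proof -
  have fin: "finite S" using S by (simp add: orthogonal_set_def)
  have "span S \<noteq> UNIV"
  proof
    assume "span S = UNIV"
    then have "dim (UNIV :: 'b set) \<le> card S" using fin by (intro dim_le_card) auto
    then show False using card dim_eq_8 by simp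
  qed
  then obtain z where z: "z \<notin> span S" by blast
  define x where "x = z - proj S z"
  have x: "x \<noteq> 0" "\<forall>b\<in>S. B x b = 0"
    using z proj_span[of S z] B_proj[OF S] by (auto simp: x_def)
  obtain y where y: "B x y \<noteq> 0" using ex_anisotropic[OF x(1)] by blast
  define y' where "y' = y - proj S y"
  have y': "B x y' \<noteq> 0" "\<forall>b\<in>S. B y' b = 0"
    using y B_proj[OF S] orthogonal_span[OF x(2) proj_span] by (auto simp: y'_def)
  show ?thesis
  proof (cases "N x = 0 \<and> N y' = 0")
    case True
    then have "N (x + y') \<noteq> 0" using y' by (simp add: N_add)
    moreover have "\<forall>b\<in>S. B (x + y') b = 0" using x y' by simp
    ultimately show ?thesis by blast
  qed (use x y' in blast)
qed

lemma orthogonal_set_insert: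
  "orthogonal_set S \<Longrightarrow> N y \<noteq> 0 \<Longrightarrow> (\<forall>b\<in>S. B y b = 0) \<Longrightarrow> orthogonal_set (insert y S) \<and> y \<notin> S"
  using B_self_nonzero by (auto simp: orthogonal_set_def B_commute)

lemma orthogonal_complete:
  assumes S: "orthogonal_set S" "card S = 8"
  shows "span S = UNIV"
proof -
  obtain Bas where Bas: "independent Bas" "UNIV \<subseteq> span Bas" "card Bas = dim (UNIV :: 'b set)"
    using basis_exists[of UNIV] by blast
  then have "finite Bas" using dim_eq_8 by (intro card_ge_0_finite) simp
  then interpret finite_dimensional_vector_space scale Bas
    by unfold_locales (use Bas in auto)
  show ?thesis
    using card_ge_dim_independent[of S UNIV] orthogonal_independent[OF S(1)] S(2) dim_eq_8 by auto
qed

lemma orthogonal_complete_eq_0: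
  assumes S: "orthogonal_set S" "card S = 8" and z: "\<forall>b\<in>S. B z b = 0"
  shows "z = 0"
proof (rule B_eqI)
  show "B z y = B 0 y" for y
    using orthogonal_span[OF z, of y] orthogonal_complete[OF S] by simp
qed

lemma orthogonal_complete_eq_proj:
  assumes S: "orthogonal_set S" "card S = 8"
  shows "z = proj S z"
proof -
  have "z - proj S z = 0"
    by (rule orthogonal_complete_eq_0[OF S]) (simp add: B_proj[OF S(1)])
  then show ?thesis by simp
qed

lemma ex_orthogonal_basis: "\<exists>S. orthogonal_set S \<and> card S = 8 \<and> e \<in> S"
proof -
  have "\<exists>S. orthogonal_set S \<and> card S = Suc n \<and> e \<in> S" if "n \<le> 7" for n
    using that
  proof (induction n)
    case 0
    then show ?case by (intro exI[of _ "{e}"]) (simp add: orthogonal_set_def)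
  next
    case (Suc n)
    then obtain S where S: "orthogonal_set S" "card S = Suc n" "e \<in> S" by auto
    obtain y where y: "N y \<noteq> 0" "\<forall>b\<in>S. B y b = 0" using orthogonal_extend[OF S(1)] S Suc by auto
    then show ?case using orthogonal_set_insert[OF S(1) y] S
      by (intro exI[of _ "insert y S"]) (auto simp: orthogonal_set_def)
  qed
  from this[of 7] show ?thesis by simp
qed

text \<open>A linear functional that vanishes on \<open>U\<close> but not at \<open>x\<close> is
  represented by a vector, which is read off from an orthogonal basis.\<close>

lemma separation:
  assumes U: "subspace U" and x: "x \<notin> U"
  shows "\<exists>y. (\<forall>u\<in>U. B y u = 0) \<and> B y x \<noteq> 0"
proof -
  interpret p: vector_space_pair scale "(*) :: 'a \<Rightarrow> 'a \<Rightarrow> 'a"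
    by unfold_locales (auto simp: algebra_simps)
  obtain A where A: "A \<subseteq> U" "independent A" "U \<subseteq> span A" using maximal_independent_subset by blast
  have "span A \<subseteq> U" by (rule span_minimal[OF A(1) U])
  then have "x \<notin> span A" using x by blast
  then have "independent (insert x A)" using A by (simp add: independent_insert)
  then obtain f where f: "Vector_Spaces.linear scale (*) f" "\<forall>z\<in>insert x A. f z = (if z = x then 1 else 0)"
    using p.linear_independent_extend[of "insert x A" "\<lambda>z. if z = x then 1 else 0"] by blast
  interpret f: Vector_Spaces.linear scale "(*)" f by (rule f(1))
  have fU: "f u = 0" if "u \<in> U" for u
  proof -
    have "span A \<subseteq> {z. f z = 0}"
      by (rule span_minimal) (use f(2) A(1) x in \<open>auto simp: subspace_def f.add f.scale\<close>)
    then show ?thesis using that A(3) by blast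
  qed
  obtain S where S: "orthogonal_set S" "card S = 8" using ex_orthogonal_basis by blast
  define y where "y = (\<Sum>b\<in>S. (f b / B b b) \<triangleright> b)"
  have "B y z = f z" for z
  proof -
    have "f z = f (proj S z)" using orthogonal_complete_eq_proj[OF S] by simp
    also have "\<dots> = (\<Sum>b\<in>S. B z b / B b b * f b)" by (simp add: proj_def f.sum f.scale)
    also have "\<dots> = B y z" by (simp add: y_def B_sum B_commute[of z] mult_ac)
    finally show ?thesis by simp
  qed
  then show ?thesis using f(2) fU by (intro exI[of _ y]) auto
qed

end

section \<open>Semisimplicity through eigenfunctionals\<close>

lemma (in vector_space) semisimple_endo_functionals:
  assumes "semisimple_endo scale g"
  shows "\<exists>n \<omega> ev. (\<forall>i<n::nat. (\<forall>x y. \<omega> i (x + y) = \<omega> i x + \<omega> i y) \<and>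
      (\<forall>c x. \<omega> i (scale c x) = to_ac c * \<omega> i x) \<and> (\<forall>x. \<omega> i (g x) = ev i * \<omega> i x)) \<and>
    (\<forall>x. (\<forall>i<n. \<omega> i x = 0) \<longrightarrow> x = 0)"
proof -
  obtain bs D where lin: "Vector_Spaces.linear scale scale g" and bs: "is_basis_list scale bs" and D: "diagonal_mat D"
    and sim: "similar_mat (map_mat to_ac (matrix_of scale bs g)) D"
    using assms by (auto simp: semisimple_endo_def)
  interpret g: Vector_Spaces.linear scale scale g by (rule lin)
  define n where "n = length bs"
  have dist: "distinct bs" and ind: "independent (set bs)" and sp: "span (set bs) = UNIV"
    using bs by (auto simp: is_basis_list_def)
  define r where "r = (\<lambda>x i. representation (set bs) x (bs ! i))"
  have r_lin: "r (x + y) i = r x i + r y i" "r (scale c x) i = c * r x i" for x y c i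
    unfolding r_def using representation_add[OF ind, of y x] representation_scale[OF ind, of x c] sp by auto
  have sum_bs: "(\<Sum>b\<in>set bs. f b) = (\<Sum>j<n. f (bs ! j))" for f :: "'b \<Rightarrow> 'd :: comm_monoid_add"
    using bij_betw_nth[OF dist refl refl] unfolding n_def by (simp add: sum.reindex_bij_betw)
  have r_expand: "x = (\<Sum>j<n. scale (r x j) (bs ! j))" for x
  proof -
    have "x = (\<Sum>b\<in>set bs. scale (representation (set bs) x b) b)"
      using sum_representation_eq[OF ind, of x "set bs"] sp by simp
    then show ?thesis unfolding sum_bs r_def .
  qed
  have r_g: "r (g x) i = (\<Sum>j<n. r (g (bs ! j)) i * r x j)" for x i
  proof -
    have r_sum: "r (\<Sum>j\<in>A. f j) i = (\<Sum>j\<in>A. r (f j) i)" for A :: "nat set" and f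
      using r_lin(1)[of _ _ i] r_lin(2)[of 0 0 i]
      by (induction A rule: infinite_finite_induct) auto
    have "r (g x) i = r (\<Sum>j<n. scale (r x j) (g (bs ! j))) i"
      by (subst r_expand[of x]) (simp add: g.sum g.scale)
    then show ?thesis by (simp add: r_sum r_lin mult.commute)
  qed
  define A where "A = map_mat to_ac (matrix_of scale bs g)"
  have A: "A \<in> carrier_mat n n" by (simp add: A_def matrix_of_def n_def)
  obtain P Q where PQ: "similar_mat_wit A D P Q" using sim by (auto simp: A_def similar_mat_def)
  have car: "D \<in> carrier_mat n n" "P \<in> carrier_mat n n" "Q \<in> carrier_mat n n"
    and inv: "P * Q = 1\<^sub>m n" "Q * P = 1\<^sub>m n" "A = P * D * Q"
    using PQ A by (auto simp: similar_mat_wit_def Let_def)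
  define v where "v = (\<lambda>x. vec n (\<lambda>i. to_ac (r x i)))"
  have v: "v x \<in> carrier_vec n" for x by (simp add: v_def)
  have v_lin: "v (x + y) = v x + v y" "v (scale c x) = to_ac c \<cdot>\<^sub>v v x" for x y c
    by (rule eq_vecI; simp add: v_def r_lin)+
  have Av: "A *\<^sub>v v x = v (g x)" for x
  proof (rule eq_vecI)
    fix i assume "i < dim_vec (v (g x))"
    then have i: "i < n" by (simp add: v_def)
    have "(A *\<^sub>v v x) $ i = (\<Sum>j = 0..<n. to_ac (r (g (bs ! j)) i) * to_ac (r x j))"
      using i A by (simp add: scalar_prod_def v_def)
        (simp add: A_def matrix_of_def r_def n_def)
    also have "\<dots> = to_ac (r (g x) i)"
      by (simp add: r_g[of x i] to_ac_sum atLeast0LessThan)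
    finally show "(A *\<^sub>v v x) $ i = v (g x) $ i" using i by (simp add: v_def)
  qed (use A in \<open>simp add: v_def\<close>)
  \<comment> \<open>The rows of \<open>Q\<close> applied to coordinate vectors: eigenfunctionals of
    \<open>g\<close> with values in the algebraic closure. They replace a base change of the space
    itself.\<close>
  define \<omega> where "\<omega> = (\<lambda>i x. (Q *\<^sub>v v x) $ i)"
  have Qv: "Q *\<^sub>v v x \<in> carrier_vec n" for x using car v by simp
  have \<omega>_add: "\<omega> i (x + y) = \<omega> i x + \<omega> i y" if "i < n" for i x y
    using that car Qv unfolding \<omega>_def v_lin mult_add_distrib_mat_vec[OF car(3) v v]
    by (simp del: index_mult_mat_vec)
  have \<omega>_scale: "\<omega> i (scale c x) = to_ac c * \<omega> i x" if "i < n" for i c x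
    using that car Qv unfolding \<omega>_def v_lin mult_mat_vec[OF car(3) v]
    by (simp del: index_mult_mat_vec)
  have \<omega>_g: "\<omega> i (g x) = D $$ (i, i) * \<omega> i x" if i: "i < n" for i x
  proof -
    have "Q *\<^sub>v v (g x) = Q *\<^sub>v (P *\<^sub>v (D *\<^sub>v (Q *\<^sub>v v x)))"
      using car v[of x] Qv[of x] by (simp add: Av[symmetric] inv(3) assoc_mult_mat_vec[of _ n n _ n])
    also have "\<dots> = (Q * P) *\<^sub>v (D *\<^sub>v (Q *\<^sub>v v x))"
      using car v[of x] Qv[of x] by (intro assoc_mult_mat_vec[symmetric]) auto
    also have "\<dots> = D *\<^sub>v (Q *\<^sub>v v x)"
      using car Qv[of x] by (simp add: inv(2))
    finally have "\<omega> i (g x) = (D *\<^sub>v (Q *\<^sub>v v x)) $ i" by (simp add: \<omega>_def)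
    also have "\<dots> = (\<Sum>j = 0..<n. D $$ (i, j) * (Q *\<^sub>v v x) $ j)"
      using i car Qv[of x] by (simp add: scalar_prod_def)
    also have "\<dots> = (\<Sum>j = 0..<n. if j = i then D $$ (i, i) * (Q *\<^sub>v v x) $ i else 0)"
      using D car i by (intro sum.cong) (auto simp: diagonal_mat_def)
    also have "\<dots> = D $$ (i, i) * \<omega> i x" using i by (simp add: \<omega>_def)
    finally show ?thesis .
  qed
  have \<omega>_inj: "x = 0" if "\<forall>i<n. \<omega> i x = 0" for x
  proof -
    have "Q *\<^sub>v v x = 0\<^sub>v n"
      by (rule eq_vecI) (use that car in \<open>auto simp: \<omega>_def\<close>)
    then have "P *\<^sub>v (Q *\<^sub>v v x) = 0\<^sub>v n" using car by auto
    moreover have "P *\<^sub>v (Q *\<^sub>v v x) = v x"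
      using car v[of x] by (simp add: assoc_mult_mat_vec[of P n n Q n, symmetric] inv(1))
    ultimately have "v x $ i = 0" if "i < n" for i using that by simp
    then have "r x j = 0" if "j < n" for j using that by (auto simp: v_def)
    then show "x = 0" by (subst r_expand) simp
  qed
  show ?thesis
    using \<omega>_add \<omega>_scale \<omega>_g \<omega>_inj by (intro exI[of _ n] exI[of _ \<omega>] exI[of _ "\<lambda>i. D $$ (i, i)"]) auto
qed

text \<open>On each eigenfunctional \<open>q\<close> acts as a scalar, and a scalar whose square
  kills a value kills it already. Degree 2 is what eigenvalues in a quadratic algebra over
  \<open>k\<close> call for.\<close>

lemma (in vector_space) semisimple_quadratic:
  fixes c0 c1 c2 :: 'a
  assumes ss: "semisimple_endo scale g"
  defines "q \<equiv> \<lambda>x. scale c2 (g (g x)) + scale c1 (g x) + scale c0 x"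
  assumes "q (q x) = 0"
  shows "q x = 0"
proof -
  obtain n \<omega> ev where *: "(\<forall>i<n::nat. (\<forall>x y. \<omega> i (x + y) = \<omega> i x + \<omega> i y) \<and>
      (\<forall>c x. \<omega> i (scale c x) = to_ac c * \<omega> i x) \<and> (\<forall>x. \<omega> i (g x) = ev i * \<omega> i x)) \<and>
    (\<forall>x. (\<forall>i<n. \<omega> i x = 0) \<longrightarrow> x = 0)"
    using semisimple_endo_functionals[OF ss] by (elim exE)
  have \<omega>: "\<omega> i (x + y) = \<omega> i x + \<omega> i y" "\<omega> i (scale c x) = to_ac c * \<omega> i x" "\<omega> i (g x) = ev i * \<omega> i x"
    if "i < n" for i x y c
    using * that by auto
  define k where "k i = to_ac c2 * (ev i)^2 + to_ac c1 * ev i + to_ac c0" for i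
  have q: "\<omega> i (q y) = k i * \<omega> i y" if "i < n" for i y
    using that by (simp add: q_def \<omega> k_def algebra_simps power2_eq_square)
  show ?thesis
  proof (rule conjunct2[OF *, rule_format])
    fix i assume i: "i < n"
    have "\<omega> i 0 = 0" using \<omega>(2)[OF i, of 0 0] by simp
    then have "k i * (k i * \<omega> i x) = 0" using q[OF i, of "q x"] q[OF i, of x] assms(3) by simp
    then show "\<omega> i (q x) = 0" using q[OF i] by auto
  qed
qed

section \<open>Automorphisms preserve the norm\<close>

locale octonion_automorphism = normed_octonion +
  fixes g :: "'b \<Rightarrow> 'b"
  assumes g_bij: "bij g" and g_linear: "Vector_Spaces.linear scale scale g" and g_e [simp]: "g e = e"
    and g_mult [simp]: "g (x \<star> y) = g x \<star> g y"
begin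

lemma g_simps [simp]: "g (x + y) = g x + g y" "g (x - y) = g x - g y" "g (- x) = - g x"
  "g (c \<triangleright> x) = c \<triangleright> g x" "g 0 = 0"
proof -
  interpret g: Vector_Spaces.linear scale scale g by (rule g_linear)
  show "g (x + y) = g x + g y" "g (x - y) = g x - g y" "g (- x) = - g x"
    "g (c \<triangleright> x) = c \<triangleright> g x" "g 0 = 0" by (rule g.add g.diff g.neg g.scale g.zero)+
qed

lemma g_eq_iff [simp]: "g x = g y \<longleftrightarrow> x = y"
  using g_bij by (auto simp: bij_def inj_def)

text \<open>The image under \<open>g\<close> of the quadratic equation of \<open>x\<close> is
  compared with the quadratic equation of \<open>g x\<close>. The difference is a linear relation
  between \<open>g x\<close> and \<open>e\<close>, so either the coefficients agree or
  \<open>x\<close> is a scalar.\<close>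

lemma N_g [simp]: "N (g x) = N x"
proof -
  have quad: "B y e \<triangleright> y - y \<star> y = N y \<triangleright> e" for y
    using conj_mul_mul[of y e] by (simp add: conj_def)
  have "g (B x e \<triangleright> x - x \<star> x) = g (N x \<triangleright> e)" using quad[of x] by simp
  then have "B x e \<triangleright> g x - g x \<star> g x = N x \<triangleright> e" by simp
  with quad[of "g x"] have eq: "(B (g x) e - B x e) \<triangleright> g x = (N (g x) - N x) \<triangleright> e"
    by (simp add: scale_left_diff_distrib algebra_simps)
  show ?thesis
  proof (cases "B (g x) e = B x e")
    case True
    then show ?thesis using eq e_nonzero by simp
  next
    case False
    define c where "c = (N (g x) - N x) / (B (g x) e - B x e)"
    have "g x = (1 / (B (g x) e - B x e)) \<triangleright> ((B (g x) e - B x e) \<triangleright> g x)" using False by simp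
    also have "\<dots> = c \<triangleright> e" unfolding eq by (simp add: c_def)
    finally have "g x = g (c \<triangleright> e)" by simp
    then have "x = c \<triangleright> e" by (simp only: g_eq_iff)
    then show ?thesis by simp
  qed
qed

lemma B_g [simp]: "B (g x) (g y) = B x y"
  using N_add[of "g x" "g y"] N_add[of x y] by (metis N_g add_left_cancel g_simps(1))

definition gi where "gi = inv_into UNIV g"

lemma g_gi [simp]: "g (gi x) = x" "gi (g x) = x"
  using g_bij by (simp_all add: gi_def bij_is_surj surj_f_inv_f bij_is_inj)

lemma B_g_left: "B (g x) y = B x (gi y)"
  using B_g[of x "gi y"] by (simp del: B_g)

lemma B_g_e [simp]: "B (g x) e = B x e"
  using B_g[of x e] by (simp del: B_g)

lemma automorphism_gi: "octonion_automorphism scale mul e N gi"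
proof
  show "bij gi" using g_bij by (simp add: gi_def bij_imp_bij_inv)
  have *: "gi x = y" if "g y = x" for x y using that by auto
  show "gi (x + y) = gi x + gi y" for x y by (rule *) simp
  show "gi (r \<triangleright> x) = r \<triangleright> gi x" for r x by (rule *) simp
  show "gi e = e" by (rule *) simp
  show "gi (x \<star> y) = gi x \<star> gi y" for x y by (rule *) simp
qed

text \<open>Every fact about \<open>g\<close> becomes available for its inverse; the rewriting
  identifies the inverse of the inverse with \<open>g\<close>.\<close>

sublocale gi: octonion_automorphism scale mul e N gi
  rewrites "octonion_automorphism.gi gi = g"
proof -
  show "octonion_automorphism scale mul e N gi" by (rule automorphism_gi)
  then interpret gi: octonion_automorphism scale mul e N gi .
  show "gi.gi = g" by (metis ext g_gi gi.g_gi(1))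
qed

end

section \<open>The orthogonal complement of a quadratic subalgebra\<close>

locale octonion_axis = normed_octonion +
  fixes a :: 'b
  assumes a_pure [simp]: "B a e = 0" and a_norm [simp]: "N a \<noteq> 0"
begin

lemma a_pure' [simp]: "B e a = 0"
  by (simp add: B_commute[of e])

lemma mul_a_a [simp]: "a \<star> (a \<star> x) = - N a \<triangleright> x"
  by (rule pure_mul_self) simp

lemma a_a [simp]: "a \<star> a = - N a \<triangleright> e"
  using mul_a_a[of e] by simp

lemma B_a_skew: "B (a \<star> x) y = - B x (a \<star> y)"
  by (rule pure_adjoint) simp

lemma B_a_a [simp]: "B (a \<star> x) (a \<star> y) = N a * B x y"
  by (simp add: B_mul_left)

lemma B_a_self [simp]: "B (a \<star> x) x = 0" "B x (a \<star> x) = 0"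
proof -
  have "2 * B (a \<star> x) x = 0" using B_a_skew[of x x] by (simp add: B_commute[of x])
  then show "B (a \<star> x) x = 0" using two by simp
  then show "B x (a \<star> x) = 0" by (simp add: B_commute[of x])
qed

lemma N_a_mul [simp]: "N (a \<star> x) = N a * N x"
  by (rule N_mult)

lemma a_mul_eq_0_iff [simp]: "a \<star> x = 0 \<longleftrightarrow> x = 0"
proof
  assume "a \<star> x = 0"
  then have "a \<star> (a \<star> x) = 0" by simp
  then have "N a \<triangleright> x = 0" by simp
  then show "x = 0" using a_norm by simp
qed simp

text \<open>The decomposition into \<open>D\<close> and \<open>a D\<close> is a grading by
  \<open>Z/2\<close>. The adjoint rules for \<open>B\<close> turn each inclusion of products into an
  orthogonality, and all of them reduce to \<open>D D\<close> being contained in \<open>D\<close>,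
  which is supplied in the form \<open>mult_orth\<close>.\<close>

lemma reflection:
  assumes D: "subspace D" "e \<in> D"
    and mult_orth: "\<And>x y z. x \<in> D \<Longrightarrow> y \<in> D \<Longrightarrow> z \<in> D \<Longrightarrow> B (x \<star> y) (a \<star> z) = 0"
    and orth: "\<And>x y. x \<in> D \<Longrightarrow> y \<in> D \<Longrightarrow> B (a \<star> x) y = 0"
    and sum: "\<And>z. \<exists>x\<in>D. \<exists>y\<in>D. z = x + a \<star> y"
  shows "\<exists>s. octonion_automorphism scale mul e N s \<and> (\<forall>x. s (s x) = x) \<and> (\<forall>x\<in>D. s x = x) \<and> s a = - a"
proof -
  have D_add: "x \<in> D \<Longrightarrow> y \<in> D \<Longrightarrow> x + y \<in> D" and D_diff: "x \<in> D \<Longrightarrow> y \<in> D \<Longrightarrow> x - y \<in> D"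
    and D_scale: "x \<in> D \<Longrightarrow> c \<triangleright> x \<in> D" and D_0: "0 \<in> D" and D_minus: "x \<in> D \<Longrightarrow> - x \<in> D" for x y c
    using D(1) by (auto intro: subspace_add subspace_scale subspace_diff subspace_0 subspace_neg)
  have D_conj: "x \<in> D \<Longrightarrow> conj x \<in> D" for x
    unfolding conj_def using D_diff D_scale D(2) by blast
  have orth': "B x (a \<star> y) = 0" if "x \<in> D" "y \<in> D" for x y
    using orth[OF that(2,1)] by (simp add: B_commute)
  have uniq: "x = 0 \<and> y = 0" if xy: "x \<in> D" "y \<in> D" and eq: "x + a \<star> y = 0" for x y
  proof -
    have "B x z = B 0 z" for z
    proof -
      obtain x' y' where z: "x' \<in> D" "y' \<in> D" "z = x' + a \<star> y'" using sum by blast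
      have "0 = B (x + a \<star> y) x'" by (simp add: eq)
      then have "B x x' = 0" using orth[OF xy(2) z(1)] by simp
      then show ?thesis using orth'[OF xy(1) z(2)] by (simp add: z(3))
    qed
    then have "x = 0" by (rule B_eqI)
    then show ?thesis using eq by simp
  qed
  define s where "s z = (THE w. \<exists>x\<in>D. \<exists>y\<in>D. z = x + a \<star> y \<and> w = x - a \<star> y)" for z
  have s: "s (x + a \<star> y) = x - a \<star> y" if "x \<in> D" "y \<in> D" for x y
    unfolding s_def
  proof (rule the_equality)
    show "\<exists>x'\<in>D. \<exists>y'\<in>D. x + a \<star> y = x' + a \<star> y' \<and> x - a \<star> y = x' - a \<star> y'"
      using that by blast
    fix w assume "\<exists>x'\<in>D. \<exists>y'\<in>D. x + a \<star> y = x' + a \<star> y' \<and> w = x' - a \<star> y'"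
    then obtain x' y' where *: "x' \<in> D" "y' \<in> D" "x + a \<star> y = x' + a \<star> y'" "w = x' - a \<star> y'" by blast
    from *(3) have "(x - x') + a \<star> (y - y') = 0" by (simp add: algebra_simps)
    then have "x - x' = 0 \<and> y - y' = 0" using * that D_diff by (intro uniq) auto
    then show "w = x - a \<star> y" using *(4) by simp
  qed
  \<comment> \<open>By \<open>sum\<close> and nondegeneracy, \<open>D\<close> is the full orthogonal
    complement of \<open>a D\<close>.\<close>
  have in_D: "z \<in> D" if z: "\<And>y. y \<in> D \<Longrightarrow> B z (a \<star> y) = 0" for z
  proof -
    obtain x' y' where xy: "x' \<in> D" "y' \<in> D" "z = x' + a \<star> y'" using sum by blast
    have *: "B y' y = 0" if "y \<in> D" for y
      using z[OF that] orth'[OF xy(1) that] by (simp add: xy(3))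
    have "B y' w = B 0 w" for w
    proof -
      obtain x'' y'' where w: "x'' \<in> D" "y'' \<in> D" "w = x'' + a \<star> y''" using sum by blast
      show ?thesis using *[OF w(1)] orth'[OF xy(2) w(2)] by (simp add: w(3))
    qed
    then have "y' = 0" by (rule B_eqI)
    then show ?thesis using xy by simp
  qed
  have mult: "x \<star> y \<in> D" if "x \<in> D" "y \<in> D" for x y
    using mult_orth[OF that] by (rule in_D)
  have in_aD: "\<exists>y\<in>D. z = a \<star> y" if z: "\<And>y. y \<in> D \<Longrightarrow> B z y = 0" for z
  proof -
    have "a \<star> z \<in> D" by (rule in_D) (simp add: z)
    then have "a \<star> ((- 1 / N a) \<triangleright> (a \<star> z)) = z" "(- 1 / N a) \<triangleright> (a \<star> z) \<in> D" by (simp_all add: D_scale D_minus)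
    then show ?thesis by metis
  qed
  have DaD: "\<exists>w\<in>D. x \<star> (a \<star> y) = a \<star> w" if "x \<in> D" "y \<in> D" for x y
  proof (rule in_aD)
    fix z assume "z \<in> D"
    then have "conj x \<star> z \<in> D" using that D_conj mult by blast
    then show "B (x \<star> (a \<star> y)) z = 0" using orth[OF that(2)] by (simp add: B_adjoint_left)
  qed
  have aDD: "\<exists>w\<in>D. a \<star> x \<star> y = a \<star> w" if "x \<in> D" "y \<in> D" for x y
  proof (rule in_aD)
    fix z assume "z \<in> D"
    then have "z \<star> conj y \<in> D" using that D_conj mult by blast
    then show "B (a \<star> x \<star> y) z = 0" using orth[OF that(1)] by (simp add: B_adjoint_right)
  qed
  have aDaD: "(a \<star> x) \<star> (a \<star> y) \<in> D" if "x \<in> D" "y \<in> D" for x y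
  proof (rule in_D)
    fix z assume z: "z \<in> D"
    \<comment> \<open>\<open>B_exchange\<close> reduces a product of two factors in
      \<open>a D\<close> to a product of one factor in \<open>a D\<close> with one in
      \<open>D\<close>.\<close>
    have "B ((a \<star> x) \<star> (a \<star> y)) (a \<star> z) + B ((a \<star> x) \<star> z) (a \<star> (a \<star> y)) = B (a \<star> x) a * B (a \<star> y) z"
      by (rule B_exchange)
    moreover have "B ((a \<star> x) \<star> z) y = 0"
      using orth[OF that(1) mult[OF that(2) D_conj[OF z]]] by (simp add: B_adjoint_right)
    ultimately show "B ((a \<star> x) \<star> (a \<star> y)) (a \<star> z) = 0"
      using orth[OF that(2) z] by simp
  qed
  have s_D: "s x = x" if "x \<in> D" for x using s[OF that D_0] by simp
  have s_aD: "s (a \<star> x) = - (a \<star> x)" if "x \<in> D" for x using s[OF D_0 that] by simp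
  have s_add: "s (z + z') = s z + s z'" for z z'
  proof -
    obtain x y where z: "x \<in> D" "y \<in> D" "z = x + a \<star> y" using sum by blast
    obtain x' y' where z': "x' \<in> D" "y' \<in> D" "z' = x' + a \<star> y'" using sum by blast
    have eq: "z + z' = (x + x') + a \<star> (y + y')" by (simp add: z z')
    show ?thesis unfolding eq using z z' by (subst s) (auto simp: s D_add)
  qed
  have s_scale: "s (c \<triangleright> z) = c \<triangleright> s z" for c z
  proof -
    obtain x y where z: "x \<in> D" "y \<in> D" "z = x + a \<star> y" using sum by blast
    have eq: "c \<triangleright> z = c \<triangleright> x + a \<star> (c \<triangleright> y)" by (simp add: z scale_right_distrib)
    show ?thesis unfolding eq using z by (subst s) (auto simp: s D_scale scale_right_diff_distrib)
  qed
  have s_s: "s (s z) = z" for z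
  proof -
    obtain x y where z: "x \<in> D" "y \<in> D" "z = x + a \<star> y" using sum by blast
    have "s z = x + a \<star> (- y)" using s z by simp
    then show ?thesis using s[of x "- y"] z D_minus by simp
  qed
  have s_mult: "s (z \<star> z') = s z \<star> s z'" for z z'
  proof -
    obtain x y where z: "x \<in> D" "y \<in> D" "z = x + a \<star> y" using sum by blast
    obtain x' y' where z': "x' \<in> D" "y' \<in> D" "z' = x' + a \<star> y'" using sum by blast
    obtain w1 where w1: "w1 \<in> D" "x \<star> (a \<star> y') = a \<star> w1" using DaD z z' by blast
    obtain w2 where w2: "w2 \<in> D" "a \<star> y \<star> x' = a \<star> w2" using aDD z z' by blast
    have eq: "z \<star> z' = (x \<star> x' + (a \<star> y) \<star> (a \<star> y')) + a \<star> (w1 + w2)"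
      using w1(2) w2(2) by (simp add: z z' algebra_simps)
    have "s (z \<star> z') = (x \<star> x' + (a \<star> y) \<star> (a \<star> y')) - a \<star> (w1 + w2)"
      unfolding eq by (rule s) (use z z' w1 w2 mult aDaD D_add in auto)
    also have "\<dots> = (x - a \<star> y) \<star> (x' - a \<star> y')"
      using w1(2) w2(2) by (simp add: algebra_simps)
    also have "\<dots> = s z \<star> s z'" using s z z' by simp
    finally show ?thesis .
  qed
  have "octonion_automorphism scale mul e N s"
  proof
    show "bij s" by (rule involuntory_imp_bij) (rule s_s)
  qed (use s_add s_scale s_mult s_D D(2) in auto)
  moreover have "s a = - a" using s_aD[OF D(2)] by simp
  ultimately show ?thesis using s_s s_D by blast
qed

section \<open>The complement of \<open>k[a]\<close> and its alternating form\<close>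

definition W :: "'b set" where "W = {w. B w e = 0 \<and> B w a = 0}"

lemma W_D: "x \<in> W \<Longrightarrow> B x e = 0" "x \<in> W \<Longrightarrow> B e x = 0" "x \<in> W \<Longrightarrow> B x a = 0" "x \<in> W \<Longrightarrow> B a x = 0"
  by (auto simp: W_def B_commute[of e] B_commute[of a])

lemma W_closed [simp]: "0 \<in> W" "x \<in> W \<Longrightarrow> y \<in> W \<Longrightarrow> x + y \<in> W" "x \<in> W \<Longrightarrow> y \<in> W \<Longrightarrow> x - y \<in> W"
  "x \<in> W \<Longrightarrow> - x \<in> W" "x \<in> W \<Longrightarrow> c \<triangleright> x \<in> W"
  by (auto simp: W_def)

lemma W_I: "B x e = 0 \<Longrightarrow> B x a = 0 \<Longrightarrow> x \<in> W"
  by (simp add: W_def)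

lemma W_a [simp]: "x \<in> W \<Longrightarrow> a \<star> x \<in> W"
  using B_a_skew[of x e] B_a_skew[of x a] by (intro W_I) (simp_all add: W_D)

text \<open>\<open>\<phi>\<close> and \<open>\<psi>\<close> are the components of a form
  \<open>a \<phi> + \<psi>\<close> with values in \<open>k[a]\<close>; \<open>\<phi>_a\<close> and
  \<open>\<psi>_a\<close> below say that it is linear over \<open>k[a]\<close> in each
  argument.\<close>

definition \<phi> where "\<phi> x y z = B x (y \<star> z)"
definition \<psi> where "\<psi> x y z = B (a \<star> x) (y \<star> z)"

lemma \<phi>_linear [simp]:
  "\<phi> (x + x') y z = \<phi> x y z + \<phi> x' y z" "\<phi> (x - x') y z = \<phi> x y z - \<phi> x' y z" "\<phi> (- x) y z = - \<phi> x y z"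
  "\<phi> (c \<triangleright> x) y z = c * \<phi> x y z" "\<phi> 0 y z = 0"
  "\<phi> y (x + x') z = \<phi> y x z + \<phi> y x' z" "\<phi> y (x - x') z = \<phi> y x z - \<phi> y x' z" "\<phi> y (- x) z = - \<phi> y x z"
  "\<phi> y (c \<triangleright> x) z = c * \<phi> y x z" "\<phi> y 0 z = 0"
  "\<phi> y z (x + x') = \<phi> y z x + \<phi> y z x'" "\<phi> y z (x - x') = \<phi> y z x - \<phi> y z x'" "\<phi> y z (- x) = - \<phi> y z x"
  "\<phi> y z (c \<triangleright> x) = c * \<phi> y z x" "\<phi> y z 0 = 0"
  by (simp_all add: \<phi>_def)

lemma \<psi>_linear [simp]:
  "\<psi> (x + x') y z = \<psi> x y z + \<psi> x' y z" "\<psi> (x - x') y z = \<psi> x y z - \<psi> x' y z" "\<psi> (- x) y z = - \<psi> x y z"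
  "\<psi> (c \<triangleright> x) y z = c * \<psi> x y z" "\<psi> 0 y z = 0"
  "\<psi> y (x + x') z = \<psi> y x z + \<psi> y x' z" "\<psi> y (x - x') z = \<psi> y x z - \<psi> y x' z" "\<psi> y (- x) z = - \<psi> y x z"
  "\<psi> y (c \<triangleright> x) z = c * \<psi> y x z" "\<psi> y 0 z = 0"
  "\<psi> y z (x + x') = \<psi> y z x + \<psi> y z x'" "\<psi> y z (x - x') = \<psi> y z x - \<psi> y z x'" "\<psi> y z (- x) = - \<psi> y z x"
  "\<psi> y z (c \<triangleright> x) = c * \<psi> y z x" "\<psi> y z 0 = 0"
  by (simp_all add: \<psi>_def)

lemma \<phi>_swap:
  assumes "x \<in> W" "y \<in> W" "z \<in> W"
  shows "\<phi> x z y = - \<phi> x y z" "\<phi> y x z = - \<phi> x y z"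
proof -
  have s23: "\<phi> x z y = - \<phi> x y z" if "x \<in> W" "y \<in> W" "z \<in> W" for x y z
  proof -
    have "B x (y \<star> z + z \<star> y) = 0" using that by (simp only: pure_anticommute W_D) (simp add: W_D)
    then show ?thesis by (simp add: \<phi>_def eq_neg_iff_add_eq_0 add.commute)
  qed
  have s13: "\<phi> z y x = - \<phi> x y z" if "x \<in> W" "y \<in> W" "z \<in> W" for x y z
    using pure_adjoint(1)[of y z x] that by (simp add: W_D \<phi>_def B_commute[of x])
  show "\<phi> x z y = - \<phi> x y z" using s23 assms .
  show "\<phi> y x z = - \<phi> x y z" using s13[of x y z] s13[of y x z] s23[of z x y] assms by simp
qed

lemma \<psi>_swap:
  assumes "x \<in> W" "y \<in> W" "z \<in> W"
  shows "\<psi> x z y = - \<psi> x y z" "\<psi> y x z = - \<psi> x y z"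
proof -
  have s23: "\<psi> x z y = - \<psi> x y z" if "x \<in> W" "y \<in> W" "z \<in> W" for x y z
    using \<phi>_swap(1)[of "a \<star> x" y z] that by (simp add: \<phi>_def \<psi>_def)
  have s13: "\<psi> z y x = - \<psi> x y z" if "x \<in> W" "y \<in> W" "z \<in> W" for x y z
    using B_exchange[of a x y z] that by (simp add: W_D \<psi>_def eq_neg_iff_add_eq_0 add.commute)
  show "\<psi> x z y = - \<psi> x y z" using s23 assms .
  show "\<psi> y x z = - \<psi> x y z" using s13[of x y z] s13[of y x z] s23[of z x y] assms by simp
qed

lemma eq_minus_self_iff: "c = - c \<longleftrightarrow> c = 0" for c :: 'a
  using two by (auto simp: eq_neg_iff_add_eq_0 mult_2[symmetric])

lemma \<phi>_alt [simp]: "x \<in> W \<Longrightarrow> y \<in> W \<Longrightarrow> \<phi> x x y = 0" "x \<in> W \<Longrightarrow> y \<in> W \<Longrightarrow> \<phi> y x x = 0"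
  "x \<in> W \<Longrightarrow> y \<in> W \<Longrightarrow> \<phi> x y x = 0"
  using \<phi>_swap(2)[of x x y] \<phi>_swap(1)[of y x x] \<phi>_swap(1)[of x x y] by (simp_all add: eq_minus_self_iff)

lemma \<psi>_alt [simp]: "x \<in> W \<Longrightarrow> y \<in> W \<Longrightarrow> \<psi> x x y = 0" "x \<in> W \<Longrightarrow> y \<in> W \<Longrightarrow> \<psi> y x x = 0"
  "x \<in> W \<Longrightarrow> y \<in> W \<Longrightarrow> \<psi> x y x = 0"
  using \<psi>_swap(2)[of x x y] \<psi>_swap(1)[of y x x] \<psi>_swap(1)[of x x y] by (simp_all add: eq_minus_self_iff)

lemma \<phi>_a [simp]:
  assumes "x \<in> W" "y \<in> W" "z \<in> W"
  shows "\<phi> (a \<star> x) y z = \<psi> x y z" "\<phi> x (a \<star> y) z = \<psi> x y z" "\<phi> x y (a \<star> z) = \<psi> x y z"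
proof -
  have 1: "\<phi> (a \<star> x) y z = \<psi> x y z" for x y z by (simp add: \<phi>_def \<psi>_def)
  have 2: "\<phi> x (a \<star> y) z = \<psi> x y z" if "x \<in> W" "y \<in> W" "z \<in> W" for x y z
    using \<phi>_swap(2)[of x "a \<star> y" z] 1[of y x z] \<psi>_swap(2)[of x y z] that by simp
  show "\<phi> (a \<star> x) y z = \<psi> x y z" "\<phi> x (a \<star> y) z = \<psi> x y z" using 1 2 assms by auto
  show "\<phi> x y (a \<star> z) = \<psi> x y z"
    using \<phi>_swap(1)[of x y "a \<star> z"] 2[of x z y] \<psi>_swap(1)[of x y z] assms by simp
qed

lemma \<psi>_a [simp]:
  assumes "x \<in> W" "y \<in> W" "z \<in> W"
  shows "\<psi> (a \<star> x) y z = - N a * \<phi> x y z" "\<psi> x (a \<star> y) z = - N a * \<phi> x y z" "\<psi> x y (a \<star> z) = - N a * \<phi> x y z"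
proof -
  have 1: "\<psi> (a \<star> x) y z = - N a * \<phi> x y z" for x y z by (simp add: \<phi>_def \<psi>_def)
  have 2: "\<psi> x (a \<star> y) z = - N a * \<phi> x y z" if "x \<in> W" "y \<in> W" "z \<in> W" for x y z
    using \<psi>_swap(2)[of x "a \<star> y" z] 1[of y x z] \<phi>_swap(2)[of x y z] that by simp
  show "\<psi> (a \<star> x) y z = - N a * \<phi> x y z" "\<psi> x (a \<star> y) z = - N a * \<phi> x y z" using 1 2 assms by auto
  show "\<psi> x y (a \<star> z) = - N a * \<phi> x y z"
    using \<psi>_swap(1)[of x y "a \<star> z"] 2[of x z y] \<phi>_swap(1)[of x y z] assms by simp
qed

lemma orthogonal_axis: "orthogonal_set {e, a}" "card {e, a} = 2"
proof -
  have "orthogonal_set {e}" by (simp add: orthogonal_set_def)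
  from orthogonal_set_insert[OF this, of a] show "orthogonal_set {e, a}" "card {e, a} = 2"
    by (auto simp: insert_commute)
qed

lemma orthogonal_4:
  assumes u: "u \<in> W" "N u \<noteq> 0"
  shows "orthogonal_set {a \<star> u, u, e, a} \<and> card {a \<star> u, u, e, a} = 4"
proof -
  have 1: "orthogonal_set (insert u {e, a}) \<and> u \<notin> {e, a}"
    by (rule orthogonal_set_insert[OF orthogonal_axis(1)]) (use u in \<open>auto simp: W_D\<close>)
  then have 2: "orthogonal_set (insert (a \<star> u) (insert u {e, a})) \<and> a \<star> u \<notin> insert u {e, a}"
    by (intro orthogonal_set_insert) (use u W_a[OF u(1)] in \<open>auto simp: W_D\<close>)
  from 1 2 orthogonal_axis show ?thesis by auto
qed

lemma ex_second:
  assumes u: "u \<in> W" "N u \<noteq> 0"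
  shows "\<exists>v\<in>W. N v \<noteq> 0 \<and> B u v = 0 \<and> B (a \<star> u) v = 0"
  using orthogonal_extend[of "{a \<star> u, u, e, a}"] orthogonal_4[OF u]
  by (auto simp: W_def B_commute)

lemma ex_first: "\<exists>u\<in>W. N u \<noteq> 0"
  using orthogonal_extend[of "{e, a}"] orthogonal_axis by (auto simp: W_def B_commute)

end

section \<open>Bases adapted to the axis\<close>

locale octonion_basis = octonion_axis +
  fixes u v :: 'b
  assumes uv: "u \<in> W" "N u \<noteq> 0" "v \<in> W" "N v \<noteq> 0" "B u v = 0" "B (a \<star> u) v = 0"
begin

definition w where "w = u \<star> v"

lemma w_W: "w \<in> W"
  using B_adjoint_right[of u v e] B_adjoint_right[of u v a] uv B_a_skew[of u v]
  unfolding w_def by (intro W_I) (simp_all add: W_D)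

declare uv [simp] w_W [simp]

lemma B_uvw [simp]: "B v u = 0" "B v (a \<star> u) = 0" "B u (a \<star> v) = 0" "B (a \<star> v) u = 0"
  "B w u = 0" "B u w = 0" "B w v = 0" "B v w = 0"
  "B w (a \<star> u) = 0" "B (a \<star> u) w = 0" "B w (a \<star> v) = 0" "B (a \<star> v) w = 0"
  "B (a \<star> w) u = 0" "B u (a \<star> w) = 0" "B (a \<star> w) v = 0" "B v (a \<star> w) = 0"
proof -
  show 1: "B v u = 0" "B v (a \<star> u) = 0" "B u (a \<star> v) = 0" "B (a \<star> v) u = 0"
    using uv B_a_skew[of u v] by (simp_all add: B_commute)
  have "B w u = \<phi> u u v" "B w v = \<phi> v u v" "B w (a \<star> u) = \<psi> u u v" "B w (a \<star> v) = \<psi> v u v"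
    by (simp_all add: w_def \<phi>_def \<psi>_def B_commute)
  then show 2: "B w u = 0" "B w v = 0" "B w (a \<star> u) = 0" "B w (a \<star> v) = 0" by simp_all
  then show 3: "B u w = 0" "B v w = 0" "B (a \<star> u) w = 0" "B (a \<star> v) w = 0" by (simp_all add: B_commute)
  then show "B u (a \<star> w) = 0" "B v (a \<star> w) = 0" using B_a_skew[of u w] B_a_skew[of v w] by simp_all
  then show "B (a \<star> w) u = 0" "B (a \<star> w) v = 0" by (simp_all add: B_commute)
qed

lemma N_w [simp]: "N w = N u * N v"
  by (simp add: w_def N_mult)

lemma orthogonal_8: "orthogonal_set {a \<star> w, w, a \<star> v, v, a \<star> u, u, e, a}"
    "card {a \<star> w, w, a \<star> v, v, a \<star> u, u, e, a} = 8"
proof -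
  note W_D [simp]
  have 4: "orthogonal_set {a \<star> u, u, e, a}" "card {a \<star> u, u, e, a} = 4" using orthogonal_4[of u] by auto
  have 5: "orthogonal_set (insert v {a \<star> u, u, e, a}) \<and> v \<notin> {a \<star> u, u, e, a}"
    by (rule orthogonal_set_insert[OF 4(1)]) auto
  then have 6: "orthogonal_set (insert (a \<star> v) (insert v {a \<star> u, u, e, a})) \<and> a \<star> v \<notin> insert v {a \<star> u, u, e, a}"
    by (intro orthogonal_set_insert) auto
  then have 7: "orthogonal_set (insert w (insert (a \<star> v) (insert v {a \<star> u, u, e, a})))
     \<and> w \<notin> insert (a \<star> v) (insert v {a \<star> u, u, e, a})"
    by (intro orthogonal_set_insert) auto
  then have 8: "orthogonal_set (insert (a \<star> w) (insert w (insert (a \<star> v) (insert v {a \<star> u, u, e, a}))))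
     \<and> a \<star> w \<notin> insert w (insert (a \<star> v) (insert v {a \<star> u, u, e, a}))"
    by (intro orthogonal_set_insert) auto
  show "orthogonal_set {a \<star> w, w, a \<star> v, v, a \<star> u, u, e, a}" using 8 by simp
  show "card {a \<star> w, w, a \<star> v, v, a \<star> u, u, e, a} = 8"
    using 4 5 6 7 8 by (simp add: card_insert_if)
qed

lemma eq_0I:
  assumes "B z e = 0" "B z a = 0" "B z u = 0" "B z (a \<star> u) = 0" "B z v = 0" "B z (a \<star> v) = 0"
    "B z w = 0" "B z (a \<star> w) = 0"
  shows "z = 0"
  by (rule orthogonal_complete_eq_0[OF orthogonal_8]) (use assms in auto)

lemma expansion:
  assumes "x \<in> W"
  shows "\<exists>p1 q1 p2 q2 p3 q3. x = p1 \<triangleright> u + q1 \<triangleright> (a \<star> u) + p2 \<triangleright> v + q2 \<triangleright> (a \<star> v) + p3 \<triangleright> w + q3 \<triangleright> (a \<star> w)"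
proof -
  define y where "y = (B x u / B u u) \<triangleright> u + (B x (a \<star> u) / B (a \<star> u) (a \<star> u)) \<triangleright> (a \<star> u) +
    (B x v / B v v) \<triangleright> v + (B x (a \<star> v) / B (a \<star> v) (a \<star> v)) \<triangleright> (a \<star> v) +
    (B x w / B w w) \<triangleright> w + (B x (a \<star> w) / B (a \<star> w) (a \<star> w)) \<triangleright> (a \<star> w)"
  have "x - y = 0"
    by (rule eq_0I) (use assms two in \<open>simp_all add: y_def W_D B_self\<close>)
  then show ?thesis unfolding y_def by (metis eq_iff_diff_eq_0)
qed

lemma \<phi>_uvw: "\<phi> u v w = 2 * N u * N v" "\<psi> u v w = 0"
proof -
  have "v \<star> (u \<star> v) = N v \<triangleright> u"
    using pure_mul_swap[of u v] pure_mul_self(1)[of v u] by (simp add: W_D)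
  then show "\<phi> u v w = 2 * N u * N v" "\<psi> u v w = 0" by (simp_all add: \<phi>_def \<psi>_def w_def B_self)
qed

text \<open>Each of \<open>u\<close>, \<open>v\<close>, \<open>w\<close> is, up to a nonzero factor,
  a product of two elements of \<open>W\<close>; passing from \<open>x\<close> to
  \<open>a \<star> x\<close> covers their multiples by \<open>a\<close>.\<close>

lemma \<phi>_nondegenerate:
  assumes x: "x \<in> W" and "\<And>y z. y \<in> W \<Longrightarrow> z \<in> W \<Longrightarrow> \<phi> x y z = 0"
  shows "x = 0"
proof -
  have 1: "B x (y \<star> z) = 0" if "y \<in> W" "z \<in> W" for y z using assms(2)[OF that] by (simp add: \<phi>_def)
  have "v \<star> w = N v \<triangleright> u"
    using pure_mul_swap[of u v] pure_mul_self(1)[of v u] by (simp add: W_D w_def)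
  then have 2: "B x u = 0" using 1[of v w] by simp
  have "u \<star> w = - N u \<triangleright> v"
    using pure_mul_self(1)[of u v] by (simp add: W_D w_def)
  then have 3: "B x v = 0" using 1[of u w] by simp
  have 4: "B x w = 0" using 1[of u v] by (simp add: w_def)
  have *: "B x (a \<star> y) = 0" if "\<And>z z'. z \<in> W \<Longrightarrow> z' \<in> W \<Longrightarrow> \<psi> x z z' = 0" "B (a \<star> x) y = 0" for y
    using that B_a_skew[of x y] by simp
  have 5: "B (a \<star> x) (y \<star> z) = 0" if "y \<in> W" "z \<in> W" for y z
    using \<phi>_a(2)[of x y z] assms(2)[of "a \<star> y" z] that x by (simp add: \<psi>_def)
  have 6: "B (a \<star> x) u = 0" using 5[of v w] \<open>v \<star> w = N v \<triangleright> u\<close> by simp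
  have 7: "B (a \<star> x) v = 0" using 5[of u w] \<open>u \<star> w = - N u \<triangleright> v\<close> by simp
  have 8: "B (a \<star> x) w = 0" using 5[of u v] by (simp add: w_def)
  show ?thesis
    by (rule eq_0I) (use x 2 3 4 6 7 8 B_a_skew[of x] in \<open>simp_all add: W_D\<close>)
qed

end

section \<open>Existence of a fixed axis\<close>

locale semisimple_automorphism = octonion_automorphism +
  assumes ss: "semisimple_endo scale g"
begin

lemma subspace_range:
  assumes "Vector_Spaces.linear scale scale h"
  shows "subspace (range h)"
proof -
  interpret h: Vector_Spaces.linear scale scale h by fact
  show ?thesis by (rule h.subspace_image[OF subspace_UNIV])
qed

text \<open>By semisimplicity the eigenvector \<open>x\<close> is not in the image of
  \<open>g - c\<close>, so some \<open>y\<close> is orthogonal to this image but not to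
  \<open>x\<close>. As \<open>g\<close> preserves \<open>B\<close>, this \<open>y\<close> is an
  eigenvector for \<open>1 / c\<close>, which is \<open>c\<close>.\<close>

lemma dual_eigenvector:
  assumes x: "x \<noteq> 0" "g x = c \<triangleright> x" "B x e = 0" and c: "c * c = 1"
  shows "\<exists>y. g y = c \<triangleright> y \<and> B y e = 0 \<and> B y x \<noteq> 0"
proof -
  define h where "h z = g z - c \<triangleright> z" for z
  have h_lin: "Vector_Spaces.linear scale scale h"
    by unfold_locales (simp_all add: h_def algebra_simps)
  have "x \<notin> range h"
  proof
    assume "x \<in> range h"
    then obtain z where z: "x = h z" by blast
    have q: "0 \<triangleright> g (g y) + 1 \<triangleright> g y + (- c) \<triangleright> y = h y" for y by (simp add: h_def)
    have "h x = 0" using x(2) by (simp add: h_def)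
    then have "h (h z) = 0" using z by simp
    then have "h z = 0"
      using semisimple_quadratic[OF ss, where ?c2.0 = 0 and ?c1.0 = 1 and ?c0.0 = "- c" and x = z] unfolding q by simp
    then show False using x(1) z by simp
  qed
  then obtain y where y: "\<And>z. B y (h z) = 0" "B y x \<noteq> 0"
    using separation[OF subspace_range[OF h_lin]] by blast
  have "gi y = c \<triangleright> y"
  proof (rule B_eqI)
    fix z
    have "B (gi y) z = B y (g z)" using B_g_left[of z y] by (simp add: B_commute)
    then show "B (gi y) z = B (c \<triangleright> y) z" using y(1)[of z] by (simp add: h_def)
  qed
  then have "g (gi y) = c \<triangleright> g y" by simp
  then have y_eq: "y = c \<triangleright> g y" by simp
  have "g y = c \<triangleright> (c \<triangleright> g y)" using c by simp
  then have gy: "g y = c \<triangleright> y" using y_eq by simp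
  have ye: "B y e = c * B y e" using B_g_e[of y] unfolding gy by simp
  \<comment> \<open>The component along \<open>e\<close> is removed. It is an eigenvector for
    \<open>c = 1\<close>, and for \<open>c = - 1\<close> it is zero by \<open>ye\<close>.\<close>
  define y' where "y' = y - (B y e / 2) \<triangleright> e"
  have "g y' = c \<triangleright> y - (c * (B y e / 2)) \<triangleright> e"
    using ye by (simp add: y'_def gy)
  also have "\<dots> = c \<triangleright> y'" by (simp add: y'_def scale_right_diff_distrib)
  finally have "g y' = c \<triangleright> y'" .
  moreover have "B y' e = 0" "B y' x = B y x" using two x(3) by (simp_all add: y'_def B_self B_commute[of e])
  ultimately show ?thesis using y(2) by auto
qed

lemma anisotropic_eigenvector:
  assumes x: "x \<noteq> 0" "g x = c \<triangleright> x" "B x e = 0" and c: "c * c = 1"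
  shows "\<exists>y. g y = c \<triangleright> y \<and> B y e = 0 \<and> N y \<noteq> 0"
proof -
  obtain y where y: "g y = c \<triangleright> y" "B y e = 0" "B y x \<noteq> 0" using dual_eigenvector[OF assms] by blast
  have "g (x + y) = c \<triangleright> (x + y)" "B (x + y) e = 0" using x y by (simp_all add: scale_right_distrib)
  moreover have "N x \<noteq> 0 \<or> N y \<noteq> 0 \<or> N (x + y) \<noteq> 0" using y(3) by (auto simp: N_add B_commute)
  ultimately show ?thesis using x y by blast
qed

text \<open>On the pure octonions the form \<open>B (g x - g\<^sup>-\<^sup>1 x) y\<close> is skew, and the dimension \<open>7\<close> is odd.\<close>

lemma ex_square_fixed: "\<exists>x. x \<noteq> 0 \<and> B x e = 0 \<and> g (g x) = x"
proof -
  obtain S where S: "orthogonal_set S" "card S = 8" "e \<in> S" using ex_orthogonal_basis by blast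
  have "finite (S - {e})" using S by (simp add: orthogonal_set_def)
  then obtain bs where bs: "set bs = S - {e}" "distinct bs" using finite_distinct_list by blast
  have len: "length bs = 7" using distinct_card[OF bs(2)] S bs(1) by simp
  define b where "b i = bs ! i" for i
  have b_in: "b i \<in> S" "b i \<noteq> e" if "i < 7" for i
    using nth_mem[of i bs] that len bs(1) by (auto simp: b_def)
  have b_orth: "B (b i) (b j) = 0" if "i < 7" "j < 7" "i \<noteq> j" for i j
  proof -
    have "b i \<noteq> b j" using that bs(2) len by (simp add: b_def nth_eq_iff_index_eq)
    then show ?thesis using S(1) b_in that by (auto simp: orthogonal_set_def)
  qed
  have b_e: "B (b i) e = 0" if "i < 7" for i using S b_in[OF that] by (auto simp: orthogonal_set_def)
  have b_self: "B (b i) (b i) \<noteq> 0" if "i < 7" for i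
    using S b_in[OF that] B_self_nonzero by (auto simp: orthogonal_set_def)
  define M where "M = mat 7 7 (\<lambda>(i, j). B (g (b i) - gi (b i)) (b j))"
  have M: "M \<in> carrier_mat 7 7" by (simp add: M_def)
  have skew: "B (g x - gi x) y = - B x (g y - gi y)" for x y
    using B_g_left[of x y] gi.B_g_left[of x y] by simp
  have "M\<^sup>T = (- 1) \<cdot>\<^sub>m M"
  proof (rule eq_matI)
    fix i j assume "i < dim_row ((- 1) \<cdot>\<^sub>m M)" "j < dim_col ((- 1) \<cdot>\<^sub>m M)"
    then show "M\<^sup>T $$ (i, j) = ((- 1) \<cdot>\<^sub>m M) $$ (i, j)"
      using skew[of "b j" "b i"] by (simp add: M_def B_commute[of "b j"] del: B_simps)
  qed (simp_all add: M_def)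
  then have "det M = (- 1) ^ 7 * det M"
    using det_transpose[OF M] M by (simp add: det_smult)
  then have "2 * det M = 0" by simp
  then have "det M = 0" using two by (simp only: mult_eq_0_iff) simp
  then obtain c where c: "c \<in> carrier_vec 7" "c \<noteq> 0\<^sub>v 7" "M *\<^sub>v c = 0\<^sub>v 7"
    using det_0_iff_vec_prod_zero[OF M] by blast
  define x where "x = (\<Sum>j<7. c $ j \<triangleright> b j)"
  have B_x: "B x z = (\<Sum>j<7. c $ j * B (b j) z)" for z by (simp add: x_def B_sum)
  have "B x e = 0" using b_e by (simp add: B_x)
  moreover have "x \<noteq> 0"
  proof
    assume "x = 0"
    have "c $ i = 0" if i: "i < 7" for i
    proof -
      have "0 = B x (b i)" using \<open>x = 0\<close> by simp
      also have "\<dots> = (\<Sum>j<7. if j = i then c $ i * B (b i) (b i) else 0)"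
        unfolding B_x using b_orth i by (intro sum.cong) auto
      also have "\<dots> = c $ i * B (b i) (b i)" using i by simp
      finally show ?thesis using b_self[OF i] by simp
    qed
    then have "c = 0\<^sub>v 7" using c(1) by (intro eq_vecI) auto
    then show False using c(2) by simp
  qed
  moreover have "g x - gi x = 0"
  proof (rule orthogonal_complete_eq_0[OF S(1,2)], rule ballI)
    fix y assume y: "y \<in> S"
    show "B (g x - gi x) y = 0"
    proof (cases "y = e")
      case True
      then show ?thesis by simp
    next
      case False
      then have "y \<in> set bs" using y bs(1) by simp
      then obtain i where i: "i < 7" "y = b i" using len by (auto simp: b_def in_set_conv_nth)
      have "(M *\<^sub>v c) $ i = (\<Sum>j = 0..<7. B (g (b i) - gi (b i)) (b j) * c $ j)"
        using i c(1) M by (simp add: scalar_prod_def) (simp add: M_def)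
      also have "\<dots> = B (g (b i) - gi (b i)) x"
        by (simp add: x_def B_sum atLeast0LessThan mult.commute)
      also have "\<dots> = - B (g x - gi x) y" using skew[of "b i" x] i by (simp add: B_commute)
      finally show ?thesis using c(3) i by simp
    qed
  qed
  ultimately show ?thesis by (intro exI[of _ x]) (metis eq_iff_diff_eq_0 g_gi(1))
qed

text \<open>If \<open>u\<close> is negated by \<open>g\<close>, then \<open>g - g\<^sup>-\<^sup>1\<close> defines an alternating form that is bilinear over
  \<open>k[u]\<close> on the orthogonal complement of \<open>k[u]\<close>, which has rank \<open>3\<close>; hence it is degenerate.\<close>

lemma fixed_if_negated:
  assumes u: "g u = - u" "B u e = 0" "N u \<noteq> 0"
  shows "\<exists>x. x \<noteq> 0 \<and> B x e = 0 \<and> g x = x"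
proof (rule ccontr)
  assume no_fixed: "\<not> ?thesis"
  interpret octonion_axis scale mul e N u by unfold_locales (use u in auto)
  have gi_u: "gi u = - u" by (metis u(1) g_gi(2) gi.g_simps(3) minus_minus)
  define A where "A x = g x - gi x" for x
  have A_simps: "A (x + y) = A x + A y" "A (c \<triangleright> x) = c \<triangleright> A x" "A (x - y) = A x - A y" "A (- x) = - A x" for x y c
    by (simp_all add: A_def scale_right_diff_distrib)
  have A_u: "A (u \<star> x) = - (u \<star> A x)" for x by (simp add: A_def u gi_u)
  have skew: "B (A x) y = - B (A y) x" for x y
    using B_g_left[of x y] gi.B_g_left[of x y] by (simp add: A_def B_commute)
  have A_W: "A x \<in> W" if "x \<in> W" for x
    using that B_g_left[of x u] gi.B_g_left[of x u] by (intro W_I) (simp_all add: A_def gi_u u W_D)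
  \<comment> \<open>For \<open>x\<close> in the kernel, \<open>g (g x) = x\<close>, so
    \<open>x + g x\<close> is fixed and must vanish. Then some anisotropic \<open>v\<close> in
    \<open>W\<close> is negated like \<open>u\<close>, and the product of the two would be
    fixed.\<close>
  have inj: "x = 0" if x: "x \<in> W" "A x = 0" for x
  proof (rule ccontr)
    assume x0: "x \<noteq> 0"
    have ggx: "g (g x) = x" using x(2) by (metis A_def eq_iff_diff_eq_0 g_gi(1))
    have "g (x + g x) = x + g x" "B (x + g x) e = 0" using ggx W_D[OF x(1)] by (simp_all add: add.commute)
    then have "x + g x = 0" using no_fixed by blast
    then have gx: "g x = (- 1) \<triangleright> x" by (simp add: eq_neg_iff_add_eq_0 add.commute)
    obtain y where y: "g y = (- 1) \<triangleright> y" "B y e = 0" "B y x \<noteq> 0"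
      using dual_eigenvector[OF x0 gx] W_D[OF x(1)] by auto
    define y' where "y' = y - (B y u / B u u) \<triangleright> u"
    have y': "g y' = - y'" "y' \<in> W" "B y' x \<noteq> 0"
      using y u W_D[OF x(1)] B_self_nonzero[OF u(3)] by (simp_all add: y'_def W_def)
    have "\<exists>v\<in>W. N v \<noteq> 0 \<and> g v = - v"
    proof -
      have "N x \<noteq> 0 \<or> N y' \<noteq> 0 \<or> N (x + y') \<noteq> 0" using y'(3) by (auto simp: N_add B_commute)
      moreover have "x + y' \<in> W" "g (x + y') = - (x + y')" using x y' gx by simp_all
      ultimately show ?thesis using x y' gx by auto
    qed
    then obtain v where v: "v \<in> W" "N v \<noteq> 0" "g v = - v" by blast
    have "g (u \<star> v) = u \<star> v" using u v by simp
    moreover have "B (u \<star> v) e = 0" using W_D[OF W_a[OF v(1)]] by simp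
    moreover have "u \<star> v \<noteq> 0" using v(2) by (metis N_mult N_zero mult_eq_0_iff u(3))
    ultimately show False using no_fixed by blast
  qed
  obtain p where p: "p \<in> W" "N p \<noteq> 0" using ex_first by blast
  obtain q where q: "q \<in> W" "N q \<noteq> 0" "B p q = 0" "B (u \<star> p) q = 0" using ex_second[OF p] by blast
  interpret octonion_basis scale mul e N u p q by unfold_locales (use p q in auto)
  define b where "b x y = B (A x) y" for x y
  have b_lin: "b (x + y) z = b x z + b y z" "b (c \<triangleright> x) z = c * b x z" "b (x - y) z = b x z - b y z" "b (- x) z = - b x z" for x y z c
    by (simp_all add: b_def A_simps)
  have b_skew: "b x y = - b y x" for x y unfolding b_def by (rule skew)
  have b_J: "b x (u \<star> y) = b (u \<star> x) y" for x y
    using B_a_skew[of "A x" y] by (simp add: b_def A_u)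
  have b_JJ: "b (u \<star> (u \<star> x)) y = - N u * b x y" for x y by (simp only: mul_a_a b_lin)
  have b_self: "b x x = 0" "b (u \<star> x) x = 0" for x
    using b_skew[of x x] b_skew[of "u \<star> x" x] b_J[of x x] by (simp_all add: eq_minus_self_iff)
  \<comment> \<open>For an alternating form \<open>\<beta>\<close> in rank 3, the vector
    \<open>\<beta>(q, w) p + \<beta>(w, p) q + \<beta>(p, q) w\<close> lies in the radical. Here the
    form with values in \<open>k[u]\<close> is
    \<open>\<beta>(x, y) = b (u \<star> x) y + b x y u\<close>.\<close>
  define n where "n = b (u \<star> q) w \<triangleright> p + b q w \<triangleright> (u \<star> p) + b (u \<star> w) p \<triangleright> q + b w p \<triangleright> (u \<star> q)
     + b (u \<star> p) q \<triangleright> w + b p q \<triangleright> (u \<star> w)"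
  have nW: "n \<in> W" by (simp add: n_def)
  have sk: "b q p = - b p q" "b w q = - b q w" "b w p = - b p w"
    "b (u \<star> q) p = - b (u \<star> p) q" "b (u \<star> w) q = - b (u \<star> q) w" "b (u \<star> w) p = - b (u \<star> p) w"
    using b_skew[of q p] b_skew[of w q] b_skew[of w p] b_skew[of "u \<star> q" p] b_skew[of "u \<star> w" q] b_skew[of "u \<star> w" p]
    by (simp_all add: b_J)
  have "b n y = 0" if "y = p \<or> y = q \<or> y = w" for y
    using that by (auto simp: n_def b_lin b_self b_JJ sk algebra_simps)
  moreover have "b n (u \<star> y) = 0" if "y = p \<or> y = q \<or> y = w" for y
    using that unfolding b_J by (auto simp: n_def scale_right_distrib b_lin b_self b_JJ sk algebra_simps)
  ultimately have "A n = 0"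
    using W_D[OF A_W[OF nW]] unfolding b_def by (intro eq_0I) simp_all
  then have "n = 0" using inj[OF nW] by simp
  \<comment> \<open>As \<open>n\<close> is zero, so are its coefficients; then \<open>p\<close>
    itself lies in the kernel of \<open>A\<close>, against \<open>inj\<close>.\<close>
  have "b (u \<star> p) q * B w w = B n w" "b p q * B (u \<star> w) (u \<star> w) = B n (u \<star> w)"
    "b (u \<star> w) p * B q q = B n q" "b w p * B (u \<star> q) (u \<star> q) = B n (u \<star> q)"
    by (simp_all add: n_def)
  then have "b (u \<star> p) q = 0" "b p q = 0" "b (u \<star> w) p = 0" "b w p = 0"
    using \<open>n = 0\<close> two u(3) p q by (simp_all add: B_self)
  then have "b p q = 0" "b p w = 0" "b (u \<star> p) q = 0" "b (u \<star> p) w = 0"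
    using sk by simp_all
  then have "A p = 0"
    using W_D[OF A_W[OF p(1)]] b_self[of p] b_J[of p p] b_J[of p q] b_J[of p w]
    unfolding b_def by (intro eq_0I) simp_all
  then have "p = 0" using inj[OF p(1)] by simp
  then show False using p(2) by simp
qed

lemma ex_fixed_axis: "\<exists>a. g a = a \<and> B a e = 0 \<and> N a \<noteq> 0"
proof -
  have *: ?thesis if "x \<noteq> 0" "B x e = 0" "g x = x" for x
    using anisotropic_eigenvector[of x 1] that by auto
  obtain x where x: "x \<noteq> 0" "B x e = 0" "g (g x) = x" using ex_square_fixed by blast
  show ?thesis
  proof (cases "x + g x = 0")
    case True
    then have "g x = (- 1) \<triangleright> x" by (simp add: eq_neg_iff_add_eq_0 add.commute)
    then obtain u where "g u = (- 1) \<triangleright> u" "B u e = 0" "N u \<noteq> 0"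
      using anisotropic_eigenvector[of x "- 1"] x by auto
    then show ?thesis using fixed_if_negated[of u] * by auto
  next
    case False
    moreover have "g (x + g x) = x + g x" using x(3) by (simp add: add.commute)
    ultimately show ?thesis using *[of "x + g x"] x(2) by simp
  qed
qed

end

section \<open>Scalars from \<open>k[a]\<close>\<close>

context octonion_axis
begin

text \<open>Multiplication by the element \<open>p + q a\<close> of the quadratic algebra \<open>k[a]\<close>.\<close>

definition lsc :: "'a \<Rightarrow> 'a \<Rightarrow> 'b \<Rightarrow> 'b" where "lsc p q x = p \<triangleright> x + q \<triangleright> (a \<star> x)"

lemma lsc_simps [simp]: "lsc p q (x + y) = lsc p q x + lsc p q y" "lsc p q (x - y) = lsc p q x - lsc p q y"
  "lsc p q (- x) = - lsc p q x" "lsc p q (c \<triangleright> x) = c \<triangleright> lsc p q x" "lsc p q 0 = 0" "lsc 1 0 x = x"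
  "a \<star> lsc p q x = lsc p q (a \<star> x)"
  by (simp_all add: lsc_def algebra_simps)

lemma lsc_lsc: "lsc p q (lsc p' q' x) = lsc (p * p' - N a * q * q') (p * q' + q * p') x"
  by (simp add: lsc_def algebra_simps)

lemma lsc_norm: "lsc p q (lsc p (- q) x) = (p^2 + N a * q^2) \<triangleright> x" "lsc p (- q) (lsc p q x) = (p^2 + N a * q^2) \<triangleright> x"
  by (simp_all add: lsc_lsc power2_eq_square mult_ac) (simp_all add: lsc_def)

lemma lsc_commute: "lsc p q (lsc p' q' x) = lsc p' q' (lsc p q x)"
  by (simp add: lsc_lsc mult_ac add_ac)

lemma lsc_trace: "lsc p q x + lsc p (- q) x = (2 * p) \<triangleright> x"
proof -
  have "lsc p q x + lsc p (- q) x = (p + p) \<triangleright> x + (q - q) \<triangleright> (a \<star> x)"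
    unfolding lsc_def scale_left_distrib scale_left_diff_distrib by simp
  then show ?thesis by (simp only: mult_2 diff_self scale_zero_left add_0_right)
qed

lemma B_lsc: "B (lsc p q x) y = p * B x y + q * B (a \<star> x) y" "B y (lsc p q x) = p * B y x + q * B y (a \<star> x)"
  by (simp_all add: lsc_def)

lemma B_lsc_adjoint: "B (lsc p q x) y = B x (lsc p (- q) y)"
  by (simp add: B_lsc B_a_skew[of x y])

lemma N_lsc: "N (lsc p q x) = (p^2 + N a * q^2) * N x"
proof -
  have "2 * N (lsc p q x) = B x (lsc p (- q) (lsc p q x))" by (simp add: B_self[symmetric] B_lsc_adjoint)
  also have "\<dots> = 2 * ((p^2 + N a * q^2) * N x)" by (simp add: lsc_norm B_self)
  finally show ?thesis using two by simp
qed

lemma lsc_W [simp]: "x \<in> W \<Longrightarrow> lsc p q x \<in> W"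
  by (simp add: lsc_def)

lemma \<phi>_lsc:
  assumes "x \<in> W" "y \<in> W" "z \<in> W"
  shows "\<phi> (lsc p q x) y z = \<phi> x (lsc p q y) z"
  using assms by (simp add: lsc_def)

lemma lsc_automorphism:
  assumes "octonion_automorphism scale mul e N s"
  shows "s a = a \<Longrightarrow> s (lsc p q x) = lsc p q (s x)" "s a = - a \<Longrightarrow> s (lsc p q x) = lsc p (- q) (s x)"
proof -
  interpret s: octonion_automorphism scale mul e N s by fact
  show "s a = a \<Longrightarrow> s (lsc p q x) = lsc p q (s x)" "s a = - a \<Longrightarrow> s (lsc p q x) = lsc p (- q) (s x)"
    by (simp_all add: lsc_def)
qed

end

context octonion_basis
begin

lemma uvw_mult [simp]: "u \<star> u = - N u \<triangleright> e" "v \<star> v = - N v \<triangleright> e" "w \<star> w = - N w \<triangleright> e" "u \<star> v = w"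
  "v \<star> u = - w" "u \<star> w = - N u \<triangleright> v" "w \<star> u = N u \<triangleright> v" "v \<star> w = N v \<triangleright> u" "w \<star> v = - N v \<triangleright> u"
proof -
  show "u \<star> u = - N u \<triangleright> e" "v \<star> v = - N v \<triangleright> e" "w \<star> w = - N w \<triangleright> e"
    by (simp_all add: pure_mul_self W_D del: N_w)
  show uv: "u \<star> v = w" by (simp add: w_def)
  show vu: "v \<star> u = - w" using pure_mul_swap[of v u] uv by (simp add: W_D)
  show "u \<star> w = - N u \<triangleright> v" using pure_mul_self(1)[of u v] by (simp add: W_D uv)
  show "v \<star> w = N v \<triangleright> u" using pure_mul_self(1)[of v u] by (simp add: W_D vu)
  show "w \<star> u = N u \<triangleright> v" using pure_mul_self(2)[of u v] by (simp add: W_D vu)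
  show "w \<star> v = - N v \<triangleright> u" using pure_mul_self(2)[of v u] by (simp add: W_D uv)
qed

lemma full_expansion:
  "\<exists>r s. z = r \<triangleright> e + s \<triangleright> a + (z - r \<triangleright> e - s \<triangleright> a) \<and> z - r \<triangleright> e - s \<triangleright> a \<in> W"
  using two by (intro exI[of _ "B z e / 2"] exI[of _ "B z a / (2 * N a)"]) (simp add: W_def B_self)

text \<open>With \<open>w = u \<star> v\<close>, the span of \<open>e\<close>, \<open>u\<close>,
  \<open>v\<close>, \<open>w\<close> is a quaternion subalgebra; since \<open>u\<close> and
  \<open>v\<close> are orthogonal over \<open>k[a]\<close>, it is orthogonal to its own multiple by
  \<open>a\<close>.\<close>

lemma ex_reflection:
  "\<exists>s. octonion_automorphism scale mul e N s \<and> (\<forall>x. s (s x) = x) \<and> s a = - a \<and> s u = u \<and> s v = v"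
proof -
  define D where "D = {r \<triangleright> e + p1 \<triangleright> u + p2 \<triangleright> v + p3 \<triangleright> w |r p1 p2 p3. True}"
  have D_I: "r \<triangleright> e + p1 \<triangleright> u + p2 \<triangleright> v + p3 \<triangleright> w \<in> D" for r p1 p2 p3 by (auto simp: D_def)
  have orth: "B (a \<star> x) y = 0" if xy: "x \<in> D" "y \<in> D" for x y
  proof -
    obtain r p1 p2 p3 r' p1' p2' p3' where x: "x = r \<triangleright> e + p1 \<triangleright> u + p2 \<triangleright> v + p3 \<triangleright> w"
      and y: "y = r' \<triangleright> e + p1' \<triangleright> u + p2' \<triangleright> v + p3' \<triangleright> w" using xy by (auto simp: D_def)
    show ?thesis
      unfolding x y using uv w_W W_a[of u] W_a[of v] W_a[of w] by (simp add: W_D del: W_a)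
  qed
  have "\<exists>s. octonion_automorphism scale mul e N s \<and> (\<forall>x. s (s x) = x) \<and> (\<forall>x\<in>D. s x = x) \<and> s a = - a"
  proof (rule reflection[OF _ _ _ orth])
    show "subspace D"
    proof (rule subspaceI)
      show "0 \<in> D" using D_I[of 0 0 0 0] by simp
      fix x assume "x \<in> D"
      then obtain r p1 p2 p3 where x: "x = r \<triangleright> e + p1 \<triangleright> u + p2 \<triangleright> v + p3 \<triangleright> w" by (auto simp: D_def)
      show "c \<triangleright> x \<in> D" for c
        using D_I[of "c * r" "c * p1" "c * p2" "c * p3"] by (simp add: x scale_right_distrib)
      fix y assume "y \<in> D"
      then obtain r' p1' p2' p3' where y: "y = r' \<triangleright> e + p1' \<triangleright> u + p2' \<triangleright> v + p3' \<triangleright> w" by (auto simp: D_def)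
      show "x + y \<in> D"
        using D_I[of "r + r'" "p1 + p1'" "p2 + p2'" "p3 + p3'"] by (simp add: x y scale_left_distrib algebra_simps)
    qed
    show "e \<in> D" using D_I[of 1 0 0 0] by simp
    fix x y assume "x \<in> D" "y \<in> D"
    then obtain r p1 p2 p3 r' p1' p2' p3' where x: "x = r \<triangleright> e + p1 \<triangleright> u + p2 \<triangleright> v + p3 \<triangleright> w"
      and y: "y = r' \<triangleright> e + p1' \<triangleright> u + p2' \<triangleright> v + p3' \<triangleright> w" by (auto simp: D_def)
    have "x \<star> y = (r * r' - p1 * p1' * N u - p2 * p2' * N v - p3 * p3' * N w) \<triangleright> e
      + (r * p1' + p1 * r' + (p2 * p3' - p3 * p2') * N v) \<triangleright> u
      + (r * p2' + p2 * r' + (p3 * p1' - p1 * p3') * N u) \<triangleright> v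
      + (r * p3' + p3 * r' + (p1 * p2' - p2 * p1')) \<triangleright> w"
      unfolding x y by (simp add: scale_left_distrib scale_left_diff_distrib scale_right_distrib algebra_simps del: N_w)
    then have xy: "x \<star> y \<in> D" using D_I by simp
    show "B (x \<star> y) (a \<star> z) = 0" if "z \<in> D" for z
      using orth[OF that xy] by (simp add: B_commute[of "x \<star> y"])
  next
    fix z
    obtain r s where rs: "z = r \<triangleright> e + s \<triangleright> a + (z - r \<triangleright> e - s \<triangleright> a)" "z - r \<triangleright> e - s \<triangleright> a \<in> W"
      using full_expansion by blast
    obtain p1 q1 p2 q2 p3 q3 where
      *: "z - r \<triangleright> e - s \<triangleright> a = p1 \<triangleright> u + q1 \<triangleright> (a \<star> u) + p2 \<triangleright> v + q2 \<triangleright> (a \<star> v) + p3 \<triangleright> w + q3 \<triangleright> (a \<star> w)"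
      using expansion[OF rs(2)] by blast
    have "z = (r \<triangleright> e + p1 \<triangleright> u + p2 \<triangleright> v + p3 \<triangleright> w) + a \<star> (s \<triangleright> e + q1 \<triangleright> u + q2 \<triangleright> v + q3 \<triangleright> w)"
      by (subst rs(1)) (simp add: *)
    then show "\<exists>x\<in>D. \<exists>y\<in>D. z = x + a \<star> y" using D_I by blast
  qed
  then obtain s where s: "octonion_automorphism scale mul e N s" "\<forall>x. s (s x) = x" "\<forall>x\<in>D. s x = x" "s a = - a" by blast
  moreover have "u \<in> D" "v \<in> D" using D_I[of 0 1 0 0] D_I[of 0 0 1 0] by simp_all
  ultimately show ?thesis by blast
qed

lemma automorphism_eq_id:
  assumes "octonion_automorphism scale mul e N s" "s a = a" "s u = u" "s v = v"
  shows "s z = z"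
proof -
  interpret s: octonion_automorphism scale mul e N s by fact
  have w: "s w = w" unfolding w_def using assms(3,4) by (simp only: s.g_mult)
  obtain r t where rt: "z = r \<triangleright> e + t \<triangleright> a + (z - r \<triangleright> e - t \<triangleright> a)" "z - r \<triangleright> e - t \<triangleright> a \<in> W"
    using full_expansion by blast
  obtain p1 q1 p2 q2 p3 q3 where
    *: "z - r \<triangleright> e - t \<triangleright> a = p1 \<triangleright> u + q1 \<triangleright> (a \<star> u) + p2 \<triangleright> v + q2 \<triangleright> (a \<star> v) + p3 \<triangleright> w + q3 \<triangleright> (a \<star> w)"
    using expansion[OF rt(2)] by blast
  have z: "z = r \<triangleright> e + t \<triangleright> a + (p1 \<triangleright> u + q1 \<triangleright> (a \<star> u) + p2 \<triangleright> v + q2 \<triangleright> (a \<star> v) + p3 \<triangleright> w + q3 \<triangleright> (a \<star> w))"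
    using rt(1) unfolding * .
  show ?thesis unfolding z using assms by (simp add: w)
qed

lemma expansion_w:
  assumes "x \<in> W" "B x u = 0" "B x (a \<star> u) = 0" "B x v = 0" "B x (a \<star> v) = 0"
  shows "\<exists>r s. x = lsc r s w"
proof -
  have "x - lsc (B x w / B w w) (B x (a \<star> w) / B (a \<star> w) (a \<star> w)) w = 0"
    by (rule eq_0I) (use assms two in \<open>simp_all add: lsc_def W_D B_self\<close>)
  then show ?thesis by auto
qed

end

lemma (in normed_octonion) automorphism_comp:
  assumes "octonion_automorphism scale mul e N s" "octonion_automorphism scale mul e N t"
  shows "octonion_automorphism scale mul e N (\<lambda>x. s (t x))"
proof -
  interpret s: octonion_automorphism scale mul e N s by fact
  interpret t: octonion_automorphism scale mul e N t by fact
  show ?thesis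
  proof
    show "bij (\<lambda>x. s (t x))" using bij_comp[OF t.g_bij s.g_bij] by (simp add: comp_def)
  qed simp_all
qed

section \<open>Inverting involutions\<close>

locale fixed_axis = semisimple_automorphism + octonion_axis +
  assumes g_a [simp]: "g a = a"
begin

lemma gi_a [simp]: "gi a = a"
  using g_gi(2)[of a] by simp

lemma lsc_g [simp]: "g (lsc p q x) = lsc p q (g x)" "gi (lsc p q x) = lsc p q (gi x)"
  by (simp_all add: lsc_def)

lemma W_g [simp]: "x \<in> W \<Longrightarrow> g x \<in> W" "x \<in> W \<Longrightarrow> gi x \<in> W"
  using B_g_left[of x a] gi.B_g_left[of x a] by (auto simp: W_def)

definition inverted :: bool where
  "inverted \<longleftrightarrow> (\<exists>s. octonion_automorphism scale mul e N s \<and> (\<forall>x. s (s x) = x) \<and> (\<forall>x. s (g (s (g x))) = x))"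

text \<open>For \<lambda> = \<open>p + q a\<close>, the operator \<open>h = g\<close> - \<lambda> is
  not a polynomial in \<open>g\<close> over \<open>k\<close>, but its product with the conjugate
  operator \<open>h'\<close> is. Semisimplicity of this quadratic polynomial shows that
  \<open>h\<close> and \<open>h'\<close> both kill \<open>x\<close>, and so does their difference, a
  multiple of \<open>2 q a\<close>. If \<open>q = 0\<close>, then \<open>h\<close> is itself a
  polynomial in \<open>g\<close>.\<close>

lemma lsc_semisimple:
  assumes "g x = lsc p q x" "x = g z - lsc p q z"
  shows "x = 0"
proof -
  define h where "h y = g y - lsc p q y" for y
  define h' where "h' y = g y - lsc p (- q) y" for y
  have x: "x = h z" "h x = 0" using assms by (simp_all add: h_def)
  have hh': "h' (h y) = h (h' y)" for y
    by (simp add: h_def h'_def lsc_norm)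
  have Q: "1 \<triangleright> g (g y) + (- (2 * p)) \<triangleright> g y + (p^2 + N a * q^2) \<triangleright> y = h' (h y)" for y
    using lsc_trace[of p q "g y"] by (simp add: h_def h'_def lsc_norm algebra_simps)
  have h'_lin: "h' 0 = 0" by (simp add: h'_def)
  have "h' (h (h' (h z))) = h' (h' (h (h z)))" using hh' by simp
  also have "\<dots> = 0" using x by (simp add: h'_lin)
  finally have "h' (h z) = 0"
    using semisimple_quadratic[OF ss, where ?c2.0 = 1 and ?c1.0 = "- (2 * p)" and ?c0.0 = "p^2 + N a * q^2" and x = z]
    unfolding Q by simp
  then have "h' x - h x = 0" using x by simp
  then have "(2 * q) \<triangleright> (a \<star> x) = 0" by (simp add: h_def h'_def lsc_def scale_left_distrib[symmetric])
  then consider "q = 0" | "x = 0" using two by auto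
  then show ?thesis
  proof cases
    case 1
    have "0 \<triangleright> g (g y) + 1 \<triangleright> g y + (- p) \<triangleright> y = h y" for y using 1 by (simp add: h_def lsc_def)
    then show ?thesis
      using semisimple_quadratic[OF ss, where ?c2.0 = 0 and ?c1.0 = 1 and ?c0.0 = "- p" and x = z] x by simp
  qed
qed

lemma span_orthogonal_eq_0:
  assumes Z: "orthogonal_set Z" and z: "z \<in> span Z" "\<forall>b\<in>Z. B z b = 0"
  shows "z = 0"
proof (rule B_eqI)
  fix y
  have "\<forall>b\<in>Z. B (y - proj Z y) b = 0" using B_proj[OF Z] by simp
  then have "B (y - proj Z y) z = 0" using z(1) by (rule orthogonal_span)
  moreover have "B z (proj Z y) = 0" using z(2) proj_span by (rule orthogonal_span)
  ultimately show "B z y = B 0 y" by (simp add: B_commute[of z])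
qed

text \<open>An orthogonal basis of a subspace stable under \<open>g\<close> and \<open>k[a]\<close>.
  The orthogonal complement is stable too, so further eigenvectors can be sought orthogonal to those
  already found.\<close>

definition stable_set :: "'b set \<Rightarrow> bool" where
  "stable_set Z \<longleftrightarrow> orthogonal_set Z \<and> (\<forall>z\<in>Z. g z \<in> span Z \<and> gi z \<in> span Z \<and> a \<star> z \<in> span Z)"

lemma stable_set_orthogonal:
  assumes Z: "stable_set Z" and y: "\<forall>b\<in>Z. B y b = 0"
  shows "\<forall>b\<in>Z. B (g y) b = 0" "\<forall>b\<in>Z. B (gi y) b = 0" "\<forall>b\<in>Z. B (a \<star> y) b = 0" "\<forall>b\<in>Z. B (lsc p q y) b = 0"
proof -
  show "\<forall>b\<in>Z. B (g y) b = 0" "\<forall>b\<in>Z. B (gi y) b = 0" "\<forall>b\<in>Z. B (a \<star> y) b = 0"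
    using Z orthogonal_span[OF y] B_g_left[of y] gi.B_g_left[of y] B_a_skew[of y] by (auto simp: stable_set_def)
  then show "\<forall>b\<in>Z. B (lsc p q y) b = 0" using y by (simp add: B_lsc)
qed

lemma stable_set_span:
  assumes Z: "stable_set Z" and y: "y \<in> span Z"
  shows "g y \<in> span Z" "a \<star> y \<in> span Z"
proof -
  have "span Z \<subseteq> {y. g y \<in> span Z}"
    by (rule span_minimal) (use Z in \<open>auto simp: stable_set_def subspace_def span_add span_scale span_zero\<close>)
  then show "g y \<in> span Z" using y by blast
  have "span Z \<subseteq> {y. a \<star> y \<in> span Z}"
    by (rule span_minimal) (use Z in \<open>auto simp: stable_set_def subspace_def span_add span_scale span_zero\<close>)
  then show "a \<star> y \<in> span Z" using y by blast
qed

text \<open>The dual of the eigenvalue \<lambda> = \<open>p + q a\<close> is the inverse of its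
  conjugate, that is, \<lambda> divided by its norm; the equation for \<open>y\<close> is stated
  with the norm on the other side.\<close>

lemma lsc_dual_eigenvector:
  assumes Z: "stable_set Z" and x: "x \<noteq> 0" "g x = lsc p q x" "\<forall>b\<in>Z. B x b = 0"
  shows "\<exists>y. (\<forall>b\<in>Z. B y b = 0) \<and> B y x \<noteq> 0 \<and> lsc p q y = (p^2 + N a * q^2) \<triangleright> g y"
proof -
  define h where "h y = g y - lsc p q y" for y
  have h_lin: "Vector_Spaces.linear scale scale h"
    by unfold_locales (simp_all add: h_def algebra_simps)
  have "x \<notin> range h" using lsc_semisimple[OF x(2)] x(1) by (auto simp: h_def)
  then obtain y where y: "\<And>z. B y (h z) = 0" "B y x \<noteq> 0"
    using separation[OF subspace_range[OF h_lin]] by blast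
  define y' where "y' = y - proj Z y"
  have "gi y = lsc p (- q) y"
  proof (rule B_eqI)
    fix z
    have "B (gi y) z = B y (g z)" using B_g_left[of z y] by (simp add: B_commute)
    also have "\<dots> = B y (lsc p q z)" using y(1)[of z] by (simp add: h_def)
    also have "\<dots> = B (lsc p (- q) y) z" using B_lsc_adjoint[of p "- q" y z] by simp
    finally show "B (gi y) z = B (lsc p (- q) y) z" .
  qed
  then have "lsc p q (g (gi y)) = lsc p q (lsc p (- q) (g y))" by simp
  then have y_eq: "lsc p q y = (p^2 + N a * q^2) \<triangleright> g y" by (simp add: lsc_norm)
  have oZ: "orthogonal_set Z" using Z by (simp add: stable_set_def)
  have y'Z: "\<forall>b\<in>Z. B y' b = 0" by (simp add: y'_def B_proj[OF oZ])
  \<comment> \<open>The defect of the projected vector lies in the span of \<open>Z\<close> and, by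
    stability, is orthogonal to \<open>Z\<close>.\<close>
  define \<xi> where "\<xi> = lsc p q y' - (p^2 + N a * q^2) \<triangleright> g y'"
  have "\<xi> = - (lsc p q (proj Z y) - (p^2 + N a * q^2) \<triangleright> g (proj Z y))"
    using y_eq by (simp add: \<xi>_def y'_def scale_right_diff_distrib)
  also have "\<dots> \<in> span Z"
    unfolding lsc_def by (intro span_neg span_diff span_add span_scale stable_set_span[OF Z] proj_span)
  finally have "\<xi> \<in> span Z" .
  moreover have "\<forall>b\<in>Z. B \<xi> b = 0" using stable_set_orthogonal[OF Z y'Z] by (simp add: \<xi>_def)
  ultimately have "\<xi> = 0" by (rule span_orthogonal_eq_0[OF oZ])
  moreover have "B y' x = B y x"
    using orthogonal_span[OF x(3) proj_span] by (simp add: y'_def B_commute[of _ x])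
  ultimately show ?thesis using y'Z y(2) by (intro exI[of _ y']) (simp add: \<xi>_def)
qed

lemma lsc_anisotropic_eigenvector:
  assumes Z: "stable_set Z" and x: "x \<noteq> 0" "g x = lsc p q x" "\<forall>b\<in>Z. B x b = 0"
    and unit: "p^2 + N a * q^2 = 1"
  shows "\<exists>y. (\<forall>b\<in>Z. B y b = 0) \<and> N y \<noteq> 0 \<and> g y = lsc p q y"
proof -
  obtain y where y: "\<forall>b\<in>Z. B y b = 0" "B y x \<noteq> 0" "g y = lsc p q y"
    using lsc_dual_eigenvector[OF Z x] unit by auto
  have "N x \<noteq> 0 \<or> N y \<noteq> 0 \<or> N (x + y) \<noteq> 0" using y(2) by (auto simp: N_add B_commute)
  moreover have "g (x + y) = lsc p q (x + y)" "\<forall>b\<in>Z. B (x + y) b = 0" using x y by simp_all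
  ultimately show ?thesis using x y by blast
qed

lemma stable_set_axis: "stable_set {e, a}"
  using orthogonal_axis by (auto simp: stable_set_def intro: span_base span_scale span_neg)

lemma stable_set_eigenvector:
  assumes "u \<in> W" "N u \<noteq> 0" "g u = lsc p q u"
  shows "stable_set {a \<star> u, u, e, a}" "p^2 + N a * q^2 = 1" "gi u = lsc p (- q) u"
proof -
  have "N (g u) = (p^2 + N a * q^2) * N u" unfolding assms(3) by (rule N_lsc)
  then show unit: "p^2 + N a * q^2 = 1" using assms(2) by simp
  define z where "z = gi u"
  have "gi (g u) = lsc p q z" unfolding assms(3) z_def by simp
  then have "u = lsc p q z" by simp
  then have "lsc p (- q) u = z" by (simp add: lsc_norm unit)
  then show gi_u: "gi u = lsc p (- q) u" by (simp add: z_def)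
  have mem: "u \<in> span {a \<star> u, u, e, a}" "a \<star> u \<in> span {a \<star> u, u, e, a}" "e \<in> span {a \<star> u, u, e, a}"
    "a \<in> span {a \<star> u, u, e, a}" by (auto intro: span_base)
  then have *: "lsc p q u \<in> span {a \<star> u, u, e, a}" "lsc p q (a \<star> u) \<in> span {a \<star> u, u, e, a}" for p q
    unfolding lsc_def by (auto intro: span_add span_diff span_scale span_neg)
  show "stable_set {a \<star> u, u, e, a}"
    unfolding stable_set_def using orthogonal_4[OF assms(1,2)] mem *
    by (auto simp: assms(3) gi_u span_scale span_neg)
qed

text \<open>Here \<open>g\<close> stabilizes the quaternion subalgebra generated by \<open>a\<close> and \<open>u\<close>.\<close>

lemma inverted_if_eigenvector:
  assumes u: "u \<in> W" "N u \<noteq> 0" "g u = lsc pu qu u"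
  shows inverted
proof -
  note st = stable_set_eigenvector[OF u]
  \<comment> \<open>As \<open>s\<close> conjugates scalars, the two applications of \<open>g\<close>
    multiply \<open>x\<close> by a scalar of norm 1 and by its conjugate.\<close>
  have s_fix: "s (g (s (g x))) = x"
    if s: "octonion_automorphism scale mul e N s" "s a = - a" "s x = x" and gx: "g x = lsc p q x" "p^2 + N a * q^2 = 1" for s x p q
  proof -
    have "g (s (g x)) = lsc p (- q) (g x)" using s gx(1) by (simp add: lsc_automorphism(2)[OF s(1)])
    also have "\<dots> = x" using gx by (simp add: lsc_norm)
    finally show ?thesis using s by simp
  qed
  have comp: "octonion_automorphism scale mul e N (\<lambda>x. s (g (s (g x))))"
    if "octonion_automorphism scale mul e N s" for s
    using that octonion_automorphism_axioms by (intro automorphism_comp[of s "\<lambda>x. g (s (g x))"] automorphism_comp[of g "\<lambda>x. s (g x)"] automorphism_comp[of s g])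
  have inv_a: "s (g (s (g a))) = a" if "octonion_automorphism scale mul e N s" "s a = - a" for s
  proof -
    interpret s: octonion_automorphism scale mul e N s by fact
    show ?thesis using that(2) by simp
  qed
  have case_eigen: inverted
    if v: "v \<in> W" "N v \<noteq> 0" "B u v = 0" "B (a \<star> u) v = 0" "g v = lsc p q v" for v p q
  proof -
    interpret octonion_basis scale mul e N a u v by unfold_locales (use u v in auto)
    obtain s where s: "octonion_automorphism scale mul e N s" "\<forall>x. s (s x) = x" "s a = - a" "s u = u" "s v = v"
      using ex_reflection by blast
    have "s (g (s (g x))) = x" for x
      by (rule automorphism_eq_id[OF comp[OF s(1)] inv_a[OF s(1,3)] s_fix[OF s(1,3,4) u(3) st(2)]
            s_fix[OF s(1,3,5) v(5) stable_set_eigenvector(2)[OF v(1,2,5)]]])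
    then show ?thesis unfolding inverted_def using s by blast
  qed
  obtain v where v: "v \<in> W" "N v \<noteq> 0" "B u v = 0" "B (a \<star> u) v = 0" using ex_second[OF u(1,2)] by blast
  interpret octonion_basis scale mul e N a u v by unfold_locales (use u v in auto)
  have vZ: "\<forall>b\<in>{a \<star> u, u, e, a}. B v b = 0" using v by (auto simp: W_D)
  \<comment> \<open>\<open>p + q a\<close> is the diagonal coefficient of \<open>g\<close> at
    \<open>v\<close>. The remainders \<open>v0\<close> of \<open>g v\<close> and \<open>v1\<close>
    of \<open>gi v\<close> are orthogonal to \<open>u\<close> and \<open>v\<close> over
    \<open>k[a]\<close>, hence multiples of \<open>w\<close>.\<close>
  define p q where "p = B (g v) v / B v v" and "q = B (g v) (a \<star> v) / B (a \<star> v) (a \<star> v)"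
  define v0 where "v0 = g v - lsc p q v"
  define v1 where "v1 = gi v - lsc p (- q) v"
  have Bvv: "B v v \<noteq> 0" using B_self_nonzero v(2) by blast
  have gv: "g v = lsc p q v + v0" "gi v = lsc p (- q) v + v1" by (simp_all add: v0_def v1_def)
  have v0: "v0 \<in> W" "B v0 u = 0" "B v0 (a \<star> u) = 0" "B v0 v = 0" "B v0 (a \<star> v) = 0"
  proof -
    show "v0 \<in> W" using v by (simp add: v0_def)
    show "B v0 u = 0" "B v0 (a \<star> u) = 0"
      using stable_set_orthogonal(1,4)[OF st(1) vZ] by (simp_all add: v0_def)
    show "B v0 v = 0" "B v0 (a \<star> v) = 0" using Bvv by (simp_all add: v0_def B_lsc p_def q_def)
  qed
  have v1: "v1 \<in> W" "B v1 u = 0" "B v1 (a \<star> u) = 0" "B v1 v = 0" "B v1 (a \<star> v) = 0"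
  proof -
    show "v1 \<in> W" using v by (simp add: v1_def)
    show "B v1 u = 0" "B v1 (a \<star> u) = 0"
      using stable_set_orthogonal(2,4)[OF st(1) vZ] by (simp_all add: v1_def)
    have "B (gi v) v = B (g v) v" using gi.B_g_left[of v v] by (simp add: B_commute)
    then show "B v1 v = 0" using Bvv by (simp add: v1_def B_lsc p_def)
    have "B (gi v) (a \<star> v) = - B (g v) (a \<star> v)"
      using gi.B_g_left[of v "a \<star> v"] B_a_skew[of v "g v"] by (simp add: B_commute)
    then show "B v1 (a \<star> v) = 0" using Bvv by (simp add: v1_def B_lsc q_def)
  qed
  obtain r s where rs: "v0 = lsc r s w" using expansion_w v0 by blast
  obtain r' s' where rs': "v1 = lsc r' s' w" using expansion_w v1 by blast
  have N_v0: "N v = (p^2 + N a * q^2) * N v + N v0" "N v = (p^2 + N a * q^2) * N v + N v1"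
  proof -
    have "B (lsc p q v) v0 = 0" "B (lsc p (- q) v) v1 = 0" using v0 v1 by (simp_all add: B_lsc B_commute[of _ v0] B_commute[of _ v1])
    then have "N (g v) = N (lsc p q v) + N v0" "N (gi v) = N (lsc p (- q) v) + N v1" unfolding gv by (simp_all add: N_add)
    then show "N v = (p^2 + N a * q^2) * N v + N v0" "N v = (p^2 + N a * q^2) * N v + N v1" by (simp_all add: N_lsc)
  qed
  have Nw: "N w \<noteq> 0" using u v by simp
  have norm_eq: "r^2 + N a * s^2 = r'^2 + N a * s'^2"
  proof -
    have "N v0 = N v1" using N_v0 by (metis add_left_cancel)
    then show ?thesis unfolding rs rs' N_lsc using Nw by (simp del: N_w)
  qed
  consider "v0 = 0" | "v0 \<noteq> 0" "N v0 = 0" | "N v0 \<noteq> 0" by auto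
  then show inverted
  proof cases
    case 1
    then show ?thesis using case_eigen[OF v, of p q] gv by simp
  next
    case 2
    \<comment> \<open>A nonzero isotropic multiple of \<open>w\<close> has a zero divisor
      \<open>r + s a\<close> as coefficient; multiplying \<open>v\<close> by the conjugate of this
      scalar kills \<open>v0\<close> and leaves an eigenvector.\<close>
    have rs0: "r^2 + N a * s^2 = 0" using 2(2) unfolding rs N_lsc using Nw by (simp del: N_w)
    define x where "x = lsc r (- s) v"
    have "p^2 + N a * q^2 = 1" using N_v0(1) 2(2) v(2) by simp
    moreover have "g x = lsc p q x"
    proof -
      have "lsc r (- s) v0 = 0" unfolding rs lsc_norm rs0 by simp
      then show ?thesis using lsc_commute[of r "- s" p q v] by (simp add: x_def gv)
    qed
    moreover have "x \<noteq> 0"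
    proof
      assume "x = 0"
      then have "B x v = 0" "B x (a \<star> v) = 0" by simp_all
      then have "r = 0" "s = 0" using Bvv by (simp_all add: x_def B_lsc)
      then show False using 2(1) by (simp add: rs lsc_def)
    qed
    moreover have "\<forall>b\<in>{a \<star> u, u, e, a}. B x b = 0" unfolding x_def by (rule stable_set_orthogonal[OF st(1) vZ])
    ultimately obtain y where y: "\<forall>b\<in>{a \<star> u, u, e, a}. B y b = 0" "N y \<noteq> 0" "g y = lsc p q y"
      using lsc_anisotropic_eigenvector[OF st(1)] by blast
    have "y \<in> W" "B u y = 0" "B (a \<star> u) y = 0" using y(1) by (auto simp: W_def B_commute)
    then show ?thesis using case_eigen y by blast
  next
    case 3
    then have nz: "r^2 + N a * s^2 \<noteq> 0" by (auto simp: rs N_lsc)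
    \<comment> \<open>Hilbert 90: \<open>r' + s' a\<close> and the conjugate of
      \<open>r + s a\<close> have equal norms, so their ratio is a quotient of two conjugates. One
      solution is the sum of \<open>r + s a\<close> and \<open>r' + s' a\<close>, another is
      \<open>a\<close> times their difference; by the parallelogram law they cannot both have norm
      0.\<close>
    have "\<exists>c d. c^2 + N a * d^2 \<noteq> 0 \<and> lsc r (- s) (lsc c d w) = lsc r' s' (lsc c (- d) w)"
    proof (cases "(r + r')^2 + N a * (s + s')^2 = 0")
      case False
      have "lsc r (- s) (lsc (r + r') (s + s') w) = lsc r' s' (lsc (r + r') (- (s + s')) w)"
      proof -
        have "r * (r + r') - N a * - s * (s + s') = r' * (r + r') - N a * s' * - (s + s')"
          using norm_eq by Groebner_Basis.algebra
        moreover have "r * (s + s') + - s * (r + r') = r' * - (s + s') + s' * (r + r')"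
          by (simp add: algebra_simps)
        ultimately show ?thesis unfolding lsc_lsc by simp
      qed
      then show ?thesis using False by blast
    next
      case True
      have "(- N a * (s' - s))^2 + N a * (r' - r)^2 = (2 * 2) * (N a * (r^2 + N a * s^2))"
        using True norm_eq by Groebner_Basis.algebra
      then have "(- N a * (s' - s))^2 + N a * (r' - r)^2 \<noteq> 0"
        using nz a_norm two by (simp only: mult_eq_0_iff) simp
      moreover have "lsc r (- s) (lsc (- N a * (s' - s)) (r' - r) w) = lsc r' s' (lsc (- N a * (s' - s)) (- (r' - r)) w)"
      proof -
        have "r * (- N a * (s' - s)) - N a * - s * (r' - r) = r' * (- N a * (s' - s)) - N a * s' * - (r' - r)"
          by (simp add: algebra_simps)
        moreover have "r * (r' - r) + - s * (- N a * (s' - s)) = r' * - (r' - r) + s' * (- N a * (s' - s))"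
          using norm_eq by Groebner_Basis.algebra
        ultimately show ?thesis unfolding lsc_lsc by simp
      qed
      ultimately show ?thesis by blast
    qed
    then obtain c d where cd: "c^2 + N a * d^2 \<noteq> 0" "lsc r (- s) (lsc c d w) = lsc r' s' (lsc c (- d) w)" by blast
    \<comment> \<open>Chosen so that the reflection fixing \<open>v\<close> and \<open>b\<close>
      maps \<open>v0\<close> to \<open>v1\<close>, and hence \<open>g v\<close> to
      \<open>gi v\<close>.\<close>
    define b where "b = lsc c d w"
    have b: "b \<in> W" "N b \<noteq> 0" "B v b = 0" "B (a \<star> v) b = 0"
      using cd(1) Nw by (simp_all add: b_def N_lsc B_lsc)
    interpret b2: octonion_basis scale mul e N a v b by unfold_locales (use v b in auto)
    obtain t where t: "octonion_automorphism scale mul e N t" "\<forall>x. t (t x) = x" "t a = - a" "t v = v" "t b = b"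
      using b2.ex_reflection by blast
    have "t v0 = v1"
    proof -
      have "lsc c (- d) (t v0) = t (lsc c d v0)" using t by (simp add: lsc_automorphism(2)[OF t(1)])
      also have "lsc c d v0 = lsc r s b" unfolding rs b_def by (rule lsc_commute)
      also have "t \<dots> = lsc r (- s) b" using t by (simp add: lsc_automorphism(2)[OF t(1)])
      also have "\<dots> = lsc c (- d) v1" unfolding b_def cd(2) rs' by (rule lsc_commute)
      finally have "lsc c d (lsc c (- d) (t v0)) = lsc c d (lsc c (- d) v1)" by simp
      then show ?thesis using cd(1) by (simp add: lsc_norm)
    qed
    interpret t: octonion_automorphism scale mul e N t by (rule t(1))
    have "t (g v) = gi v" using t \<open>t v0 = v1\<close> by (simp add: gv lsc_automorphism(2)[OF t(1)])
    then have fix_v: "t (g (t (g v))) = v" using t by simp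
    \<comment> \<open>A further vector fixed by \<open>t\<close>. It is orthogonal to the multiples
      of \<open>v\<close> and \<open>w\<close> by \<open>k[a]\<close>, so it is a multiple of
      \<open>u\<close> and again an eigenvector of \<open>g\<close>.\<close>
    define m where "m = v \<star> b"
    have m: "t m = m" unfolding m_def by (simp only: t.g_mult t(4,5))
    have mw: "m = b2.w" by (simp add: m_def)
    have mW: "m \<in> W" "N m \<noteq> 0" "B v m = 0" "B (a \<star> v) m = 0" using v b by (simp_all add: mw)
    have "B m w = 0 \<and> B m (a \<star> w) = 0"
    proof -
      have "B m b = 0" "B (a \<star> m) b = 0" by (simp_all add: mw)
      then have "c * B m w + d * B m (a \<star> w) = 0" "c * B m (a \<star> w) - d * N a * B m w = 0"
        by (simp_all add: b_def B_lsc B_a_skew[of m] mult_ac)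
      then have "(c^2 + N a * d^2) * B m w = 0" "(c^2 + N a * d^2) * B m (a \<star> w) = 0"
        by Groebner_Basis.algebra+
      then show ?thesis using cd(1) by simp
    qed
    then have "m - lsc (B m u / B u u) (B m (a \<star> u) / B (a \<star> u) (a \<star> u)) u = 0"
      using mW u two W_D[OF mW(1)]
      by (intro eq_0I) (simp_all add: lsc_def W_D B_self B_commute[of m v] B_commute[of m "a \<star> v"])
    then obtain f h where "m = lsc f h u" by auto
    then have gm: "g m = lsc pu qu m" using u(3) lsc_commute by simp
    interpret b3: octonion_basis scale mul e N a v m by unfold_locales (use v mW in auto)
    have "t (g (t (g x))) = x" for x
      by (rule b3.automorphism_eq_id[OF comp[OF t(1)] inv_a[OF t(1,3)] fix_v s_fix[OF t(1,3) m gm st(2)]])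
    then show ?thesis unfolding inverted_def using t by blast
  qed
qed

end

lemma (in octonion_axis) W_eqI:
  assumes "x \<in> W" "y \<in> W" "\<And>z. z \<in> W \<Longrightarrow> B x z = B y z"
  shows "x = y"
proof (rule B_eqI)
  fix z
  define z' where "z' = z - (B z e / 2) \<triangleright> e - (B z a / (2 * N a)) \<triangleright> a"
  have "z' \<in> W" using two by (simp add: z'_def W_def B_self)
  then have "B x z' = B y z'" using assms(3) by blast
  then show "B x z = B y z" using assms(1,2) by (simp add: z'_def W_D)
qed

section \<open>The form \<open>T\<close> in the algebraic closure, and inversion from a
  generator\<close>

locale fixed_axis_basis = fixed_axis + octonion_basis
begin

text \<open>The \<open>k[a]\<close>-valued form with components \<open>\<phi>\<close> and \<open>\<psi>\<close>, evaluated at the homomorphism \<open>a \<mapsto> r\<close> into the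
  algebraic closure. Using both roots \<open>r\<close> and \<open>-r\<close> covers split \<open>k[a]\<close>, too.\<close>

definition T :: "'a alg_closure \<Rightarrow> 'b \<Rightarrow> 'b \<Rightarrow> 'b \<Rightarrow> 'a alg_closure" where
  "T r x y z = r * to_ac (\<phi> x y z) + to_ac (\<psi> x y z)"

abbreviation K where "K r \<equiv> adjoin_sqrt (range to_ac) r"

definition axis_root :: "'a alg_closure \<Rightarrow> bool" where "axis_root r \<longleftrightarrow> r^2 = to_ac (- N a)"

lemma subfield_range: "subfield_set (range to_ac :: 'a alg_closure set)"
  unfolding subfield_set_def
proof (intro conjI ballI)
  show "0 \<in> (range to_ac :: 'a alg_closure set)" "1 \<in> (range to_ac :: 'a alg_closure set)"
    by (metis rangeI to_ac_0, metis rangeI to_ac_1)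
  fix x :: "'a alg_closure" assume "x \<in> range to_ac"
  then obtain x' where x: "x = to_ac x'" by blast
  show "- x \<in> range to_ac" "inverse x \<in> range to_ac"
    unfolding x by (simp_all flip: to_ac_minus to_ac_inverse)
  fix y :: "'a alg_closure" assume "y \<in> range to_ac"
  then obtain y' where y: "y = to_ac y'" by blast
  show "x + y \<in> range to_ac" "x * y \<in> range to_ac"
    unfolding x y by (simp_all flip: to_ac_add to_ac_mult)
qed

lemma subfield_K: "axis_root r \<Longrightarrow> subfield_set (K r)"
  by (rule subfield_adjoin_sqrt[OF subfield_range]) (auto simp: axis_root_def simp del: to_ac_minus)

lemma K_I: "to_ac p + to_ac q * r \<in> K r"
  by (rule adjoin_sqrtI) auto

lemma K_E:
  assumes "x \<in> K r" obtains p q where "x = to_ac p + to_ac q * r"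
  using assms by (auto simp: adjoin_sqrt_def)

lemma T_lsc:
  assumes "axis_root r" "x \<in> W" "y \<in> W" "z \<in> W"
  shows "T r (lsc p q x) y z = (to_ac p + to_ac q * r) * T r x y z"
proof -
  have "to_ac (N a) = - (r * r)" using assms(1) by (simp add: axis_root_def power2_eq_square)
  then show ?thesis using assms(2-) by (simp add: T_def lsc_def algebra_simps)
qed

lemma axis_root_nonzero: "axis_root r \<Longrightarrow> r \<noteq> 0"
  by (auto simp: axis_root_def)

lemma axis_root_minus: "axis_root r \<Longrightarrow> axis_root (- r)"
  by (simp add: axis_root_def)

lemma two_ac: "(2 :: 'a alg_closure) \<noteq> 0"
  using two by (metis to_ac_eq_0_iff to_ac_numeral)

lemma T_add: "T r (x + x') y z = T r x y z + T r x' y z"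
  by (simp add: T_def algebra_simps)

lemma T_diff: "T r (x - x') y z = T r x y z - T r x' y z"
  by (simp add: T_def algebra_simps)

lemma T_alternating_rank3:
  assumes r: "axis_root r"
  shows "alternating_rank3 W (T r) g gi u v w (K r)"
proof
  show "\<exists>a b c. \<forall>y\<in>W. \<forall>z\<in>W. T r x y z = a * T r u y z + b * T r v y z + c * T r w y z" if x: "x \<in> W" for x
  proof -
    obtain p1 q1 p2 q2 p3 q3 where
      "x = p1 \<triangleright> u + q1 \<triangleright> (a \<star> u) + p2 \<triangleright> v + q2 \<triangleright> (a \<star> v) + p3 \<triangleright> w + q3 \<triangleright> (a \<star> w)"
      using expansion[OF x] by blast
    then have "x = lsc p1 q1 u + lsc p2 q2 v + lsc p3 q3 w" by (simp add: lsc_def add_ac)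
    then have "\<forall>y\<in>W. \<forall>z\<in>W. T r x y z = (to_ac p1 + to_ac q1 * r) * T r u y z +
      (to_ac p2 + to_ac q2 * r) * T r v y z + (to_ac p3 + to_ac q3 * r) * T r w y z"
      using r by (simp add: T_add T_lsc)
    then show ?thesis by blast
  qed
  show "T r u v w \<noteq> 0"
    using two uv axis_root_nonzero[OF r] by (simp add: T_def \<phi>_uvw two_ac)
  show "subfield_set (K r)" by (rule subfield_K[OF r])
  show "T r x y z \<in> K r" for x y z
    using K_I[of "\<psi> x y z" "\<phi> x y z" r] by (simp add: T_def add.commute mult.commute)
  show "T r (g x) (g y) (g z) = T r x y z" for x y z
  proof -
    have "\<phi> (g x) (g y) (g z) = \<phi> x y z" using B_g[of x "y \<star> z"] by (simp add: \<phi>_def del: B_g)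
    moreover have "\<psi> (g x) (g y) (g z) = \<psi> x y z" using B_g[of "a \<star> x" "y \<star> z"] by (simp add: \<psi>_def del: B_g)
    ultimately show ?thesis by (simp add: T_def)
  qed
  show "T r y x z = - T r x y z" "T r x z y = - T r x y z" if "x \<in> W" "y \<in> W" "z \<in> W" for x y z
    using \<phi>_swap[OF that] \<psi>_swap[OF that] by (simp_all add: T_def algebra_simps)
qed (simp_all add: T_def)

lemma T_eq_0D:
  assumes "axis_root r" "T r x y z = 0" "T (- r) x y z = 0"
  shows "\<phi> x y z = 0"
proof -
  have "2 * (r * to_ac (\<phi> x y z)) = T r x y z - T (- r) x y z" by (simp add: T_def algebra_simps)
  then show ?thesis using assms two_ac axis_root_nonzero by simp
qed

lemma ex_axis_root: "\<exists>r. axis_root r"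
proof -
  have "\<exists>x. poly [:to_ac (N a), 0, 1:] x = 0" by (rule alg_closed_imp_poly_has_root) auto
  then obtain x where "poly [:to_ac (N a), 0, 1:] x = 0" ..
  then have "x^2 = to_ac (- N a)" by (simp add: power2_eq_square eq_neg_iff_add_eq_0 add.commute)
  then show ?thesis by (auto simp: axis_root_def)
qed

text \<open>Cramer's rule over \<open>k[a]\<close>, for three vectors on which \<open>T\<close> has
  the value 1: the coordinates are values of \<open>T\<close>, with components \<open>\<psi>\<close>
  and \<open>\<phi>\<close>. The identity is checked under both homomorphisms and carried back by
  \<open>T_eq_0D\<close> and \<open>\<phi>_nondegenerate\<close>.\<close>

lemma generator_expansion:
  assumes xyz: "x1 \<in> W" "x2 \<in> W" "x3 \<in> W" and \<phi>0: "\<phi> x1 x2 x3 = 0" and \<psi>1: "\<psi> x1 x2 x3 = 1" and x: "x \<in> W"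
  shows "x = lsc (\<psi> x x2 x3) (\<phi> x x2 x3) x1 + lsc (\<psi> x1 x x3) (\<phi> x1 x x3) x2 + lsc (\<psi> x1 x2 x) (\<phi> x1 x2 x) x3"
proof -
  define y where "y = x - (lsc (\<psi> x x2 x3) (\<phi> x x2 x3) x1 + lsc (\<psi> x1 x x3) (\<phi> x1 x x3) x2 + lsc (\<psi> x1 x2 x) (\<phi> x1 x2 x) x3)"
  have yW: "y \<in> W" using xyz x by (simp add: y_def)
  have T0: "T r y s t = 0" if r: "axis_root r" and st: "s \<in> W" "t \<in> W" for r s t
  proof -
    interpret T: alternating_rank3 W "T r" g gi u v w "K r" by (rule T_alternating_rank3[OF r])
    have T1: "T r x1 x2 x3 = 1" by (simp add: T_def \<phi>0 \<psi>1)
    have c: "to_ac (\<psi> y1 y2 y3) + to_ac (\<phi> y1 y2 y3) * r = T r y1 y2 y3" for y1 y2 y3 by (simp add: T_def)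
    have "T r y s t = T r x s t - (T r x x2 x3 * T r x1 s t + T r x1 x x3 * T r x2 s t + T r x1 x2 x * T r x3 s t)"
      unfolding y_def T_diff T_add T_lsc[OF r xyz(1) st] T_lsc[OF r xyz(2) st] T_lsc[OF r xyz(3) st] c ..
    also have "T r x1 x2 x3 * T r x s t = T r x x2 x3 * T r x1 s t + T r x1 x x3 * T r x2 s t + T r x1 x2 x * T r x3 s t"
      using T.cramer[of x1 x2 x3 x s t] T.T_cyclic[of x x2 x3] T.T_swap23[of x1 x x3] xyz x st by (simp add: algebra_simps)
    ultimately show ?thesis using T1 by simp
  qed
  obtain r where r: "axis_root r" using ex_axis_root by blast
  have "y = 0"
    by (rule \<phi>_nondegenerate[OF yW]) (use T_eq_0D[OF r] T0[OF r] T0[OF axis_root_minus[OF r]] in blast)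
  then show ?thesis by (simp add: y_def)
qed

text \<open>Up to the factor \<open>1/2\<close>, the vectors \<open>g w0\<close> and
  \<open>gi w0\<close> are \<open>e2\<close> minus and plus the same multiple of
  \<open>a \<star> e3\<close>. A reflection that fixes \<open>D\<close> and negates \<open>a\<close>
  therefore exchanges them.\<close>

lemma inverted_if_generator:
  assumes w0: "w0 \<in> W" and \<phi>0: "\<phi> (gi w0) w0 (g w0) = 0" and \<psi>1: "\<psi> (gi w0) w0 (g w0) = 1"
  shows inverted
proof -
  define yp ym e2 e3 where "yp = g w0" and "ym = gi w0" and "e2 = yp + ym" and "e3 = a \<star> (yp - ym)"
  have W: "yp \<in> W" "ym \<in> W" "e2 \<in> W" "e3 \<in> W" using w0 by (simp_all add: yp_def ym_def e2_def e3_def)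
  note BW = W_D[OF w0] W_D[OF W(1)] W_D[OF W(2)] W_D[OF W(3)] W_D[OF W(4)]
    W_D[OF W_a[OF w0]] W_D[OF W_a[OF W(3)]] W_D[OF W_a[OF W(4)]]
  have Bg: "B w0 ym = B w0 yp" "B ym ym = B yp yp" "B (a \<star> w0) ym = - B (a \<star> w0) yp"
  proof -
    show "B w0 ym = B w0 yp" using B_g_left[of w0 w0] by (simp add: yp_def ym_def B_commute)
    show "B ym ym = B yp yp" by (simp add: yp_def ym_def)
    have "B (a \<star> w0) ym = B (a \<star> yp) w0" using B_g_left[of "a \<star> w0" w0] by (simp add: yp_def ym_def)
    then show "B (a \<star> w0) ym = - B (a \<star> w0) yp" using B_a_skew[of yp w0] by (simp add: B_commute)
  qed
  define D where "D = {r \<triangleright> e + p1 \<triangleright> w0 + p2 \<triangleright> e2 + p3 \<triangleright> e3 |r p1 p2 p3. True}"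
  have D_I: "r \<triangleright> e + p1 \<triangleright> w0 + p2 \<triangleright> e2 + p3 \<triangleright> e3 \<in> D" for r p1 p2 p3 by (auto simp: D_def)
  have o12: "B (a \<star> w0) e2 = 0" "B (a \<star> w0) e3 = 0" "B (a \<star> e2) e3 = 0"
    using Bg by (simp_all add: e2_def e3_def B_commute)
  then have o21: "B (a \<star> e2) w0 = 0" "B (a \<star> e3) w0 = 0" "B (a \<star> e3) e2 = 0"
    by (simp_all add: B_a_skew[of e2] B_a_skew[of e3] B_commute[of _ "a \<star> w0"] B_commute[of _ "a \<star> e2"])
  have orth: "B (a \<star> x) y = 0" if xy: "x \<in> D" "y \<in> D" for x y
  proof -
    obtain r p1 p2 p3 r' p1' p2' p3' where x: "x = r \<triangleright> e + p1 \<triangleright> w0 + p2 \<triangleright> e2 + p3 \<triangleright> e3"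
      and y: "y = r' \<triangleright> e + p1' \<triangleright> w0 + p2' \<triangleright> e2 + p3' \<triangleright> e3" using xy by (auto simp: D_def)
    show ?thesis unfolding x y by (simp add: o12 o21 BW)
  qed
  \<comment> \<open>Up to a nonzero factor, this is the value of \<open>\<phi>\<close> that vanishes
    by \<open>\<phi>0\<close>. Together with antisymmetry it yields the orthogonality
    \<open>mult_orth\<close>.\<close>
  have psi0: "\<psi> w0 e2 e3 = 0"
  proof -
    have "\<phi> w0 yp ym = 0" "\<phi> w0 ym yp = 0"
      using \<phi>0 \<phi>_swap[of ym w0 yp] \<phi>_swap[of w0 yp ym] w0 W by (simp_all add: yp_def ym_def)
    then show ?thesis using w0 W by (simp add: e2_def e3_def)
  qed
  have psi1: "\<psi> w0 e3 e2 = 0" "\<psi> e2 w0 e3 = 0"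
    unfolding \<psi>_swap[OF w0 W(3,4)] using psi0 by simp_all
  have psi2: "\<psi> e2 e3 w0 = 0" "\<psi> e3 w0 e2 = 0"
    unfolding \<psi>_swap(1)[OF W(3) w0 W(4)] \<psi>_swap(2)[OF w0 W(4,3)] using psi1 by simp_all
  have psi3: "\<psi> e3 e2 w0 = 0"
    unfolding \<psi>_swap(1)[OF W(4) w0 W(3)] using psi2 by simp
  note psi = psi1 psi2 psi3
  have mult_orth: "B (x \<star> y) (a \<star> z) = 0" if xyz: "x \<in> D" "y \<in> D" "z \<in> D" for x y z
  proof -
    obtain r p1 p2 p3 r' p1' p2' p3' r'' p1'' p2'' p3'' where x: "x = r \<triangleright> e + (p1 \<triangleright> w0 + p2 \<triangleright> e2 + p3 \<triangleright> e3)"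
      and y: "y = r' \<triangleright> e + (p1' \<triangleright> w0 + p2' \<triangleright> e2 + p3' \<triangleright> e3)"
      and z: "z = r'' \<triangleright> e + (p1'' \<triangleright> w0 + p2'' \<triangleright> e2 + p3'' \<triangleright> e3)" using xyz by (auto simp: D_def add.assoc)
    define x' y' z' where "x' = p1 \<triangleright> w0 + p2 \<triangleright> e2 + p3 \<triangleright> e3" and "y' = p1' \<triangleright> w0 + p2' \<triangleright> e2 + p3' \<triangleright> e3"
      and "z' = p1'' \<triangleright> w0 + p2'' \<triangleright> e2 + p3'' \<triangleright> e3"
    have xyz': "x' \<in> W" "y' \<in> W" "z' \<in> W" using w0 W by (simp_all add: x'_def y'_def z'_def)
    have D': "x' \<in> D" "y' \<in> D"
      using D_I[of 0 p1 p2 p3] D_I[of 0 p1' p2' p3'] by (simp_all add: x'_def y'_def)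
    have "\<psi> z' x' y' = 0" unfolding x'_def y'_def z'_def using w0 W by (simp add: psi0 psi)
    then have 1: "B (x' \<star> y') (a \<star> z') = 0" by (simp add: \<psi>_def B_commute)
    have 2: "B x' (a \<star> z) = 0" "B y' (a \<star> z) = 0" "B e (a \<star> z) = 0"
      using orth[OF xyz(3) D'(1)] orth[OF xyz(3) D'(2)] orth[OF xyz(3) D_I[of 1 0 0 0]] by (simp_all add: B_commute)
    have 3: "B (x' \<star> y') a = 0"
      using B_adjoint_right[of x' y' a] orth[OF D'(2,1)] W_D[OF xyz'(2)] by (simp add: B_commute[of x'])
    have "B (x \<star> y) (a \<star> z) = r * r' * B e (a \<star> z) + r * B y' (a \<star> z) + r' * B x' (a \<star> z) + B (x' \<star> y') (a \<star> z)"
      unfolding x y x'_def[symmetric] y'_def[symmetric] by (simp add: algebra_simps)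
    also have "\<dots> = B (x' \<star> y') (a \<star> z)" using 2 by simp
    also have "\<dots> = 0" unfolding z z'_def[symmetric] using 1 3 by simp
    finally show ?thesis .
  qed
  \<comment> \<open>\<open>D + a D\<close> is closed under multiplication by \<open>k[a]\<close> and
    contains \<open>e\<close> and generators of \<open>W\<close> over \<open>k[a]\<close>, so it is
    the whole algebra.\<close>
  define S where "S = {x + a \<star> y |x y. x \<in> D \<and> y \<in> D}"
  have subD: "subspace D"
  proof (rule subspaceI)
    show "0 \<in> D" using D_I[of 0 0 0 0] by simp
    fix x assume "x \<in> D"
    then obtain r p1 p2 p3 where x: "x = r \<triangleright> e + p1 \<triangleright> w0 + p2 \<triangleright> e2 + p3 \<triangleright> e3" by (auto simp: D_def)
    show "c \<triangleright> x \<in> D" for c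
      using D_I[of "c * r" "c * p1" "c * p2" "c * p3"] by (simp add: x scale_right_distrib)
    fix y assume "y \<in> D"
    then obtain r' p1' p2' p3' where y: "y = r' \<triangleright> e + p1' \<triangleright> w0 + p2' \<triangleright> e2 + p3' \<triangleright> e3" by (auto simp: D_def)
    show "x + y \<in> D"
      using D_I[of "r + r'" "p1 + p1'" "p2 + p2'" "p3 + p3'"] by (simp add: x y scale_left_distrib algebra_simps)
  qed
  have S_I: "x \<in> D \<Longrightarrow> y \<in> D \<Longrightarrow> x + a \<star> y \<in> S" for x y by (auto simp: S_def)
  have S_add: "x + y \<in> S" if S: "x \<in> S" "y \<in> S" for x y
  proof -
    obtain x1 x2 y1 y2 where *: "x = x1 + a \<star> x2" "y = y1 + a \<star> y2" "x1 \<in> D" "x2 \<in> D" "y1 \<in> D" "y2 \<in> D"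
      using S by (auto simp: S_def)
    have "x + y = (x1 + y1) + a \<star> (x2 + y2)" by (simp add: *)
    then show ?thesis using * S_I subspace_add[OF subD] by metis
  qed
  have S_scale: "c \<triangleright> x \<in> S" and S_a: "a \<star> x \<in> S" if S: "x \<in> S" for x c
  proof -
    obtain x1 x2 where *: "x = x1 + a \<star> x2" "x1 \<in> D" "x2 \<in> D" using S by (auto simp: S_def)
    have "c \<triangleright> x = c \<triangleright> x1 + a \<star> (c \<triangleright> x2)" by (simp add: * scale_right_distrib)
    then show "c \<triangleright> x \<in> S" using * S_I subspace_scale[OF subD] by metis
    have "a \<star> x = (- N a) \<triangleright> x2 + a \<star> x1" by (simp add: *)
    then show "a \<star> x \<in> S" using * S_I subspace_scale[OF subD] by metis
  qed
  have S_D: "x \<in> D \<Longrightarrow> x \<in> S" for x using S_I[of x 0] subspace_0[OF subD] by simp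
  have S_lsc: "lsc p q x \<in> S" if "x \<in> S" for p q x unfolding lsc_def using that by (intro S_add S_scale S_a)
  have D_gen: "e \<in> D" "w0 \<in> D" "e2 \<in> D" "e3 \<in> D"
    using D_I[of 1 0 0 0] D_I[of 0 1 0 0] D_I[of 0 0 1 0] D_I[of 0 0 0 1] by simp_all
  have ae3: "a \<star> e3 = - N a \<triangleright> (yp - ym)" by (simp add: e3_def scale_right_diff_distrib)
  have y_eq: "yp = (1 / 2) \<triangleright> (e2 + (- 1 / N a) \<triangleright> (a \<star> e3))" "ym = (1 / 2) \<triangleright> (e2 + (1 / N a) \<triangleright> (a \<star> e3))"
  proof -
    have half: "(1 / 2) \<triangleright> (x + x) = x" for x
    proof -
      have "x + x = 2 \<triangleright> x" using scale_left_distrib[of 1 1 x] by simp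
      then show ?thesis using two by simp
    qed
    have "e2 + (- 1 / N a) \<triangleright> (a \<star> e3) = yp + yp" "e2 + (1 / N a) \<triangleright> (a \<star> e3) = ym + ym"
      unfolding ae3 e2_def by simp_all
    then show "yp = (1 / 2) \<triangleright> (e2 + (- 1 / N a) \<triangleright> (a \<star> e3))" "ym = (1 / 2) \<triangleright> (e2 + (1 / N a) \<triangleright> (a \<star> e3))"
      by (simp_all add: half)
  qed
  have S_gen: "e \<in> S" "w0 \<in> S" "a \<in> S" "yp \<in> S" "ym \<in> S"
  proof -
    show "e \<in> S" "w0 \<in> S" using D_gen S_D by auto
    show "a \<in> S" using S_a[OF S_D[OF D_gen(1)]] by simp
    have e: "e2 \<in> S" "a \<star> e3 \<in> S" using D_gen S_D S_a by auto
    show "yp \<in> S" by (subst y_eq(1)) (intro S_scale S_add e)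
    show "ym \<in> S" by (subst y_eq(2)) (intro S_scale S_add e)
  qed
  have expand: "\<exists>p1 q1 p2 q2 p3 q3. x = lsc p1 q1 ym + lsc p2 q2 w0 + lsc p3 q3 yp" if "x \<in> W" for x
    using generator_expansion[OF W(2) w0 W(1) _ _ that] \<phi>0 \<psi>1 unfolding yp_def ym_def by blast
  have sum: "\<exists>x\<in>D. \<exists>y\<in>D. z = x + a \<star> y" for z
  proof -
    obtain r s where rs: "z = r \<triangleright> e + s \<triangleright> a + (z - r \<triangleright> e - s \<triangleright> a)" "z - r \<triangleright> e - s \<triangleright> a \<in> W"
      using full_expansion by blast
    obtain p1 q1 p2 q2 p3 q3 where "z - r \<triangleright> e - s \<triangleright> a = lsc p1 q1 ym + lsc p2 q2 w0 + lsc p3 q3 yp"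
      using expand[OF rs(2)] by blast
    also have "\<dots> \<in> S" by (intro S_add S_lsc S_gen)
    finally have "r \<triangleright> e + s \<triangleright> a + (z - r \<triangleright> e - s \<triangleright> a) \<in> S" by (intro S_add S_scale S_gen)
    then have "z \<in> S" by simp
    then show ?thesis by (auto simp: S_def)
  qed
  obtain s where s: "octonion_automorphism scale mul e N s" "\<forall>x. s (s x) = x" "\<forall>x\<in>D. s x = x" "s a = - a"
    using reflection[OF subD D_gen(1) mult_orth orth sum] by blast
  interpret s: octonion_automorphism scale mul e N s by (rule s(1))
  have s_gen: "s w0 = w0" "s e2 = e2" "s e3 = e3" using s(3) D_gen by blast+
  have "s yp = (1 / 2) \<triangleright> (e2 + (1 / N a) \<triangleright> (a \<star> e3))" by (subst y_eq(1)) (simp add: s s_gen)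
  then have s_yp: "s yp = ym" using y_eq(2) by simp
  then have s_ym: "s ym = yp" using s(2) by metis
  have s_W: "s x \<in> W" if "x \<in> W" for x
    using that s.B_g[of x a] s(4) W_D by (intro W_I) (simp_all add: del: s.B_g)
  have B_gi: "B (gi x) y = B x (g y)" for x y using gi.B_g_left[of x y] by simp
  \<comment> \<open>This gives that \<open>s g s g\<close> fixes \<open>yp\<close>; for
    \<open>w0\<close> and \<open>ym\<close> the exchange of \<open>yp\<close> and \<open>ym\<close>
    is enough. Both sides are tested against the multiples of \<open>ym\<close>, \<open>w0\<close>,
    \<open>yp\<close> by \<open>k[a]\<close>, where invariance of \<open>B\<close> under
    \<open>g\<close> and \<open>s\<close> applies.\<close>
  have s_ggw: "s (g (g w0)) = gi (gi w0)"
  proof (rule W_eqI)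
    show "s (g (g w0)) \<in> W" "gi (gi w0) \<in> W" using w0 s_W by simp_all
    define d where "d = s (g (g w0)) - gi (gi w0)"
    have B_s: "B (s x) y = B x (s y)" for x y using s.B_g[of x "s y"] s(2) by (simp del: s.B_g)
    have B_d: "B d z = B (g (g w0)) (s z) - B (gi (gi w0)) z" for z by (simp add: d_def B_s)
    have 1: "B d w0 = 0"
      unfolding B_d s_gen B_gi by (simp add: B_commute)
    have 2: "B d yp = 0"
      unfolding B_d s_yp B_gi using B_g_left[of "g (g w0)" w0] by (simp add: yp_def ym_def B_commute)
    have 3: "B d ym = 0"
      unfolding B_d s_ym using B_gi[of w0 w0] by (simp add: yp_def ym_def B_commute)
    have a_gi: "B x (a \<star> gi y) = B (g x) (a \<star> y)" for x y using B_g_left[of x "a \<star> y"] by simp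
    have skew: "B (a \<star> d) z = - B d (a \<star> z)" "B y (a \<star> w0) = - B w0 (a \<star> y)" for y z
      using B_a_skew[of d z] B_a_skew[of w0 y] by (simp_all add: B_commute)
    have 4: "B (a \<star> d) w0 = 0"
      unfolding skew(1) B_d B_gi using skew(2)[of "g (g w0)"] by (simp add: s(4) s_gen)
    have 5: "B (a \<star> d) yp = 0"
      unfolding skew(1) B_d B_gi using skew(2)[of "g (g (g w0))"]
      by (simp add: s(4) s_yp) (simp add: yp_def ym_def a_gi)
    have "B (g (g w0)) (a \<star> g w0) = B (g w0) (a \<star> w0)"
      using B_g[of "g w0" "a \<star> w0"] by (simp del: B_g)
    then have 6: "B (a \<star> d) ym = 0"
      unfolding skew(1) B_d B_gi using skew(2)[of "g w0"]
      by (simp add: s(4) s_ym) (simp add: yp_def ym_def)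
    fix z assume "z \<in> W"
    then obtain p1 q1 p2 q2 p3 q3 where z: "z = lsc p1 q1 ym + lsc p2 q2 w0 + lsc p3 q3 yp" using expand by blast
    have "B d z = 0" unfolding z using 1 2 3 4 5 6 by (simp add: B_lsc B_a_skew)
    then show "B (s (g (g w0))) z = B (gi (gi w0)) z" by (simp add: d_def)
  qed
  define \<rho> where "\<rho> x = s (g (s (g x)))" for x
  have \<rho>_aut: "octonion_automorphism scale mul e N \<rho>" unfolding \<rho>_def
    using s(1) octonion_automorphism_axioms by (intro automorphism_comp[of s "\<lambda>x. g (s (g x))"] automorphism_comp[of g "\<lambda>x. s (g x)"] automorphism_comp[of s g])
  interpret \<rho>: octonion_automorphism scale mul e N \<rho> by (rule \<rho>_aut)
  have \<rho>_gen: "\<rho> a = a" "\<rho> w0 = w0" "\<rho> ym = ym" "\<rho> yp = yp"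
  proof -
    show "\<rho> a = a" using s by (simp add: \<rho>_def)
    show "\<rho> w0 = w0" using s_yp s_gen by (simp add: \<rho>_def yp_def ym_def)
    show "\<rho> ym = ym" using s_yp s_gen by (simp add: \<rho>_def yp_def ym_def)
    show "\<rho> yp = yp" using s_ggw s_ym by (simp add: \<rho>_def yp_def ym_def)
  qed
  have "\<rho> z = z" for z
  proof -
    obtain r t where rt: "z = r \<triangleright> e + t \<triangleright> a + (z - r \<triangleright> e - t \<triangleright> a)" "z - r \<triangleright> e - t \<triangleright> a \<in> W"
      using full_expansion by blast
    obtain p1 q1 p2 q2 p3 q3 where *: "z - r \<triangleright> e - t \<triangleright> a = lsc p1 q1 ym + lsc p2 q2 w0 + lsc p3 q3 yp"
      using expand[OF rt(2)] by blast
    have z: "z = r \<triangleright> e + t \<triangleright> a + (lsc p1 q1 ym + lsc p2 q2 w0 + lsc p3 q3 yp)" using rt(1) unfolding * .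
    show ?thesis unfolding z by (simp add: \<rho>_gen lsc_def)
  qed
  then show ?thesis unfolding inverted_def using s(1,2) by (auto simp: \<rho>_def)
qed

end

section \<open>Characteristic cubics with and without a root\<close>

context fixed_axis_basis
begin

abbreviation tr where "tr r \<equiv> alternating_rank3.t (T r) g u v w"
abbreviation tr' where "tr' r \<equiv> alternating_rank3.t' (T r) g u v w"

text \<open>If \<open>r\<close> lies in the base field, \<open>\<beta>\<close> prescribes one
  component of an element of \<open>k x k\<close>, and \<open>1 / \<beta>\<close> as the other
  component gives norm 1. Otherwise \<open>k[a]\<close> is a field, where a nonzero element has
  nonzero norm.\<close>

lemma ex_scalar:
  assumes r: "axis_root r" and \<beta>: "\<beta> \<in> K r" "\<beta> \<noteq> 0"
  shows "\<exists>p q. \<beta> = to_ac p + to_ac q * r \<and> p^2 + N a * q^2 \<noteq> 0 \<and> (r \<in> range to_ac \<longrightarrow> p^2 + N a * q^2 = 1)"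
proof (cases "r \<in> range to_ac")
  case True
  then obtain \<rho> where \<rho>: "r = to_ac \<rho>" by blast
  have \<rho>0: "\<rho> \<noteq> 0" using axis_root_nonzero[OF r] \<rho> by auto
  have Na: "N a = - (\<rho>^2)" using r by (simp add: axis_root_def \<rho> flip: to_ac_power to_ac_minus)
  obtain p q where "\<beta> = to_ac p + to_ac q * r" using \<beta>(1) by (rule K_E)
  then have "\<beta> = to_ac (p + q * \<rho>)" by (simp add: \<rho>)
  then obtain b where b: "\<beta> = to_ac b" by blast
  then have b0: "b \<noteq> 0" using \<beta>(2) by auto
  define P Q where "P = (b + 1 / b) / 2" and "Q = (b - 1 / b) / (2 * \<rho>)"
  have PQ: "Q * \<rho> = (b - 1 / b) / 2" using \<rho>0 by (simp add: Q_def)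
  have "P + Q * \<rho> = b" unfolding PQ P_def using two by (simp add: add_divide_distrib[symmetric] diff_divide_distrib[symmetric])
  moreover have "P - Q * \<rho> = 1 / b" unfolding PQ P_def using two by (simp add: add_divide_distrib[symmetric] diff_divide_distrib[symmetric])
  ultimately have "(P + Q * \<rho>) * (P - Q * \<rho>) = 1" using b0 by simp
  then have "P^2 + N a * Q^2 = 1" unfolding Na by (simp add: algebra_simps power2_eq_square)
  moreover have "\<beta> = to_ac P + to_ac Q * r"
    using \<open>P + Q * \<rho> = b\<close> by (simp add: b \<rho> flip: to_ac_mult to_ac_add)
  ultimately show ?thesis by (intro exI[of _ P] exI[of _ Q]) simp
next
  case False
  obtain p q where pq: "\<beta> = to_ac p + to_ac q * r" using \<beta>(1) by (rule K_E)
  have "p^2 + N a * q^2 \<noteq> 0"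
  proof
    assume "p^2 + N a * q^2 = 0"
    then have "to_ac (p^2 + N a * q^2) = 0" by simp
    moreover have "to_ac (N a) = - (r * r)" using r by (simp add: axis_root_def power2_eq_square)
    ultimately have "(to_ac p + to_ac q * r) * (to_ac p - to_ac q * r) = 0"
      by (simp add: algebra_simps power2_eq_square)
    then have eq: "to_ac p - to_ac q * r = 0" using \<beta>(2) pq by simp
    show False
    proof (cases "q = 0")
      case True
      then show False using eq pq \<beta>(2) by simp
    next
      case q: False
      then have "r = to_ac (p / q)" using eq by (simp add: field_simps)
      then show False using False by blast
    qed
  qed
  with pq False show ?thesis by blast
qed

text \<open>If the scalar \<open>p + q a\<close> above the root has norm 1, duality makes the
  resulting eigenvector anisotropic. Otherwise \<open>x0\<close> is isotropic and its dual
  \<open>y\<close> has a different eigenvalue; then the component in \<open>W\<close> of their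
  product is an anisotropic eigenvector.\<close>

lemma inverted_if_root:
  assumes r: "axis_root r" and \<beta>: "\<beta> \<in> K r" and root: "\<beta>^3 - tr r * \<beta>^2 + tr' r * \<beta> - 1 = 0"
  shows inverted
proof -
  interpret T: alternating_rank3 W "T r" g gi u v w "K r" by (rule T_alternating_rank3[OF r])
  have "\<beta> \<noteq> 0" using root by auto
  then obtain p q where pq: "\<beta> = to_ac p + to_ac q * r" "p^2 + N a * q^2 \<noteq> 0"
    "r \<in> range to_ac \<Longrightarrow> p^2 + N a * q^2 = 1"
    using ex_scalar[OF r \<beta>] by blast
  define n where "n = p^2 + N a * q^2"
  define h where "h z = lsc p q z - g z" for z
  have T_h: "T r (h x) y z = \<beta> * T r x y z - T r (g x) y z" if "x \<in> W" "y \<in> W" "z \<in> W" for x y z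
    unfolding h_def T_diff T_lsc[OF r that] pq(1) ..
  have hW: "h x \<in> W" if "x \<in> W" for x using that by (simp add: h_def)
  \<comment> \<open>In the eyes of \<open>T r\<close>, \<open>h\<close> is
    \<open>\<beta> - g\<close>; its determinant vanishes at the root, so \<open>h\<close> cannot be
    onto.\<close>
  have "h ` W \<noteq> W"
  proof
    assume surj: "h ` W = W"
    have "u \<in> h ` W" "v \<in> h ` W" "w \<in> h ` W" by (simp_all add: surj)
    then obtain x y z where xyz: "x \<in> W" "y \<in> W" "z \<in> W" "u = h x" "v = h y" "w = h z" by blast
    have "T r u v w = (\<beta>^3 - tr r * \<beta>^2 + tr' r * \<beta> - 1) * T r x y z"
      by (rule T.T_shift[OF xyz(1-3)]) (use xyz T_h hW in auto)
    then show False using root T.T_uvw by simp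
  qed
  then obtain x where x: "x \<in> W" "x \<notin> h ` W" using hW by blast
  have h_lin: "Vector_Spaces.linear scale scale h"
    by unfold_locales (simp_all add: h_def algebra_simps)
  then interpret h: Vector_Spaces.linear scale scale h .
  have "subspace W" by (auto simp: subspace_def)
  then have "subspace (h ` W)" by (rule h.subspace_image)
  then obtain y where y: "\<And>z. z \<in> W \<Longrightarrow> B y (h z) = 0" "B y x \<noteq> 0"
    using separation[OF _ x(2)] by blast
  \<comment> \<open>The components along \<open>e\<close> and \<open>a\<close> are removed; they do
    not affect the pairing with \<open>W\<close>.\<close>
  define x0 where "x0 = y - (B y e / 2) \<triangleright> e - (B y a / (2 * N a)) \<triangleright> a"
  have x0: "x0 \<in> W" using two by (simp add: x0_def W_def B_self)
  have "B x0 x = B y x" using W_D[OF x(1)] by (simp add: x0_def)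
  then have x0_nz: "x0 \<noteq> 0" using y(2) by auto
  have "lsc p (- q) x0 = gi x0"
  proof (rule W_eqI)
    fix z assume z: "z \<in> W"
    have "B x0 (h z) = 0" using y(1)[OF z] W_D[OF hW[OF z]] by (simp add: x0_def)
    then have "B x0 (lsc p q z) = B x0 (g z)" by (simp add: h_def)
    then show "B (lsc p (- q) x0) z = B (gi x0) z"
      using B_lsc_adjoint[of p "- q" x0 z] gi.B_g_left[of x0 z] by simp
  qed (use x0 in simp_all)
  then have "lsc p q (lsc p (- q) (g x0)) = lsc p q x0" by (metis g_gi(1) lsc_g(1))
  then have "n \<triangleright> g x0 = lsc p q x0" by (simp add: lsc_norm n_def)
  then have "(1 / n) \<triangleright> (n \<triangleright> g x0) = (1 / n) \<triangleright> lsc p q x0" by simp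
  then have gx0: "g x0 = lsc (p / n) (q / n) x0" using pq(2) by (simp add: n_def lsc_def scale_right_distrib)
  have n': "(p / n)^2 + N a * (q / n)^2 = 1 / n"
  proof -
    have "(p / n)^2 + N a * (q / n)^2 = n / (n * n)"
      by (simp add: n_def power_divide add_divide_distrib[symmetric]) (simp add: power2_eq_square)
    then show ?thesis using pq(2) by (simp add: n_def)
  qed
  have x0Z: "\<forall>b\<in>{e, a}. B x0 b = 0" using W_D[OF x0] by simp
  show ?thesis
  proof (cases "n = 1")
    case True
    then obtain y where y: "\<forall>b\<in>{e, a}. B y b = 0" "N y \<noteq> 0" "g y = lsc (p / n) (q / n) y"
      using lsc_anisotropic_eigenvector[OF stable_set_axis x0_nz gx0 x0Z] n' by auto
    then have "y \<in> W" by (simp add: W_def)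
    then show ?thesis using inverted_if_eigenvector y by blast
  next
    case False
    then have r_irr: "r \<notin> range to_ac" using pq(3) by (auto simp: n_def)
    have n0: "n \<noteq> 0" using pq(2) by (simp add: n_def)
    obtain y where y: "\<forall>b\<in>{e, a}. B y b = 0" "B y x0 \<noteq> 0"
      "lsc (p / n) (q / n) y = (1 / n) \<triangleright> g y"
      using lsc_dual_eigenvector[OF stable_set_axis x0_nz gx0 x0Z] unfolding n' by blast
    have yW: "y \<in> W" using y(1) by (simp add: W_def)
    have "n \<triangleright> lsc (p / n) (q / n) y = n \<triangleright> ((1 / n) \<triangleright> g y)" using y(3) by simp
    then have gy: "g y = lsc p q y" using n0 by (simp add: lsc_def scale_right_distrib)
    have "N x0 = (1 / n) * N x0" using N_lsc[of "p / n" "q / n" x0] unfolding n' by (simp flip: gx0)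
    then have "(1 - 1 / n) * N x0 = 0" by (simp add: algebra_simps)
    moreover have "1 - 1 / n \<noteq> 0" using False n0 by (simp add: field_simps)
    ultimately have Nx0: "N x0 = 0" by (metis mult_eq_0_iff)
    \<comment> \<open>\<open>m\<close> is isotropic, while its component in \<open>k[a]\<close> is
      nonzero, hence anisotropic because \<open>k[a]\<close> is a field here. So its component
      \<open>z\<close> in \<open>W\<close> is anisotropic as well.\<close>
    define m where "m = x0 \<star> y"
    define c d where "c = B m e / 2" and "d = B m a / (2 * N a)"
    define z where "z = m - c \<triangleright> e - d \<triangleright> a"
    have zW: "z \<in> W" using two by (simp add: z_def c_def d_def W_def B_self)
    have B_z: "B z t = \<phi> t x0 y" if "t \<in> W" for t
      using W_D[OF that] by (simp add: z_def m_def \<phi>_def B_commute)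
    have "B m e = - B x0 y" using W_D[OF yW] by (simp add: m_def B_e_mul)
    then have c0: "c \<noteq> 0" using y(2) two by (simp add: c_def B_commute[of x0])
    \<comment> \<open>By invariance and \<open>k[a]\<close>-linearity of the trilinear form, the
      eigenvalue at \<open>z\<close> is the conjugate of the product of the eigenvalues at
      \<open>x0\<close> and \<open>y\<close>.\<close>
    have "g z = lsc (p / n) (- q / n) (lsc p (- q) z)"
    proof (rule W_eqI)
      fix t assume t: "t \<in> W"
      have "B (g z) t = \<phi> (gi t) x0 y" using t B_z[of "gi t"] by (simp add: B_g_left)
      also have "\<dots> = \<phi> t (g x0) (g y)" using B_g_left[of "x0 \<star> y" t] by (simp add: \<phi>_def B_commute)
      also have "\<dots> = \<phi> t (lsc (p / n) (q / n) x0) (lsc p q y)" by (simp add: gx0 gy)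
      also have "\<dots> = \<phi> (lsc p q (lsc (p / n) (q / n) t)) x0 y"
        using t x0 yW by (simp add: \<phi>_lsc)
          (simp add: lsc_def algebra_simps)
      also have "\<dots> = B z (lsc p q (lsc (p / n) (q / n) t))" using B_z t by simp
      also have "\<dots> = B (lsc (p / n) (- q / n) (lsc p (- q) z)) t"
        using B_lsc_adjoint[of p "- q" z "lsc (p / n) (q / n) t"]
          B_lsc_adjoint[of "p / n" "- q / n" "lsc p (- q) z" t] by simp
      finally show "B (g z) t = B (lsc (p / n) (- q / n) (lsc p (- q) z)) t" .
    qed (use zW in simp_all)
    moreover have "N z \<noteq> 0"
    proof
      assume "N z = 0"
      have "m = z + (c \<triangleright> e + d \<triangleright> a)" by (simp add: z_def)
      moreover have "N m = 0" by (simp add: m_def N_mult Nx0)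
      moreover have "N (c \<triangleright> e + d \<triangleright> a) = c^2 + d^2 * N a" by (simp add: N_add N_scale)
      moreover have "B z (c \<triangleright> e + d \<triangleright> a) = 0" using W_D[OF zW] by simp
      ultimately have eq: "c^2 + d^2 * N a = 0" using \<open>N z = 0\<close> by (simp add: N_add)
      then have d0: "d \<noteq> 0" using c0 by auto
      have "c^2 = - N a * d^2" using eq by (simp add: eq_neg_iff_add_eq_0 mult.commute)
  then have "- N a = (c / d)^2" using d0 by (simp add: power_divide)
      then have "r^2 = (to_ac (c / d))^2" using r \<open>- N a = (c / d)^2\<close> by (simp only: axis_root_def flip: to_ac_minus to_ac_power)
      then have "r = to_ac (c / d) \<or> r = to_ac (- (c / d))" unfolding power2_eq_iff by simp
      then show False using r_irr by blast
    qed
    ultimately show ?thesis using inverted_if_eigenvector[OF zW] unfolding lsc_lsc by blast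
  qed
qed

text \<open>One polynomial in \<open>g\<close> over \<open>k[a]\<close> has to normalize
  \<open>T\<close> under both homomorphisms. For split \<open>k[a]\<close> the two conditions are
  independent and their solutions are glued; for a field they are conjugate, and a solution of one
  solves the other.\<close>

lemma inverted_if_no_root:
  assumes cd: "cd_le_one TYPE('a)"
    and no_root: "\<And>r \<beta>. axis_root r \<Longrightarrow> \<beta> \<in> K r \<Longrightarrow> \<beta>^3 - tr r * \<beta>^2 + tr' r * \<beta> - 1 \<noteq> 0"
  shows inverted
proof -
  obtain r where r: "axis_root r" using ex_axis_root by blast
  have r': "axis_root (- r)" using r by (rule axis_root_minus)
  define \<tau> where "\<tau> r = T r u (g u) (g (g u))" for r
  have \<tau>: "\<tau> r \<noteq> 0" "\<exists>P0\<in>K r. \<exists>P1\<in>K r. \<exists>P2\<in>K r. cubic_norm (tr r) (tr' r) P0 P1 P2 = 1 / \<tau> r"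
    if r: "axis_root r" for r
  proof -
    interpret T: alternating_rank3 W "T r" g gi u v w "K r" by (rule T_alternating_rank3[OF r])
    show \<tau>0: "\<tau> r \<noteq> 0" unfolding \<tau>_def
      by (rule T.generator[OF _ T.uvw T.T_uvw]) (rule no_root[OF r])
    have "1 / \<tau> r \<in> K r" by (simp add: \<tau>_def)
    then show "\<exists>P0\<in>K r. \<exists>P1\<in>K r. \<exists>P2\<in>K r. cubic_norm (tr r) (tr' r) P0 P1 P2 = 1 / \<tau> r"
      using \<tau>0 no_root[OF r]
      by (intro cubic_norm_surjective[OF cd two_ac subfield_K[OF r] subset_adjoin_sqrt(1)[OF subfield_range] T.t_K]) simp_all
  qed
  define E where "E r p q = to_ac p + to_ac q * r" for r :: "'a alg_closure" and p q
  have "\<exists>p0 q0 p1 q1 p2 q2.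
    cubic_norm (tr r) (tr' r) (E r p0 q0) (E r p1 q1) (E r p2 q2) = 1 / \<tau> r \<and>
    cubic_norm (tr (- r)) (tr' (- r)) (E (- r) p0 q0) (E (- r) p1 q1) (E (- r) p2 q2) = 1 / \<tau> (- r)"
  proof (cases "r \<in> range to_ac")
    case True
    then obtain \<rho> where \<rho>: "r = to_ac \<rho>" by blast
    have \<rho>0: "\<rho> \<noteq> 0" using axis_root_nonzero[OF r] \<rho> by auto
    have K_range: "\<exists>p. x = to_ac p" if "x \<in> K r \<or> x \<in> K (- r)" for x
    proof -
      have "\<exists>p q. x = to_ac p + to_ac q * r \<or> x = to_ac p + to_ac q * (- r)" using that K_E by metis
      then obtain p q where "x = to_ac (p + q * \<rho>) \<or> x = to_ac (p - q * \<rho>)" by (auto simp: \<rho>)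
      then show ?thesis by blast
    qed
    \<comment> \<open>The Chinese remainder theorem for \<open>k[a] = k x k\<close>.\<close>
    have glue: "\<exists>p q. E r p q = x \<and> E (- r) p q = y" if xy: "x \<in> K r" "y \<in> K (- r)" for x y
    proof -
      obtain b c where bc: "x = to_ac b" "y = to_ac c" using K_range xy by metis
      define p q where "p = (b + c) / 2" and "q = (b - c) / (2 * \<rho>)"
      have q: "q * \<rho> = (b - c) / 2" using \<rho>0 by (simp add: q_def)
      have "p + q * \<rho> = b" "p - q * \<rho> = c"
        unfolding q p_def using two by (simp_all add: add_divide_distrib[symmetric] diff_divide_distrib[symmetric])
      then show ?thesis
        by (intro exI[of _ p] exI[of _ q]) (simp add: E_def \<rho> bc flip: to_ac_mult to_ac_add to_ac_diff)
    qed
    obtain P0 P1 P2 where P: "P0 \<in> K r" "P1 \<in> K r" "P2 \<in> K r" "cubic_norm (tr r) (tr' r) P0 P1 P2 = 1 / \<tau> r"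
      using \<tau>(2)[OF r] by blast
    obtain Q0 Q1 Q2 where Q: "Q0 \<in> K (- r)" "Q1 \<in> K (- r)" "Q2 \<in> K (- r)"
      "cubic_norm (tr (- r)) (tr' (- r)) Q0 Q1 Q2 = 1 / \<tau> (- r)"
      using \<tau>(2)[OF r'] by blast
    show ?thesis using glue[OF P(1) Q(1)] glue[OF P(2) Q(2)] glue[OF P(3) Q(3)] P(4) Q(4) by metis
  next
    case False
    \<comment> \<open>The conjugation that negates \<open>r\<close>, as a relation compatible with
      the field operations. It takes \<open>T r\<close> to \<open>T (- r)\<close>, hence the norm
      equation at \<open>r\<close> to the one at \<open>- r\<close>.\<close>
    define R where "R x y \<longleftrightarrow> (\<exists>p q. x = E r p q \<and> y = E (- r) p q)" for x y
    have rr: "r * r = - to_ac (N a)" using r by (simp add: axis_root_def power2_eq_square)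
    have R_E: "R (E r p q) (E (- r) p q)" for p q by (auto simp: R_def)
    have R_const: "R (to_ac p) (to_ac p)" for p using R_E[of p 0] by (simp add: E_def)
    have R_add: "R (x + x') (y + y')" if xy: "R x y" "R x' y'" for x x' y y'
    proof -
      obtain p q p' q' where "x = E r p q" "y = E (- r) p q" "x' = E r p' q'" "y' = E (- r) p' q'"
        using xy by (auto simp: R_def)
      moreover have "E s p q + E s p' q' = E s (p + p') (q + q')" for s by (simp add: E_def algebra_simps)
      ultimately show ?thesis using R_E by simp
    qed
    have R_mult: "R (x * x') (y * y')" if xy: "R x y" "R x' y'" for x x' y y'
    proof -
      obtain p q p' q' where *: "x = E r p q" "y = E (- r) p q" "x' = E r p' q'" "y' = E (- r) p' q'"
        using xy by (auto simp: R_def)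
      have "E s p q * E s p' q' = E s (p * p' - N a * q * q') (p * q' + q * p')" if "s * s = - to_ac (N a)" for s
        using that by (simp add: E_def algebra_simps) (simp flip: mult.assoc)
      from this[of r] this[of "- r"] show ?thesis unfolding * using rr R_E by simp
    qed
    have R_minus: "R (x - x') (y - y')" if xy: "R x y" "R x' y'" for x x' y y'
      using R_add[OF xy(1) R_mult[OF R_const[of "- 1"] xy(2)]] by simp
    have R_inverse: "R (inverse x) (inverse y)" if xy: "R x y" "x \<noteq> 0" for x y
    proof -
      obtain p q where *: "x = E r p q" "y = E (- r) p q" using xy by (auto simp: R_def)
      have prod: "E r p q * E (- r) p q = to_ac (p^2 + N a * q^2)"
        using rr by (simp add: E_def algebra_simps power2_eq_square) (simp flip: mult.assoc)
      have nz: "p^2 + N a * q^2 \<noteq> 0"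
      proof
        assume "p^2 + N a * q^2 = 0"
        then have "E (- r) p q = 0" using prod xy(2) * by auto
        then have eq: "to_ac p = to_ac q * r" by (simp add: E_def)
        show False
        proof (cases "q = 0")
          case True
          then show False using eq xy(2) * by (simp add: E_def)
        next
          case q: False
          then have "r = to_ac (p / q)" using eq by (simp add: field_simps)
          then show False using False by blast
        qed
      qed
      define c where "c = 1 / (p^2 + N a * q^2)"
      have c: "to_ac c * to_ac (p^2 + N a * q^2) = 1"
      proof -
        have "c * (p^2 + N a * q^2) = 1" using nz by (simp add: c_def)
        then have "to_ac (c * (p^2 + N a * q^2)) = to_ac 1" by (rule arg_cong)
        then show ?thesis by (simp only: to_ac_mult to_ac_1)
      qed
      have "inverse x = to_ac c * y" "inverse y = to_ac c * x"
        using c prod by (auto intro!: inverse_unique simp: * mult_ac)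
      moreover have "R (to_ac c * y) (to_ac c * x)"
      proof -
        have "R y x" using R_E[of p "- q"] by (simp add: * E_def)
        then show ?thesis by (intro R_mult R_const)
      qed
      ultimately show ?thesis by simp
    qed
    have R_unique: "y = y'" if xy: "R x y" "R x y'" for x y y'
    proof -
      obtain p q where 1: "x = E r p q" "y = E (- r) p q" using xy(1) by (auto simp: R_def)
      obtain p' q' where 2: "x = E r p' q'" "y' = E (- r) p' q'" using xy(2) by (auto simp: R_def)
      have "to_ac p + to_ac q * r = to_ac p' + to_ac q' * r" using 1(1) 2(1) by (simp add: E_def)
      then have "to_ac p = to_ac p' \<and> to_ac q = to_ac q'"
        by (intro adjoin_sqrt_unique[OF subfield_range False]) auto
      then show ?thesis using 1 2 by simp
    qed
    have R_T: "R (T r x y z) (T (- r) x y z)" for x y z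
      using R_E[of "\<psi> x y z" "\<phi> x y z"] by (simp add: T_def E_def add.commute mult.commute)
    interpret T: alternating_rank3 W "T r" g gi u v w "K r" by (rule T_alternating_rank3[OF r])
    interpret T': alternating_rank3 W "T (- r)" g gi u v w "K (- r)" by (rule T_alternating_rank3[OF r'])
    have R_t: "R (tr r) (tr (- r))" "R (tr' r) (tr' (- r))"
      unfolding T.t_def T'.t_def T.t'_def T'.t'_def divide_inverse
      by (intro R_mult R_add R_T R_inverse T.T_uvw)+
    obtain P0 P1 P2 where P: "P0 \<in> K r" "P1 \<in> K r" "P2 \<in> K r" "cubic_norm (tr r) (tr' r) P0 P1 P2 = 1 / \<tau> r"
      using \<tau>(2)[OF r] by blast
    obtain p0 q0 where P0: "P0 = E r p0 q0" using K_E[OF P(1)] by (metis E_def)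
    obtain p1 q1 where P1: "P1 = E r p1 q1" using K_E[OF P(2)] by (metis E_def)
    obtain p2 q2 where P2: "P2 = E r p2 q2" using K_E[OF P(3)] by (metis E_def)
    have num: "R (numeral k) (numeral k)" for k using R_const[of "numeral k"] by simp
    have "R (cubic_norm (tr r) (tr' r) (E r p0 q0) (E r p1 q1) (E r p2 q2))
       (cubic_norm (tr (- r)) (tr' (- r)) (E (- r) p0 q0) (E (- r) p1 q1) (E (- r) p2 q2))"
      unfolding cubic_norm_def power2_eq_square power3_eq_cube
      by (intro R_add R_mult R_minus R_E R_t num)
    then have 1: "R (1 / \<tau> r) (cubic_norm (tr (- r)) (tr' (- r)) (E (- r) p0 q0) (E (- r) p1 q1) (E (- r) p2 q2))"
      using P(4) by (simp add: P0 P1 P2)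
    have 2: "R (1 / \<tau> r) (1 / \<tau> (- r))"
      using R_inverse[OF R_T, of u "g u" "g (g u)"] \<tau>(1)[OF r] by (simp add: \<tau>_def divide_inverse)
    show ?thesis using R_unique[OF 1 2] P(4) unfolding P0 P1 P2 by blast
  qed
  then obtain p0 q0 p1 q1 p2 q2 where pq:
    "cubic_norm (tr r) (tr' r) (E r p0 q0) (E r p1 q1) (E r p2 q2) = 1 / \<tau> r"
    "cubic_norm (tr (- r)) (tr' (- r)) (E (- r) p0 q0) (E (- r) p1 q1) (E (- r) p2 q2) = 1 / \<tau> (- r)" by blast
  define x where "x = lsc p0 q0 u + lsc p1 q1 (g u) + lsc p2 q2 (g (g u))"
  have x: "x \<in> W" by (simp add: x_def)
  have T1: "T s x (g x) (g (g x)) = 1"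
    if s: "axis_root s" and n: "cubic_norm (tr s) (tr' s) (E s p0 q0) (E s p1 q1) (E s p2 q2) = 1 / \<tau> s" for s
  proof -
    interpret T: alternating_rank3 W "T s" g gi u v w "K s" by (rule T_alternating_rank3[OF s])
    have "T s x y z = E s p0 q0 * T s u y z + E s p1 q1 * T s (g u) y z + E s p2 q2 * T s (g (g u)) y z"
      if "y \<in> W" "z \<in> W" for y z
      unfolding x_def T_add E_def using that s by (simp add: T_lsc)
    then have "T s x (g x) (g (g x)) = cubic_norm (tr s) (tr' s) (E s p0 q0) (E s p1 q1) (E s p2 q2) * T s u (g u) (g (g u))"
      by (intro T.T_cubic_norm x) simp_all
    then show ?thesis using n \<tau>(1)[OF s] by (simp add: \<tau>_def)
  qed
  \<comment> \<open>The value 1 at both \<open>r\<close> and \<open>- r\<close> means that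
    \<open>\<phi>\<close> vanishes and \<open>\<psi>\<close> is 1.\<close>
  have T: "r * to_ac (\<phi> x (g x) (g (g x))) + to_ac (\<psi> x (g x) (g (g x))) = 1"
    "- r * to_ac (\<phi> x (g x) (g (g x))) + to_ac (\<psi> x (g x) (g (g x))) = 1"
    using T1[OF r pq(1)] T1[OF r' pq(2)] by (simp_all add: T_def)
  then have "2 * (r * to_ac (\<phi> x (g x) (g (g x)))) = 0" by Groebner_Basis.algebra
  then have \<phi>0: "\<phi> x (g x) (g (g x)) = 0" using two_ac axis_root_nonzero[OF r] by simp
  then have "to_ac (\<psi> x (g x) (g (g x))) = to_ac 1" using T(1) by simp
  then have "\<psi> x (g x) (g (g x)) = 1" by (simp only: to_ac_eq_iff)
  \<comment> \<open>The middle vector \<open>g x\<close> is taken as \<open>w0\<close>, so that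
    \<open>x\<close> becomes \<open>gi w0\<close>.\<close>
  with \<phi>0 x show ?thesis by (intro inverted_if_generator[of "g x"]) simp_all
qed

end

section \<open>The inverting involution and the factorization of \<open>g\<close>\<close>

lemma (in fixed_axis) inverted:
  assumes "cd_le_one TYPE('a)"
  shows inverted
proof -
  obtain u where u: "u \<in> W" "N u \<noteq> 0" using ex_first by blast
  obtain v where v: "v \<in> W" "N v \<noteq> 0" "B u v = 0" "B (a \<star> u) v = 0" using ex_second[OF u] by blast
  interpret fixed_axis_basis scale mul e N g a u v by unfold_locales (use u v in auto)
  show ?thesis using inverted_if_root inverted_if_no_root[OF assms] by blast
qed

theorem theorem6p13:
  fixes scale :: "'a :: field \<Rightarrow> 'c :: ab_group_add \<Rightarrow> 'c"
    and mul :: "'c \<Rightarrow> 'c \<Rightarrow> 'c" and e :: 'c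
  defines "G \<equiv> octonion_algebra.aut_group scale mul e"
  assumes "CHAR('a) \<noteq> 2"
    and "cd_le_one TYPE('a)"
    and "octonion_algebra scale mul e"
    and "g \<in> carrier G"
    and "semisimple_endo scale g"
  shows "\<exists>s t. involution G s \<and> involution G t \<and> g = s \<otimes>\<^bsub>G\<^esub> t"
proof -
  interpret octonion_algebra scale mul e by fact
  have two: "(2 :: 'a) \<noteq> 0"
  proof
    assume "(2 :: 'a) = 0"
    then have "of_nat 2 = (0 :: 'a)" by simp
    then have "CHAR('a) dvd 2" by (simp only: of_nat_eq_0_iff_char_dvd)
    then have "CHAR('a) = 1" using assms(2) two_is_prime_nat prime_nat_iff by blast
    then show False by (simp add: CHAR_not_1')
  qed
  obtain N where N: "quadratic_form scale N" "nondegenerate N" "\<And>x y. N (mul x y) = N x * N y"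
    using ex_norm by blast
  have g: "bij g" "Vector_Spaces.linear scale scale g" "g e = e" "\<And>x y. g (mul x y) = mul (g x) (g y)"
    using assms(5) by (auto simp: G_def aut_group_def)
  have "semisimple_automorphism scale mul e N g"
    by (intro semisimple_automorphism.intro octonion_automorphism.intro normed_octonion.intro
        normed_octonion_axioms.intro octonion_automorphism_axioms.intro semisimple_automorphism_axioms.intro)
      (fact octonion_algebra_axioms N two g assms(6))+
  then interpret semisimple_automorphism scale mul e N g .
  obtain a where a: "g a = a" "B a e = 0" "N a \<noteq> 0" using ex_fixed_axis by blast
  interpret fixed_axis scale mul e N g a by unfold_locales (use a in auto)
  have inverted by (rule inverted) fact
  then obtain s where s: "octonion_automorphism scale mul e N s" "\<And>x. s (s x) = x" "\<And>x. s (g (s (g x))) = x"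
    by (auto simp: inverted_def)
  have aut: "t \<in> carrier G" if "octonion_automorphism scale mul e N t" for t
  proof -
    interpret t: octonion_automorphism scale mul e N t by fact
    show ?thesis using t.g_bij t.g_linear by (simp add: G_def aut_group_def)
  qed
  have "octonion_automorphism scale mul e N (\<lambda>x. s (g x))"
    by (rule automorphism_comp[OF s(1) octonion_automorphism_axioms])
  moreover have G_simps: "x \<otimes>\<^bsub>G\<^esub> y = x \<circ> y" "\<one>\<^bsub>G\<^esub> = id" for x y
    by (simp_all add: G_def aut_group_def)
  ultimately have "involution G (\<lambda>x. s (g x))" "involution G s"
    unfolding involution_def G_simps using aut s by (auto simp: fun_eq_iff)
  moreover have "g = s \<otimes>\<^bsub>G\<^esub> (\<lambda>x. s (g x))"
    unfolding G_simps using s(2) by (auto simp: fun_eq_iff)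
  ultimately show ?thesis by blast
qed

end
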